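(* Let $X$ and $Y$ be Banach spaces and let $\Omega$ be a compact Hausdorff space with Borel $\sigma$-algebra $\Sigma$. Assume that $S\in\mathcal{L}(\mathcal{C}(\Omega),\mathcal{L}(X,Y))$ and let $m:\Sigma\rightarrow\mathcal{L}(X,Y^{**})$ be its representing measure. The following statements are equivalent. (a) There exists an operator $U\in\mathcal{L}(\mathcal{C}(\Omega,X),Y)$ such that $U^{\#}=S$. (b) There exists a constant $c>0$ such that, for every sequence $(E_{i})$ of pairwise disjoint sets in $\Sigma$ and every sequence $(x_{i})$ in $B_{X}$, the inequality $\|(m(E_{i})x_{i})\|_{1}^{w}\leq c$ holds.
   Context: All Banach spaces are over the same field $\mathbb{K}$ ($\mathbb{R}$ or $\mathbb{C}$); $B_X$ is the closed unit ball of $X$; $\mathcal{L}(X,Y)$ is the Banach space of bounded linear operators. For a sequence $(w_i)$ in a Banach space $W$, $\|(w_i)\|_1^w=\sup_{w^*\in B_{W^*}}\sum_i|w^*(w_i)|$. $\mathcal{C}(\Omega)$ and $\mathcal{C}(\Omega,X)$ are the Banach spaces of continuous $\mathbb{K}$-valued and $X$-valued functions on $\Omega$ with the supremum norm. For $U\in\mathcal{L}(\mathcal{C}(\Omega,X),Y)$, the associated operator $U^{\#}\in\mathcal{L}(\mathcal{C}(\Omega),\mathcal{L}(X,Y))$ is $(U^{\#}\varphi)x=U(\varphi x)$, where $\varphi x$ is the function $\omega\mapsto\varphi(\omega)x$. Representing measure: for $T\in\mathcal{L}(\mathcal{C}(\Omega),Y)$, its (classical) representing measure is the finitely additive vector measure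 $\Sigma\to Y^{**}$, $E\mapsto T^{**}(\chi_E)$, where the bounded Borel function $\chi_E$ is viewed as an element of $\mathcal{C}(\Omega)^{**}$ by integration against the regular Borel measures $\mathcal{C}(\Omega)^*$; it satisfies $T\varphi=\int_\Omega\varphi\,dm$ for $\varphi\in\mathcal{C}(\Omega)$. For $S\in\mathcal{L}(\mathcal{C}(\Omega),\mathcal{L}(X,Y))$ and $x\in X$, let $S_x\in\mathcal{L}(\mathcal{C}(\Omega),Y)$ be $S_x\varphi=(S\varphi)x$, with representing measure $m_x:\Sigma\to Y^{**}$. The representing measure $m:\Sigma\to\mathcal{L}(X,Y^{**})$ of $S$ is the finitely additive measure defined by $m(E)x=m_x(E)$, $E\in\Sigma$, $x\in X$. *)

theory Defs
  imports "HOL-Analysis.Analysis"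
begin

section \<open>Banach spaces over the real or complex numbers\<close>

text \<open>The scalar field is a type variable ranging over (isometric copies of) the real and the
  complex numbers, so that one statement covers both cases.\<close>

class real_or_complex = real_normed_field + banach +
  assumes real_or_complex:
    "\<exists>\<iota> :: 'a \<Rightarrow> complex.
       (\<forall>a b. \<iota> (a + b) = \<iota> a + \<iota> b) \<and> (\<forall>a b. \<iota> (a * b) = \<iota> a * \<iota> b) \<and>
       (\<forall>r a. \<iota> (r *\<^sub>R a) = r *\<^sub>R \<iota> a) \<and> (\<forall>a. norm (\<iota> a) = norm a) \<and>
       (range \<iota> = \<real> \<or> range \<iota> = UNIV)"

instance real :: real_or_complex
proof
  show "\<exists>\<iota> :: real \<Rightarrow> complex.
       (\<forall>a b. \<iota> (a + b) = \<iota> a + \<iota> b) \<and> (\<forall>a b. \<iota> (a * b) = \<iota> a * \<iota> b) \<and>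
       (\<forall>r a. \<iota> (r *\<^sub>R a) = r *\<^sub>R \<iota> a) \<and> (\<forall>a. norm (\<iota> a) = norm a) \<and>
       (range \<iota> = \<real> \<or> range \<iota> = UNIV)"
    by (rule exI[of _ complex_of_real]) (auto simp: Reals_def scaleR_conv_of_real)
qed

instance complex :: real_or_complex
proof
  show "\<exists>\<iota> :: complex \<Rightarrow> complex.
       (\<forall>a b. \<iota> (a + b) = \<iota> a + \<iota> b) \<and> (\<forall>a b. \<iota> (a * b) = \<iota> a * \<iota> b) \<and>
       (\<forall>r a. \<iota> (r *\<^sub>R a) = r *\<^sub>R \<iota> a) \<and> (\<forall>a. norm (\<iota> a) = norm a) \<and>
       (range \<iota> = \<real> \<or> range \<iota> = UNIV)"
    by (rule exI[of _ "\<lambda>z. z"]) auto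
qed

text \<open>Isabelle's class of Banach spaces is a class of real spaces. A Banach space over the
  scalar field is such a type together with a scalar multiplication that extends the real one.\<close>

locale banach_space_over = vector_space scale
  for scale :: "'k::real_or_complex \<Rightarrow> 'a::banach \<Rightarrow> 'a" +
  assumes scale_of_real: "scale (of_real r) x = r *\<^sub>R x"
    and norm_scale: "norm (scale a x) = norm a * norm x"

lemma banach_space_over_scalars: "banach_space_over ((*) :: 'k::real_or_complex \<Rightarrow> _)"
  by unfold_locales (auto simp: algebra_simps scaleR_conv_of_real norm_mult)

text \<open>Bounded operators that are linear over the scalar field. The type \<open>'a \<Rightarrow>\<^sub>L 'b\<close> only asks
  for linearity over the reals; the operator norm is the same.\<close>

definition bounded_ops ::
  "('k::real_or_complex \<Rightarrow> 'a::real_normed_vector \<Rightarrow> 'a) \<Rightarrow>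
   ('k \<Rightarrow> 'b::real_normed_vector \<Rightarrow> 'b) \<Rightarrow> ('a \<Rightarrow>\<^sub>L 'b) set"
  where "bounded_ops sa sb = {T. Vector_Spaces.linear sa sb (blinfun_apply T)}"

definition blinfun_scale ::
  "('k::real_or_complex \<Rightarrow> 'b::banach \<Rightarrow> 'b) \<Rightarrow>
   'k \<Rightarrow> ('a::real_normed_vector \<Rightarrow>\<^sub>L 'b) \<Rightarrow> ('a \<Rightarrow>\<^sub>L 'b)"
  where "blinfun_scale s a T = Blinfun (\<lambda>x. s a (blinfun_apply T x))"

lemma (in banach_space_over) bounded_linear_scale_right: "bounded_linear (scale a)"
proof (rule bounded_linear_intro[of _ "norm a"])
  fix r x
  have "scale a (r *\<^sub>R x) = scale (a * of_real r) x"
    by (simp flip: scale_of_real)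
  also have "\<dots> = r *\<^sub>R scale a x"
    by (simp add: mult.commute flip: scale_of_real)
  finally show "scale a (r *\<^sub>R x) = r *\<^sub>R scale a x" .
qed (simp_all add: scale_right_distrib norm_scale mult.commute)

lemma (in banach_space_over) bounded_linear_scale_left: "bounded_linear (\<lambda>a. scale a x)"
proof (rule bounded_linear_intro[of _ "norm x"])
  fix r a
  show "scale (r *\<^sub>R a) x = r *\<^sub>R scale a x"
    by (simp add: scaleR_conv_of_real[of r a] flip: scale_of_real)
qed (simp_all add: scale_left_distrib norm_scale)

lemma (in banach_space_over) blinfun_scale_apply:
  "blinfun_apply (blinfun_scale scale a T) x = scale a (blinfun_apply T x)"
  unfolding blinfun_scale_def
  by (subst bounded_linear_Blinfun_apply)
    (auto intro: bounded_linear_compose[OF bounded_linear_scale_right] blinfun.bounded_linear_right)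

lemma (in banach_space_over) vector_space_blinfun_scale:
  "vector_space (blinfun_scale scale :: 'k \<Rightarrow> ('b::real_normed_vector \<Rightarrow>\<^sub>L 'a) \<Rightarrow> _)"
  by unfold_locales
    (auto intro!: blinfun_eqI simp: blinfun_scale_apply blinfun.add_left
      scale_left_distrib scale_right_distrib)

section \<open>Spaces of continuous functions\<close>

text \<open>For compact \<open>\<Omega>\<close> every continuous function is bounded, so \<open>\<C>(\<Omega>,X)\<close> is the type
  \<open>'w \<Rightarrow>\<^sub>C 'x\<close> with its supremum norm. The functions to which \<open>Bcontfun\<close> is applied below are
  continuous and bounded.\<close>

definition cont_scale ::
  "('k::real_or_complex \<Rightarrow> 'x::banach \<Rightarrow> 'x) \<Rightarrow>
   'k \<Rightarrow> ('w::topological_space \<Rightarrow>\<^sub>C 'x) \<Rightarrow> ('w \<Rightarrow>\<^sub>C 'x)"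
  where "cont_scale s a f = Bcontfun (\<lambda>\<omega>. s a (apply_bcontfun f \<omega>))"

definition cont_tensor ::
  "('k::real_or_complex \<Rightarrow> 'x::banach \<Rightarrow> 'x) \<Rightarrow>
   ('w::topological_space \<Rightarrow>\<^sub>C 'k) \<Rightarrow> 'x \<Rightarrow> ('w \<Rightarrow>\<^sub>C 'x)"
  where "cont_tensor s \<phi> x = Bcontfun (\<lambda>\<omega>. s (apply_bcontfun \<phi> \<omega>) x)"

text \<open>This is \<open>U\<^sup>#\<close>; both uses of \<open>Blinfun\<close> are applied to bounded linear maps, see
  \<open>associated_op_apply\<close>.\<close>

definition associated_op ::
  "('k::real_or_complex \<Rightarrow> 'x::banach \<Rightarrow> 'x) \<Rightarrow>
   (('w::topological_space \<Rightarrow>\<^sub>C 'x) \<Rightarrow>\<^sub>L 'y::banach) \<Rightarrow> ('w \<Rightarrow>\<^sub>C 'k) \<Rightarrow>\<^sub>L ('x \<Rightarrow>\<^sub>L 'y)"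
  where "associated_op s U =
    Blinfun (\<lambda>\<phi>. Blinfun (\<lambda>x. blinfun_apply U (cont_tensor s \<phi> x)))"

lemma bounded_linear_image_bcontfun:
  assumes "bounded_linear h"
  shows "(\<lambda>\<omega>. h (apply_bcontfun f \<omega>)) \<in> bcontfun"
proof -
  have "bounded (h ` range (apply_bcontfun f))"
    by (rule bounded_linear_image[OF bounded_apply_bcontfun assms])
  then show ?thesis
    by (auto simp: bcontfun_def image_image
        intro: bounded_linear.continuous_on[OF assms])
qed

lemma (in banach_space_over) cont_scale_apply:
  "apply_bcontfun (cont_scale scale a f) \<omega> = scale a (apply_bcontfun f \<omega>)"
  unfolding cont_scale_def
  by (subst Bcontfun_inverse)
    (rule bounded_linear_image_bcontfun[OF bounded_linear_scale_right], rule refl)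

lemma (in banach_space_over) vector_space_cont_scale:
  "vector_space (cont_scale scale :: 'k \<Rightarrow> ('w::topological_space \<Rightarrow>\<^sub>C 'a) \<Rightarrow> _)"
  by unfold_locales
    (auto intro!: bcontfun_eqI simp: cont_scale_apply scale_left_distrib scale_right_distrib)

lemma (in banach_space_over) cont_tensor_apply:
  "apply_bcontfun (cont_tensor scale \<phi> x) \<omega> = scale (apply_bcontfun \<phi> \<omega>) x"
  unfolding cont_tensor_def
  by (subst Bcontfun_inverse)
    (rule bounded_linear_image_bcontfun[OF bounded_linear_scale_left], rule refl)

lemma (in banach_space_over) norm_cont_tensor_le:
  "norm (cont_tensor scale \<phi> x) \<le> norm \<phi> * norm x"
  by (rule norm_bound) (simp add: cont_tensor_apply norm_scale mult_right_mono norm_bounded)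

lemma (in banach_space_over) associated_op_apply:
  fixes U :: "('w::topological_space \<Rightarrow>\<^sub>C 'a) \<Rightarrow>\<^sub>L 'y::banach"
  shows "blinfun_apply (blinfun_apply (associated_op scale U) \<phi>) x
     = blinfun_apply U (cont_tensor scale \<phi> x)"
proof -
  have add: "cont_tensor scale \<phi> (x + y) = cont_tensor scale \<phi> x + cont_tensor scale \<phi> y"
    "cont_tensor scale (\<phi> + \<psi>) x = cont_tensor scale \<phi> x + cont_tensor scale \<psi> x"
    "cont_tensor scale \<phi> (r *\<^sub>R x) = r *\<^sub>R cont_tensor scale \<phi> x"
    "cont_tensor scale (r *\<^sub>R \<phi>) x = r *\<^sub>R cont_tensor scale \<phi> x"
    for \<phi> \<psi> :: "'w \<Rightarrow>\<^sub>C 'k" and x y r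
    by (auto intro!: bcontfun_eqI simp: cont_tensor_apply scale_left_distrib scale_right_distrib
        linear_simps(5)[OF bounded_linear_scale_right] linear_simps(5)[OF bounded_linear_scale_left])
  have bound: "norm (blinfun_apply U (cont_tensor scale \<phi> x)) \<le> norm U * norm \<phi> * norm x"
    for \<phi> :: "'w \<Rightarrow>\<^sub>C 'k" and x
    by (rule order_trans[OF norm_blinfun])
      (simp add: mult.assoc mult_left_mono norm_cont_tensor_le)
  have inner: "blinfun_apply (Blinfun (\<lambda>x. blinfun_apply U (cont_tensor scale \<phi> x))) x
      = blinfun_apply U (cont_tensor scale \<phi> x)" for \<phi> :: "'w \<Rightarrow>\<^sub>C 'k" and x
    by (subst bounded_linear_Blinfun_apply)
      (auto intro!: bounded_linear_intro[of _ "norm U * norm \<phi>"] order_trans[OF bound]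
        simp: add blinfun.add_right blinfun.scaleR_right mult_ac)
  define V where "V = (\<lambda>\<phi> :: 'w \<Rightarrow>\<^sub>C 'k. Blinfun (\<lambda>x. blinfun_apply U (cont_tensor scale \<phi> x)))"
  have V: "blinfun_apply (V \<phi>) x = blinfun_apply U (cont_tensor scale \<phi> x)" for \<phi> x
    by (simp add: V_def inner)
  have "bounded_linear V"
  proof (rule bounded_linear_intro[of _ "norm U"])
    fix \<phi>
    show "norm (V \<phi>) \<le> norm \<phi> * norm U"
      by (rule norm_blinfun_bound) (simp_all add: V bound mult.commute[of "norm \<phi>"])
  qed (auto intro!: blinfun_eqI simp: V add blinfun.add_left blinfun.add_right
      blinfun.scaleR_left blinfun.scaleR_right)
  then show ?thesis
    by (simp add: associated_op_def bounded_linear_Blinfun_apply V flip: V_def)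
qed

section \<open>Duals and the weak summing norm\<close>

text \<open>Iterated duals over a fixed scalar field are not types, since the scalar multiplication is
  a term. They are described by an explicit carrier and explicit operations; functionals are
  plain functions, made extensional outside the carrier.\<close>

record ('k, 'v) normed_space_over =
  carrier :: "'v set"
  add :: "'v \<Rightarrow> 'v \<Rightarrow> 'v"
  smult :: "'k \<Rightarrow> 'v \<Rightarrow> 'v"
  nrm :: "'v \<Rightarrow> real"

definition space_of ::
  "('k \<Rightarrow> 'a::real_normed_vector \<Rightarrow> 'a) \<Rightarrow> ('k, 'a) normed_space_over"
  where "space_of s = \<lparr>carrier = UNIV, add = (+), smult = s, nrm = norm\<rparr>"

definition unit_ball :: "('k, 'v) normed_space_over \<Rightarrow> 'v set"
  where "unit_ball V = {v \<in> carrier V. nrm V v \<le> 1}"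

definition dual ::
  "('k::real_or_complex, 'v) normed_space_over \<Rightarrow> ('k, 'v \<Rightarrow> 'k) normed_space_over"
  where "dual V =
    \<lparr>carrier = {f \<in> extensional (carrier V).
        (\<forall>u\<in>carrier V. \<forall>v\<in>carrier V. f (add V u v) = f u + f v) \<and>
        (\<forall>a. \<forall>v\<in>carrier V. f (smult V a v) = a * f v) \<and>
        (\<exists>C. \<forall>v\<in>carrier V. norm (f v) \<le> C * nrm V v)},
     add = (\<lambda>f g. \<lambda>v\<in>carrier V. f v + g v),
     smult = (\<lambda>a f. \<lambda>v\<in>carrier V. a * f v),
     nrm = (\<lambda>f. SUP v\<in>unit_ball V. norm (f v))\<rparr>"

definition adjoint_op ::
  "('k::real_or_complex, 'v) normed_space_over \<Rightarrow> ('k, 'w) normed_space_over \<Rightarrow>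
   ('v \<Rightarrow> 'w) \<Rightarrow> ('w \<Rightarrow> 'k) \<Rightarrow> ('v \<Rightarrow> 'k)"
  where "adjoint_op V W T = (\<lambda>g\<in>carrier (dual W). \<lambda>v\<in>carrier V. g (T v))"

definition biadjoint_op ::
  "('k::real_or_complex, 'v) normed_space_over \<Rightarrow> ('k, 'w) normed_space_over \<Rightarrow>
   ('v \<Rightarrow> 'w) \<Rightarrow> (('v \<Rightarrow> 'k) \<Rightarrow> 'k) \<Rightarrow> (('w \<Rightarrow> 'k) \<Rightarrow> 'k)"
  where "biadjoint_op V W T = adjoint_op (dual W) (dual V) (adjoint_op V W T)"

definition weak_l1_norm ::
  "('k::real_or_complex, 'v) normed_space_over \<Rightarrow> (nat \<Rightarrow> 'v) \<Rightarrow> ennreal"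
  where "weak_l1_norm W w = (SUP f\<in>unit_ball (dual W). \<Sum>i. ennreal (norm (f (w i))))"

section \<open>Regular Borel measures and representing measures\<close>

text \<open>Scalar measures are set functions of which only the values on Borel sets matter.
  Regularity is that of Dunford and Schwartz: the variation is small on the difference of an
  open superset and a compact subset.\<close>

definition regular_borel_measure ::
  "('w::topological_space set \<Rightarrow> 'k::real_or_complex) \<Rightarrow> bool"
  where "regular_borel_measure \<mu> \<longleftrightarrow>
    (\<forall>A :: nat \<Rightarrow> 'w set. range A \<subseteq> sets borel \<longrightarrow> disjoint_family A \<longrightarrow>
        (\<lambda>i. \<mu> (A i)) sums \<mu> (\<Union>i. A i)) \<and>
    (\<forall>E\<in>sets borel. \<forall>\<epsilon>>0. \<exists>F G. compact F \<and> open G \<and> F \<subseteq> E \<and> E \<subseteq> G \<and>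
        (\<forall>A\<in>sets borel. A \<subseteq> G - F \<longrightarrow> norm (\<mu> A) < \<epsilon>))"

text \<open>The integral of a bounded function is the limit of the integrals of simple functions that
  converge to it uniformly.\<close>

definition has_measure_integral ::
  "('w::topological_space set \<Rightarrow> 'k::real_or_complex) \<Rightarrow> ('w \<Rightarrow> 'k) \<Rightarrow> 'k \<Rightarrow> bool"
  where "has_measure_integral \<mu> f I \<longleftrightarrow>
    (\<exists>s :: nat \<Rightarrow> 'w \<Rightarrow> 'k. (\<forall>n. simple_function borel (s n)) \<and>
       uniform_limit UNIV s f sequentially \<and>
       (\<lambda>n. \<Sum>a\<in>range (s n). a * \<mu> (s n -` {a})) \<longlonglongrightarrow> I)"

definition cont_space ::
  "('k::real_or_complex, 'w::topological_space \<Rightarrow>\<^sub>C 'k) normed_space_over"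
  where "cont_space = space_of (cont_scale (*))"

text \<open>\<open>\<chi>\<^sub>E\<close> as an element of \<open>\<C>(\<Omega>)\<^sup>*\<^sup>*\<close>: a functional is sent to the value at \<open>E\<close> of the
  regular Borel measure that represents it by the Riesz theorem. The description ranges over that
  value, not over the measure, because set functions may differ on non-Borel sets.\<close>

definition indicator_bidual ::
  "'w::topological_space set \<Rightarrow> (('w \<Rightarrow>\<^sub>C 'k::real_or_complex) \<Rightarrow> 'k) \<Rightarrow> 'k"
  where "indicator_bidual E = (\<lambda>l\<in>carrier (dual cont_space).
    THE a. \<exists>\<mu>. regular_borel_measure \<mu> \<and>
      (\<forall>\<phi>. has_measure_integral \<mu> (apply_bcontfun \<phi>) (l \<phi>)) \<and> a = \<mu> E)"

definition representing_measure ::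
  "('k::real_or_complex \<Rightarrow> 'y::banach \<Rightarrow> 'y) \<Rightarrow>
   (('w::topological_space \<Rightarrow>\<^sub>C 'k) \<Rightarrow> 'y) \<Rightarrow> 'w set \<Rightarrow> ('y \<Rightarrow> 'k) \<Rightarrow> 'k"
  where "representing_measure sy T E =
    biadjoint_op cont_space (space_of sy) T (indicator_bidual E)"

definition operator_representing_measure ::
  "('k::real_or_complex \<Rightarrow> 'y::banach \<Rightarrow> 'y) \<Rightarrow>
   (('w::topological_space \<Rightarrow>\<^sub>C 'k) \<Rightarrow>\<^sub>L ('x::banach \<Rightarrow>\<^sub>L 'y)) \<Rightarrow>
   'w set \<Rightarrow> 'x \<Rightarrow> ('y \<Rightarrow> 'k) \<Rightarrow> 'k"
  where "operator_representing_measure sy S E x =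
    representing_measure sy (\<lambda>\<phi>. blinfun_apply (blinfun_apply S \<phi>) x) E"

end

theory Submission
  imports Defs
begin

text \<open>For (a) \<open>\<Longrightarrow>\<close> (b), the value of \<open>m(E)x\<close> at \<open>y\<^sup>*\<close> is the \<open>E\<close>-measure of the regular Borel
  measure representing \<open>\<phi> \<mapsto> y\<^sup>*((S\<phi>)x)\<close>. By regularity a sum \<open>\<Sum> a\<^sub>i m(E\<^sub>i)x\<^sub>i\<close> with \<open>|a\<^sub>i| \<le> 1\<close> is
  approximated at \<open>y\<^sup>*\<close> by \<open>y\<^sup>*(U(\<Sum> a\<^sub>i \<phi>\<^sub>i x\<^sub>i))\<close>, where the \<open>\<phi>\<^sub>i \<ge> 0\<close> are close to \<open>\<chi>\<close> of the \<open>E\<^sub>i\<close> and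
  \<open>\<Sum> \<phi>\<^sub>i \<le> 1\<close>, so it has norm at most \<open>\<parallel>U\<parallel>\<close>.
  For (b) \<open>\<Longrightarrow>\<close> (a), \<open>f = \<Sum> \<phi>\<^sub>j x\<^sub>j\<close> is almost constant on the sets \<open>E\<^sub>i\<close> of a fine Borel partition, so
  \<open>y\<^sup>*(\<Sum> (S\<phi>\<^sub>j)x\<^sub>j)\<close> is close to \<open>\<Sum> m(E\<^sub>i)(f(\<omega>\<^sub>i))(y\<^sup>*)\<close>, which (b) bounds by \<open>c \<parallel>f\<parallel>\<close>; hence
  \<open>\<phi>x \<mapsto> (S\<phi>)x\<close> extends to \<open>\<C>(\<Omega>,X)\<close> by density.
  The Riesz representation of a scalar functional \<open>l\<close> comes from its modulus
  \<open>|l|(f) = sup {|l(g)| : |g| \<le> f}\<close>, which is additive on nonnegative functions and yields a positive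
  regular measure \<open>\<nu>\<close> by Caratheodory's construction; \<open>l\<close> extends to \<open>L\<^sup>1(\<nu>)\<close>, and the representing
  measure of \<open>E\<close> is the value of the extension at \<open>\<chi>\<close> of \<open>E\<close>.\<close>

text \<open>The weak summing norm in (b) tests with functionals on the bidual of Y, that is with
  elements of the third dual, whereas integration controls \<open>m E x\<close> only at points of
  the first dual. For (a) to (b) the gap closes because a finite rotated sum is a single element of
  the bidual, and its norm is a supremum over the ball of the dual alone. For (b) to (a) it suffices
  to test with evaluations at the ball of the dual, since Hahn-Banach makes that ball norming. The
  value of the indicator of \<open>E\<close> at a functional is only given by a description, so its
  linearity and boundedness have to be earned. Identities pass from continuous functions to
  \<open>E\<close> through one Urysohn function that is close to the indicator for finitely many
  regular measures at once. Integral estimates are phrased with the supremum of |mu(A)| over Borel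
  sets \<open>A\<close> instead of the variation. The price is the recurring factor 4: two real
  coordinates times two signs.\<close>

text \<open>Coordinates that serve both scalar fields: in the complex case \<open>j\<close> is the
  preimage of the imaginary unit, in the real case \<open>j = 0\<close> and \<open>im = 0\<close>.
  The two cases have to be told apart only where \<open>j * j\<close> occurs.\<close>

lemma real_or_complex_parts:
  obtains re im :: "'k::real_or_complex \<Rightarrow> real" and j :: 'k
  where "\<And>a b. re (a + b) = re a + re b" "\<And>a b. im (a + b) = im a + im b"
    "\<And>a. \<bar>re a\<bar> \<le> norm a" "\<And>a. \<bar>im a\<bar> \<le> norm a"
    "\<And>a. norm a \<le> \<bar>re a\<bar> + \<bar>im a\<bar>"
    "\<And>a. a = of_real (re a) + j * of_real (im a)"
    "\<And>r s. re (of_real r + j * of_real s) = r"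
    "j * j = -1 \<or> (j = 0 \<and> (\<forall>a. im a = 0))"
proof -
  obtain \<iota> :: "'k \<Rightarrow> complex" where
    add: "\<And>a b. \<iota> (a + b) = \<iota> a + \<iota> b" and mult: "\<And>a b. \<iota> (a * b) = \<iota> a * \<iota> b" and
    scaleR: "\<And>r a. \<iota> (r *\<^sub>R a) = r *\<^sub>R \<iota> a" and nrm: "\<And>a. norm (\<iota> a) = norm a" and
    rng: "range \<iota> = \<real> \<or> range \<iota> = UNIV"
    using real_or_complex by metis
  have "\<iota> 1 * \<iota> 1 = \<iota> 1" "\<iota> 1 \<noteq> 0"
    using mult[of 1 1] nrm[of 1] by auto
  then have one: "\<iota> 1 = 1" by simp
  have real: "\<iota> (of_real r) = of_real r" for r
    using scaleR[of r 1] one by (simp add: of_real_def)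
  have eqI: "a = b" if "\<iota> a = \<iota> b" for a b
  proof -
    have "\<iota> (a - b) = 0"
      using add[of "a - b" b] that by simp
    then show ?thesis using nrm[of "a - b"] by simp
  qed
  show thesis
  proof (cases "range \<iota> = \<real>")
    case True
    then have R: "\<iota> a = of_real (Re (\<iota> a))" for a
      by (metis rangeI of_real_Re)
    show thesis
    proof (rule that[of "\<lambda>a. Re (\<iota> a)" "\<lambda>a. 0" 0])
      show "norm a \<le> \<bar>Re (\<iota> a)\<bar> + \<bar>0\<bar>" for a
        using nrm[of a] R[of a] by (metis abs_zero add.right_neutral norm_of_real order_refl)
      show "a = of_real (Re (\<iota> a)) + 0 * of_real 0" for a
        using R by (intro eqI) (simp add: real)
    qed (simp_all add: add real abs_Re_le_cmod flip: nrm)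
  next
    case False
    then obtain j where j: "\<iota> j = \<i>"
      using rng by (metis UNIV_I rangeE)
    show thesis
    proof (rule that[of "\<lambda>a. Re (\<iota> a)" "\<lambda>a. Im (\<iota> a)" j])
      have "\<iota> (-1) = -1" using real[of "-1"] by simp
      then have "j * j = -1" by (intro eqI) (simp add: mult j)
      then show "j * j = -1 \<or> (j = 0 \<and> (\<forall>a. Im (\<iota> a) = 0))" ..
      show "a = of_real (Re (\<iota> a)) + j * of_real (Im (\<iota> a))" for a
        by (intro eqI) (simp add: real add mult j complex_eq mult.commute)
    qed (simp_all add: add mult j real abs_Re_le_cmod abs_Im_le_cmod cmod_le flip: nrm)
  qed
qed

lemma unimodular_multiplier:
  fixes a :: "'k::real_normed_field"
  obtains u where "norm u = 1" "u * a = of_real (norm a)"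
proof (cases "a = 0")
  case True
  then show thesis using that[of 1] by simp
next
  case False
  then show thesis using that[of "of_real (norm a) / a"] by (simp add: norm_divide)
qed

section \<open>The Hahn--Banach theorem\<close>

definition sublinear :: "('a::real_vector \<Rightarrow> real) \<Rightarrow> bool"
  where "sublinear q \<longleftrightarrow> (\<forall>x y. q (x + y) \<le> q x + q y) \<and> (\<forall>r x. 0 \<le> r \<longrightarrow> q (r *\<^sub>R x) = r * q x)"

lemma sublinear_add: "sublinear q \<Longrightarrow> q (x + y) \<le> q x + q y"
  and sublinear_scale: "sublinear q \<Longrightarrow> 0 \<le> r \<Longrightarrow> q (r *\<^sub>R x) = r * q x"
  by (auto simp: sublinear_def)

lemma sublinear_zero: "sublinear q \<Longrightarrow> q 0 = 0"
  using sublinear_scale[of q 0 0] by simp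

lemma sublinear_minus: "sublinear q \<Longrightarrow> - q (- x) \<le> q x"
  using sublinear_add[of q x "- x"] sublinear_zero[of q] by simp

text \<open>One-sided homogeneity suffices: applied to \<open>inverse r\<close> at
  \<open>r *\<^sub>R x\<close>, it gives the reverse inequality.\<close>

lemma sublinearI:
  assumes add: "\<And>x y. q (x + y) \<le> q x + q y"
    and zero: "q 0 = 0"
    and scale: "\<And>r x. 0 < r \<Longrightarrow> q (r *\<^sub>R x) \<le> r * q x"
  shows "sublinear q"
proof -
  have "q (r *\<^sub>R x) = r * q x" if "0 < r" for r x
  proof (rule antisym[OF scale[OF that]])
    have "q x \<le> inverse r * q (r *\<^sub>R x)"
      using scale[of "inverse r" "r *\<^sub>R x"] that by simp
    then show "r * q x \<le> q (r *\<^sub>R x)"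
      using that by (simp add: field_simps)
  qed
  then show ?thesis
    using zero add by (auto simp: sublinear_def le_less[of 0])
qed

text \<open>The largest \<open>p \<le> q\<close> with \<open>p (x + t y) = p x + t q(y)\<close> for \<open>t \<ge> 0\<close>.\<close>

definition directional :: "('a::real_vector \<Rightarrow> real) \<Rightarrow> 'a \<Rightarrow> 'a \<Rightarrow> real"
  where "directional q y x = (INF t\<in>{0..}. q (x + t *\<^sub>R y) - t * q y)"

text \<open>Keeps the infimum in \<open>directional\<close> from being a default value.\<close>

lemma directional_bdd:
  assumes "sublinear q"
  shows "bdd_below ((\<lambda>t. q (x + t *\<^sub>R y) - t * q y) ` {0..})"
proof (rule bdd_belowI2)
  fix t :: real assume "t \<in> {0..}"
  then show "- q (- x) \<le> q (x + t *\<^sub>R y) - t * q y"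
    using sublinear_add[OF assms, of "x + t *\<^sub>R y" "- x"] sublinear_scale[OF assms, of t y]
    by simp
qed

lemma directional_le:
  assumes "sublinear q" "0 \<le> t"
  shows "directional q y x \<le> q (x + t *\<^sub>R y) - t * q y"
  unfolding directional_def using assms by (intro cINF_lower directional_bdd) auto

text \<open>Near-optimal parameters \<open>s\<close> for \<open>x\<close> and \<open>t\<close> for
  \<open>z\<close> are combined into \<open>s + t\<close> for \<open>x + z\<close>; for homogeneity
  the parameter is rescaled from \<open>t\<close> to \<open>r * t\<close>.\<close>

lemma sublinear_directional:
  assumes q: "sublinear q"
  shows "sublinear (directional q y)"
proof (rule sublinearI)
  fix x z
  have "directional q y (x + z) - (q (x + s *\<^sub>R y) - s * q y) \<le> q (z + t *\<^sub>R y) - t * q y"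
    if "0 \<le> s" "0 \<le> t" for s t
  proof -
    have "directional q y (x + z) \<le> q ((x + z) + (s + t) *\<^sub>R y) - (s + t) * q y"
      using that by (intro directional_le q) simp
    moreover have "q ((x + z) + (s + t) *\<^sub>R y) \<le> q (x + s *\<^sub>R y) + q (z + t *\<^sub>R y)"
      using sublinear_add[OF q, of "x + s *\<^sub>R y" "z + t *\<^sub>R y"] by (simp add: algebra_simps)
    ultimately show ?thesis by (simp add: algebra_simps)
  qed
  then have "directional q y (x + z) - (q (x + s *\<^sub>R y) - s * q y) \<le> directional q y z"
    if "0 \<le> s" for s
    unfolding directional_def[of q y z] using that by (intro cINF_greatest) auto
  then have "directional q y (x + z) - directional q y z \<le> q (x + s *\<^sub>R y) - s * q y"
    if "0 \<le> s" for s
    using that by (smt (verit))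
  then have "directional q y (x + z) - directional q y z \<le> directional q y x"
    unfolding directional_def[of q y x] by (intro cINF_greatest) auto
  then show "directional q y (x + z) \<le> directional q y x + directional q y z"
    by simp
next
  have "q (0 + t *\<^sub>R y) - t * q y = 0" if "t \<ge> 0" for t
    using sublinear_scale[OF q that, of y] by simp
  then show "directional q y 0 = 0"
    unfolding directional_def by (subst INF_cong[where D = "\<lambda>_. 0"]) auto
next
  fix r :: real and x assume r: "0 < r"
  have "inverse r * directional q y (r *\<^sub>R x) \<le> q (x + t *\<^sub>R y) - t * q y" if "0 \<le> t" for t
  proof -
    have "directional q y (r *\<^sub>R x) \<le> q (r *\<^sub>R x + (r * t) *\<^sub>R y) - (r * t) * q y"
      using that r by (intro directional_le q) simp
    also have "\<dots> = r * (q (x + t *\<^sub>R y) - t * q y)"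
      using r sublinear_scale[OF q, of r "x + t *\<^sub>R y"] by (simp add: algebra_simps)
    finally show ?thesis using r by (simp add: field_simps)
  qed
  then have "inverse r * directional q y (r *\<^sub>R x) \<le> directional q y x"
    unfolding directional_def[of q y x] by (intro cINF_greatest) auto
  then show "directional q y (r *\<^sub>R x) \<le> r * directional q y x"
    using r by (simp add: field_simps)
qed

lemma directional_le_self: "sublinear q \<Longrightarrow> directional q y x \<le> q x"
  using directional_le[of q 0 y x] by simp

text \<open>A minimal sublinear functional coincides with all its modifications \<open>directional q y\<close>,
  which makes it superadditive.\<close>

theorem linear_below_sublinear:
  fixes p :: "'a::real_vector \<Rightarrow> real"
  assumes p: "sublinear p"
  obtains f where "linear f" "\<And>x. f x \<le> p x"
proof -
  define A where "A = {q :: 'a \<Rightarrow> real. sublinear q \<and> (\<forall>x. q x \<le> p x)}"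
  \<comment> \<open>The order is reversed, so that the maximal element found by Zorn's lemma is a
    minimal sublinear functional.\<close>
  define P where "P = (\<lambda>a b :: 'a \<Rightarrow> real. \<forall>x. b x \<le> a x)"
  have max: "\<exists>u\<in>A. \<forall>a\<in>A. P u a \<longrightarrow> a = u"
  proof (rule predicate_Zorn)
    show "partial_order_on A (relation_of P A)"
    proof (rule partial_order_on_relation_ofI)
      show "P a a" for a by (simp add: P_def)
      show "P a c" if "P a b" "P b c" for a b c using that order_trans unfolding P_def by blast
      show "a = b" if "P a b" "P b a" for a b using that antisym unfolding P_def by blast
    qed
  next
    fix C assume "C \<in> Chains (relation_of P A)"
    then have CA: "C \<subseteq> A" and total: "\<And>a b. a \<in> C \<Longrightarrow> b \<in> C \<Longrightarrow> P a b \<or> P b a"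
      by (auto simp: Chains_def relation_of_def)
    show "\<exists>u\<in>A. \<forall>a\<in>C. P a u"
    proof (cases "C = {}")
      case True
      then show ?thesis using p by (auto simp: A_def)
    next
      case False
      define u where "u = (\<lambda>x. INF q\<in>C. q x)"
      have sub: "sublinear q" if "q \<in> C" for q using CA that by (auto simp: A_def)
      have le_p: "q x \<le> p x" if "q \<in> C" for q x using CA that by (auto simp: A_def)
      have bdd: "bdd_below ((\<lambda>q. q x) ` C)" for x
      proof (rule bdd_belowI2)
        fix q assume "q \<in> C"
        then show "- p (- x) \<le> q x"
          using sublinear_minus[OF sub, of q x] le_p[of q "- x"] by simp
      qed
      have u_le: "u x \<le> q x" if "q \<in> C" for q x
        unfolding u_def using bdd that by (rule cINF_lower)
      have u_ge: "c \<le> u x" if "\<And>q. q \<in> C \<Longrightarrow> c \<le> q x" for c x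
        unfolding u_def using False that by (rule cINF_greatest)
      have "sublinear u"
      proof (rule sublinearI)
        fix x y
        have *: "u (x + y) \<le> q x + r y" if qr: "q \<in> C" "r \<in> C" for q r
        proof -
          \<comment> \<open>The smaller of \<open>q\<close> and \<open>r\<close> in the chain bounds
            both summands; this is where totality of the chain enters.\<close>
          obtain s where "s \<in> C" "s x \<le> q x" "s y \<le> r y"
            using total[OF qr] qr order.refl unfolding P_def by metis
          then show ?thesis
            using u_le[of s "x + y"] sublinear_add[OF sub, of s x y] by simp
        qed
        have "u (x + y) - q x \<le> u y" if "q \<in> C" for q
          using *[OF that] by (intro u_ge) (simp add: algebra_simps)
        then have "u (x + y) - u y \<le> u x"
          by (intro u_ge) (simp add: algebra_simps)
        then show "u (x + y) \<le> u x + u y" by simp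
      next
        show "u 0 = 0"
        proof (rule antisym)
          show "0 \<le> u 0" by (rule u_ge) (simp add: sublinear_zero sub)
          obtain q where "q \<in> C" using False by blast
          then show "u 0 \<le> 0" using u_le[of q 0] by (simp add: sublinear_zero sub)
        qed
      next
        fix r :: real and x assume r: "0 < r"
        have "inverse r * u (r *\<^sub>R x) \<le> u x"
        proof (rule u_ge)
          fix q assume "q \<in> C"
          then show "inverse r * u (r *\<^sub>R x) \<le> q x"
            using u_le[of q "r *\<^sub>R x"] sublinear_scale[OF sub, of q r x] r by (simp add: field_simps)
        qed
        then show "u (r *\<^sub>R x) \<le> r * u x" using r by (simp add: field_simps)
      qed
      moreover have "u x \<le> p x" for x
        using False u_le le_p by (meson all_not_in_conv order_trans)
      ultimately show ?thesis
        using u_le by (intro bexI[of _ u]) (auto simp: A_def P_def)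
    qed
  qed
  obtain f where f: "sublinear f" "\<And>x. f x \<le> p x"
    and min: "\<And>q. sublinear q \<Longrightarrow> (\<And>x. q x \<le> f x) \<Longrightarrow> q = f"
  proof -
    from max obtain u where u: "u \<in> A" "\<And>a. a \<in> A \<Longrightarrow> P u a \<Longrightarrow> a = u" by blast
    show thesis
    proof (rule that)
      show "sublinear u" "u x \<le> p x" for x using u(1) by (auto simp: A_def)
      fix q assume q: "sublinear q" "\<And>x. q x \<le> u x"
      have "q x \<le> p x" for x using q(2)[of x] u(1) by (auto simp: A_def intro: order_trans)
      with q show "q = u" by (intro u(2)) (auto simp: A_def P_def)
    qed
  qed
  \<comment> \<open>With parameter \<open>t = 1\<close> this identity becomes
    \<open>f x + f y \<le> f (x + y)\<close>.\<close>
  have "directional f y = f" for y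
    using min[of "directional f y"] sublinear_directional directional_le_self f(1) by blast
  then have "f x \<le> f (x + y) - f y" for x y
    using directional_le[OF f(1), of 1 y x] by simp
  then have add: "f (x + y) = f x + f y" for x y
    using sublinear_add[OF f(1), of x y] by (smt (verit))
  have minus: "f (- x) = - f x" for x
    using add[of x "- x"] sublinear_zero[OF f(1)] by simp
  have "linear f"
  proof (rule linearI)
    fix r x show "f (r *\<^sub>R x) = r *\<^sub>R f x"
      using sublinear_scale[OF f(1), of r x] sublinear_scale[OF f(1), of "- r" x] minus[of "r *\<^sub>R x"]
      by (cases "0 \<le> r") auto
  qed (rule add)
  with f(2) show thesis using that by blast
qed

text \<open>Dominating by \<open>directional norm x\<close> instead of the norm replaces the
  extension from the line through \<open>x\<close>: its value at \<open>- x\<close> is at most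
  \<open>- norm x\<close>, which forces \<open>f x\<close> up to \<open>norm x\<close>.\<close>

lemma (in banach_space_over) norming_functional:
  obtains f where "f \<in> unit_ball (dual (space_of scale))" "norm x \<le> norm (f x)"
proof -
  interpret scale: banach_space_over scale by unfold_locales
  have norm: "sublinear (norm :: 'a \<Rightarrow> real)"
    by (auto simp: sublinear_def norm_triangle_ineq)
  obtain f where f: "linear f" "\<And>y. f y \<le> directional norm x y"
    using linear_below_sublinear[OF sublinear_directional[OF norm]] by metis
  have f_le: "f y \<le> norm y" for y
    using f(2) directional_le_self[OF norm] order_trans by blast
  have "f (- x) \<le> - norm x"
    using f(2)[of "- x"] directional_le[OF norm, of 1 x "- x"] by simp
  then have f_x: "norm x \<le> f x"
    using linear_neg[OF f(1), of x] by simp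
  obtain re im :: "'k \<Rightarrow> real" and j :: 'k where
    "\<And>a b. re (a + b) = re a + re b" "\<And>a b. im (a + b) = im a + im b" and
    re_le: "\<And>a. \<bar>re a\<bar> \<le> norm a" and "\<And>a. \<bar>im a\<bar> \<le> norm a"
    "\<And>a. norm a \<le> \<bar>re a\<bar> + \<bar>im a\<bar>" and
    decomp: "\<And>a. a = of_real (re a) + j * of_real (im a)" and
    re: "\<And>r s. re (of_real r + j * of_real s) = r" and
    j: "j * j = -1 \<or> (j = 0 \<and> (\<forall>a. im a = 0))"
    by (rule real_or_complex_parts) (rule that)
  \<comment> \<open>The functional over the scalar field with real part \<open>f\<close>. For real
    scalars \<open>j = 0\<close>, and \<open>g\<close> is \<open>f\<close> itself.\<close>
  define g where "g = (\<lambda>y. of_real (f y) + j * of_real (- f (scale j y)))"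
  have re_g: "re (g y) = f y" for y by (simp only: g_def re)
  have re_real: "re (of_real r) = r" for r using re[of r 0] by simp
  have g_add: "g (y + z) = g y + g z" for y z
    by (simp add: g_def linear_add[OF f(1)] scale_right_distrib algebra_simps)
  have g_scale: "g (scale a y) = a * g y" for a y
  proof -
    have expand: "scale a z = re a *\<^sub>R z + im a *\<^sub>R scale j z" for z
    proof -
      have "scale a z = scale (of_real (re a)) z + scale (of_real (im a)) (scale j z)"
        by (subst decomp[of a]) (simp add: scale_left_distrib mult.commute)
      then show ?thesis by (simp only: scale_of_real)
    qed
    have a: "f (scale a y) = re a * f y + im a * f (scale j y)"
      by (simp add: expand linear_add[OF f(1)] linear_cmul[OF f(1)])
    have "scale j (scale a y) = scale a (scale j y)"
      by (simp add: mult.commute)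
    also have "f \<dots> = re a * f (scale j y) + im a * f (scale j (scale j y))"
      by (simp only: expand linear_add[OF f(1)] linear_cmul[OF f(1)] real_scaleR_def)
    finally have ja: "f (scale j (scale a y)) = re a * f (scale j y) + im a * f (scale (j * j) y)"
      by (simp only: scale_scale)
    from j show ?thesis
    proof
      assume j: "j * j = -1"
      have "a * g y = (of_real (re a) + j * of_real (im a)) * g y" by (subst decomp[of a]) simp
      also have "\<dots> = of_real (re a) * of_real (f y) - (j * j) * of_real (im a) * of_real (f (scale j y))
         + j * (of_real (im a) * of_real (f y) - of_real (re a) * of_real (f (scale j y)))"
        by (simp add: g_def algebra_simps)
      also have "\<dots> = g (scale a y)"
        unfolding g_def a ja j by (simp add: linear_neg[OF f(1)] algebra_simps)
      finally show ?thesis ..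
    next
      assume "j = 0 \<and> (\<forall>a. im a = 0)"
      then show ?thesis using a decomp[of a] by (simp add: g_def)
    qed
  qed
  have g_le: "norm (g y) \<le> norm y" for y
  proof -
    \<comment> \<open>After the rotation by \<open>u\<close> the value of \<open>g\<close> is real,
      hence equal to its real part, which \<open>f_le\<close> bounds.\<close>
    obtain u where u: "norm u = 1" "u * g y = of_real (norm (g y))"
      by (rule unimodular_multiplier)
    have "norm (g y) = re (g (scale u y))" by (simp add: g_scale u re_real)
    also have "\<dots> \<le> norm (scale u y)" by (simp only: re_g f_le)
    finally show ?thesis by (simp add: norm_scale u)
  qed
  show thesis
  proof (rule that[of g])
    have "(SUP v\<in>{v. norm v \<le> 1}. norm (g v)) \<le> 1"
      by (rule cSUP_least) (auto intro: exI[of _ 0] order_trans[OF g_le])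
    moreover have "\<exists>C. \<forall>v. norm (g v) \<le> C * norm v"
      by (rule exI[of _ 1]) (simp add: g_le)
    ultimately show "g \<in> unit_ball (dual (space_of scale))"
      by (simp add: unit_ball_def dual_def space_of_def g_add g_scale)
    show "norm x \<le> norm (g x)"
      using re_le[of "g x"] f_x by (simp add: re_g)
  qed
qed

section \<open>Separation of closed sets by continuous functions\<close>

lemma Urysohn_compact_t2:
  fixes A B :: "'w::t2_space set"
  assumes "compact (UNIV :: 'w set)" "closed A" "closed B" "A \<inter> B = {}"
  obtains h :: "'w \<Rightarrow> real" where "continuous_on UNIV h" "\<And>w. 0 \<le> h w" "\<And>w. h w \<le> 1"
    "\<And>w. w \<in> A \<Longrightarrow> h w = 0" "\<And>w. w \<in> B \<Longrightarrow> h w = 1"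
proof -
  have "normal_space (euclidean :: 'w topology)"
  proof (rule compact_Hausdorff_or_regular_imp_normal_space)
    show "compact_space (euclidean :: 'w topology)" by (simp add: compact_space_def assms)
    have "Hausdorff_space (euclidean :: 'w topology)"
      unfolding Hausdorff_space_def disjnt_def using hausdorff by (metis open_openin)
    then show "Hausdorff_space (euclidean :: 'w topology) \<or> regular_space (euclidean :: 'w topology)" ..
  qed
  then obtain h where h: "continuous_map euclidean (top_of_set {0..1::real}) h"
    "h ` A \<subseteq> {0}" "h ` B \<subseteq> {1}"
    using Urysohn_lemma[of "euclidean :: 'w topology" A B 0 1] assms by (auto simp: disjnt_def)
  show thesis
    by (rule that[of h]) (use h in \<open>auto simp: continuous_map_in_subtopology\<close>)
qed

section \<open>Positive functionals on continuous functions\<close>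

definition nonneg_cont :: "('w::topological_space \<Rightarrow> real) \<Rightarrow> bool"
  where "nonneg_cont f \<longleftrightarrow> continuous_on UNIV f \<and> (\<forall>w. 0 \<le> f w)"

lemma nonneg_contI: "continuous_on UNIV f \<Longrightarrow> (\<And>w. 0 \<le> f w) \<Longrightarrow> nonneg_cont f"
  by (simp add: nonneg_cont_def)

lemma nonneg_cont_const: "0 \<le> c \<Longrightarrow> nonneg_cont (\<lambda>_. c)"
  by (simp add: nonneg_cont_def)

lemma nonneg_cont_min: "nonneg_cont f \<Longrightarrow> 0 \<le> d \<Longrightarrow> nonneg_cont (\<lambda>w. min (f w) d)"
  by (auto simp: nonneg_cont_def intro!: continuous_intros)

lemma nonneg_cont_cut: "nonneg_cont f \<Longrightarrow> nonneg_cont (\<lambda>w. max (f w - d) 0)"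
  by (auto simp: nonneg_cont_def intro!: continuous_intros)

text \<open>Everything is demanded on the cone of nonnegative continuous functions only, because
  that is where the modulus of a scalar functional is defined.\<close>

locale positive_functional =
  fixes \<Lambda> :: "('w::t2_space \<Rightarrow> real) \<Rightarrow> real"
  assumes compact: "compact (UNIV :: 'w set)"
    and nonneg: "nonneg_cont f \<Longrightarrow> 0 \<le> \<Lambda> f"
    and add: "nonneg_cont f \<Longrightarrow> nonneg_cont g \<Longrightarrow> \<Lambda> (\<lambda>w. f w + g w) = \<Lambda> f + \<Lambda> g"
    and scale: "nonneg_cont f \<Longrightarrow> 0 < c \<Longrightarrow> \<Lambda> (\<lambda>w. c * f w) = c * \<Lambda> f"
begin

lemma mono:
  assumes "nonneg_cont f" "nonneg_cont g" "\<And>w. f w \<le> g w"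
  shows "\<Lambda> f \<le> \<Lambda> g"
proof -
  have "nonneg_cont (\<lambda>w. g w - f w)"
    using assms by (auto simp: nonneg_cont_def intro!: continuous_intros)
  then show ?thesis
    using add[of f "\<lambda>w. g w - f w"] nonneg[of "\<lambda>w. g w - f w"] assms(1) by simp
qed

lemma const: "0 < c \<Longrightarrow> \<Lambda> (\<lambda>_. c) = c * \<Lambda> (\<lambda>_. 1)"
  using scale[of "\<lambda>_. 1" c] by (simp add: nonneg_cont_const)

lemma le_cut:
  assumes f: "nonneg_cont f" and d: "0 < d"
  shows "\<Lambda> f \<le> \<Lambda> (\<lambda>w. max (f w - d) 0) + d * \<Lambda> (\<lambda>_. 1)"
proof -
  have "\<Lambda> f \<le> \<Lambda> (\<lambda>w. max (f w - d) 0 + d)"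
    using d by (intro mono f nonneg_contI)
      (auto intro!: continuous_intros simp: f[unfolded nonneg_cont_def] add_nonneg_pos less_imp_le)
  also have "\<dots> = \<Lambda> (\<lambda>w. max (f w - d) 0) + d * \<Lambda> (\<lambda>_. 1)"
    using f d by (subst add) (simp_all add: nonneg_cont_cut nonneg_cont_const const[OF d])
  finally show ?thesis .
qed

section \<open>The outer measure of a positive functional\<close>

text \<open>The competitors of the Riesz construction, with vanishing off \<open>G\<close> in place
  of support in \<open>G\<close>.\<close>

definition below :: "'w set \<Rightarrow> ('w \<Rightarrow> real) \<Rightarrow> bool"
  where "below G f \<longleftrightarrow> nonneg_cont f \<and> (\<forall>w. f w \<le> 1) \<and> (\<forall>w. w \<notin> G \<longrightarrow> f w = 0)"

definition open_content :: "'w set \<Rightarrow> ennreal"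
  where "open_content G = (SUP f\<in>Collect (below G). ennreal (\<Lambda> f))"

definition outer :: "'w set \<Rightarrow> ennreal"
  where "outer E = (INF G\<in>{G. open G \<and> E \<subseteq> G}. open_content G)"

lemma below_cut: "below G f \<Longrightarrow> 0 \<le> d \<Longrightarrow> below G (\<lambda>w. max (f w - d) 0)"
  unfolding below_def by (auto simp: nonneg_cont_cut) (smt (verit))

lemma open_content_ge: "below G f \<Longrightarrow> ennreal (\<Lambda> f) \<le> open_content G"
  unfolding open_content_def by (intro SUP_upper) simp

lemma open_content_least: "(\<And>f. below G f \<Longrightarrow> ennreal (\<Lambda> f) \<le> c) \<Longrightarrow> open_content G \<le> c"
  unfolding open_content_def by (intro SUP_least) simp

lemma open_content_mono: "G \<subseteq> H \<Longrightarrow> open_content G \<le> open_content H"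
  by (intro open_content_least open_content_ge) (auto simp: below_def)

lemma open_content_le: "open_content G \<le> ennreal (\<Lambda> (\<lambda>_. 1))"
  by (intro open_content_least ennreal_leI mono) (auto simp: below_def nonneg_cont_const)

text \<open>Cutting off \<open>f\<close> at a small height is what replaces compact supports.\<close>

lemma open_content_leI:
  assumes "\<And>f d. below G f \<Longrightarrow> 0 < d \<Longrightarrow> ennreal (\<Lambda> (\<lambda>w. max (f w - d) 0)) \<le> c"
  shows "open_content G \<le> c"
proof (rule open_content_least)
  fix f assume f: "below G f"
  show "ennreal (\<Lambda> f) \<le> c"
  proof (cases c)
    case top
    then show ?thesis by simp
  next
    case (real r)
    have "\<Lambda> f \<le> r"
    proof (rule field_le_epsilon)
      fix e :: real assume e: "0 < e"
      \<comment> \<open>Makes \<open>d * \<Lambda> (\<lambda>_. 1) \<le> e\<close>; the summand 1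
        guards against a vanishing denominator.\<close>
      define d where "d = e / (\<Lambda> (\<lambda>_. 1) + 1)"
      have 1: "0 \<le> \<Lambda> (\<lambda>_. 1)" by (simp add: nonneg nonneg_cont_const)
      have d: "0 < d" using e 1 by (simp add: d_def)
      have "d * \<Lambda> (\<lambda>_. 1) \<le> e"
        using e 1 by (simp add: d_def field_simps)
      moreover have "\<Lambda> (\<lambda>w. max (f w - d) 0) \<le> r"
        using assms[OF f d] real by simp
      ultimately show "\<Lambda> f \<le> r + e"
        using le_cut[of f d] f d by (simp add: below_def)
    qed
    then show ?thesis using real by (simp add: ennreal_leI)
  qed
qed

lemma open_content_empty: "open_content {} = 0"
proof -
  have "\<Lambda> (\<lambda>_. 0) = 0"
    using add[of "\<lambda>_. 0" "\<lambda>_. 0"] by (simp add: nonneg_cont_const)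
  moreover have "f = (\<lambda>_. 0)" if "below {} f" for f
    using that by (auto simp: below_def)
  ultimately have "open_content {} \<le> 0"
    by (intro open_content_least) auto
  then show ?thesis by simp
qed

text \<open>A Urysohn function \<open>h\<close> that is 0 off \<open>G\<close> and 1 on the part of
  \<open>{w. d \<le> f w}\<close> outside \<open>H\<close> splits the cut function into
  \<open>h\<close> times it, which lives on \<open>G\<close>, and \<open>1 - h\<close> times it,
  which lives on \<open>H\<close>.\<close>

lemma open_content_Un:
  assumes G: "open G" and H: "open H"
  shows "open_content (G \<union> H) \<le> open_content G + open_content H"
proof (rule open_content_leI)
  fix f and d :: real assume f: "below (G \<union> H) f" and d: "0 < d"
  have cont: "continuous_on UNIV f" and f0: "\<And>w. 0 \<le> f w" "\<And>w. f w \<le> 1"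
    and off: "\<And>w. w \<notin> G \<Longrightarrow> w \<notin> H \<Longrightarrow> f w = 0"
    using f by (auto simp: below_def nonneg_cont_def)
  have "closed {w. d \<le> f w}"
    using cont by (intro closed_Collect_le) auto
  then have 1: "closed ({w. d \<le> f w} - H)" using H by blast
  have 2: "- G \<inter> ({w. d \<le> f w} - H) = {}" using off d by force
  obtain h :: "'w \<Rightarrow> real" where h: "continuous_on UNIV h" "\<And>w. 0 \<le> h w" "\<And>w. h w \<le> 1"
    "\<And>w. w \<in> - G \<Longrightarrow> h w = 0" "\<And>w. w \<in> {w. d \<le> f w} - H \<Longrightarrow> h w = 1"
    by (rule Urysohn_compact_t2[OF compact closed_Compl[OF G] 1 2]) (rule that)
  let ?f = "\<lambda>w. max (f w - d) 0"
  have 1: "below G (\<lambda>w. ?f w * h w)"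
    unfolding below_def
  proof (intro conjI allI impI)
    show "nonneg_cont (\<lambda>w. ?f w * h w)"
      using h by (auto intro!: nonneg_contI continuous_intros cont)
    show "?f w * h w \<le> 1" for w
      using h(2,3)[of w] f0[of w] d by (intro mult_le_one) auto
    show "?f w * h w = 0" if "w \<notin> G" for w
      using h(4)[of w] that by simp
  qed
  have 2: "below H (\<lambda>w. ?f w * (1 - h w))"
    unfolding below_def
  proof (intro conjI allI impI)
    show "nonneg_cont (\<lambda>w. ?f w * (1 - h w))"
      using h by (auto intro!: nonneg_contI continuous_intros cont)
    show "?f w * (1 - h w) \<le> 1" for w
      using h(2,3)[of w] f0[of w] d by (intro mult_le_one) auto
    show "?f w * (1 - h w) = 0" if "w \<notin> H" for w
      using h(5)[of w] that by (cases "d \<le> f w") auto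
  qed
  have "ennreal (\<Lambda> ?f) = ennreal (\<Lambda> (\<lambda>w. ?f w * h w + ?f w * (1 - h w)))"
    by (simp flip: distrib_left)
  also have "\<dots> = ennreal (\<Lambda> (\<lambda>w. ?f w * h w)) + ennreal (\<Lambda> (\<lambda>w. ?f w * (1 - h w)))"
    using 1 2 by (subst add) (auto simp: below_def nonneg)
  also have "\<dots> \<le> open_content G + open_content H"
    by (intro add_mono open_content_ge 1 2)
  finally show "ennreal (\<Lambda> ?f) \<le> open_content G + open_content H" .
qed

lemma open_content_finite_UN:
  fixes n :: nat
  shows "(\<And>i. open (G i)) \<Longrightarrow> open_content (\<Union>i<n. G i) \<le> (\<Sum>i<n. open_content (G i))"
proof (induction n)
  case (Suc n)
  have "open_content (\<Union>i<Suc n. G i) \<le> open_content (\<Union>i<n. G i) + open_content (G n)"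
    using Suc.prems open_content_Un[of "\<Union>i<n. G i" "G n"] by (simp add: lessThan_Suc Un_commute open_UN)
  also have "\<dots> \<le> (\<Sum>i<n. open_content (G i)) + open_content (G n)"
    by (intro add_right_mono Suc.IH Suc.prems)
  finally show ?case by simp
qed (simp add: open_content_empty)

text \<open>The set where \<open>f\<close> is at least \<open>d\<close> is compact, so the cut
  function already vanishes off a finite union.\<close>

lemma open_content_UN:
  fixes G :: "nat \<Rightarrow> 'w set"
  assumes G: "\<And>i. open (G i)"
  shows "open_content (\<Union>i. G i) \<le> (\<Sum>i. open_content (G i))"
proof (rule open_content_leI)
  fix f and d :: real assume f: "below (\<Union>i. G i) f" and d: "0 < d"
  have "closed {w. d \<le> f w}"
    using f by (intro closed_Collect_le) (auto simp: below_def nonneg_cont_def)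
  then have "compact {w. d \<le> f w}"
    using compact_Int_closed[OF compact] by simp
  moreover have "{w. d \<le> f w} \<subseteq> (\<Union>i. G i)"
  proof
    fix w assume "w \<in> {w. d \<le> f w}"
    then have "f w \<noteq> 0" using d by auto
    then show "w \<in> (\<Union>i. G i)" using f unfolding below_def by blast
  qed
  ultimately obtain I where I: "finite I" "{w. d \<le> f w} \<subseteq> (\<Union>i\<in>I. G i)"
    using compactE_image[of "{w. d \<le> f w}" UNIV G] G by (metis subset_UNIV)
  then obtain n where n: "I \<subseteq> {..<n}"
    using finite_nat_iff_bounded by blast
  have "below (\<Union>i<n. G i) (\<lambda>w. max (f w - d) 0)"
    unfolding below_def
  proof (intro conjI allI impI)
    show "max (f w - d) 0 = 0" if "w \<notin> (\<Union>i<n. G i)" for w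
    proof -
      have "w \<notin> {w. d \<le> f w}" using I n that by blast
      then show ?thesis by simp
    qed
  qed (use below_cut[OF f, of d] d in \<open>auto simp: below_def\<close>)
  then have "ennreal (\<Lambda> (\<lambda>w. max (f w - d) 0)) \<le> open_content (\<Union>i<n. G i)"
    by (rule open_content_ge)
  also have "\<dots> \<le> (\<Sum>i<n. open_content (G i))"
    by (rule open_content_finite_UN[OF G])
  also have "\<dots> \<le> (\<Sum>i. open_content (G i))"
    by (rule sum_le_suminf) auto
  finally show "ennreal (\<Lambda> (\<lambda>w. max (f w - d) 0)) \<le> (\<Sum>i. open_content (G i))" .
qed

lemma outer_open: "open G \<Longrightarrow> outer G = open_content G"
  unfolding outer_def by (intro antisym INF_lower INF_greatest) (auto intro: open_content_mono)

lemma outer_mono: "E \<subseteq> F \<Longrightarrow> outer E \<le> outer F"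
  unfolding outer_def by (intro INF_superset_mono) auto

lemma outer_le: "outer E \<le> ennreal (\<Lambda> (\<lambda>_. 1))"
  using outer_mono[of E UNIV] open_content_le[of UNIV] by (simp add: outer_open)

lemma outer_approx:
  assumes "0 < e"
  obtains G where "open G" "E \<subseteq> G" "open_content G \<le> outer E + ennreal e"
proof -
  have fin: "outer E < top" using outer_le[of E] by (simp add: le_less_trans)
  then have "outer E < outer E + ennreal e"
    using assms ennreal_add_left_cancel_less[of "outer E" 0 "ennreal e"] by simp
  then obtain G where "open G" "E \<subseteq> G" "open_content G < outer E + ennreal e"
    unfolding outer_def INF_less_iff by blast
  then show thesis using that by (meson less_imp_le)
qed

lemma outer_UN:
  fixes E :: "nat \<Rightarrow> 'w set"
  shows "outer (\<Union>i. E i) \<le> (\<Sum>i. outer (E i))"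
proof (rule ennreal_le_epsilon)
  fix e :: real assume e: "0 < e"
  have "\<exists>G. open G \<and> E i \<subseteq> G \<and> open_content G \<le> outer (E i) + ennreal (e * (1/2) ^ Suc i)" for i
  proof -
    have "0 < e * (1/2) ^ Suc i" using e by simp
    then obtain G where "open G" "E i \<subseteq> G" "open_content G \<le> outer (E i) + ennreal (e * (1/2) ^ Suc i)"
      by (rule outer_approx)
    then show ?thesis by blast
  qed
  then obtain G where G: "\<And>i. open (G i)" "\<And>i. E i \<subseteq> G i"
    "\<And>i. open_content (G i) \<le> outer (E i) + ennreal (e * (1/2) ^ Suc i)"
    by metis
  have "outer (\<Union>i. E i) \<le> open_content (\<Union>i. G i)"
    using G(1,2) by (subst outer_open[symmetric]) (auto intro!: outer_mono)
  also have "\<dots> \<le> (\<Sum>i. open_content (G i))" by (rule open_content_UN[OF G(1)])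
  also have "\<dots> \<le> (\<Sum>i. outer (E i) + ennreal (e * (1/2) ^ Suc i))"
    by (intro suminf_le G(3)) auto
  also have "\<dots> = (\<Sum>i. outer (E i)) + (\<Sum>i. ennreal (e * (1/2) ^ Suc i))"
    by (rule suminf_add[symmetric]) auto
  also have "(\<Sum>i. ennreal (e * (1/2) ^ Suc i)) = ennreal e"
    using e sums_mult[OF power_half_series, of e] by (intro suminf_ennreal_eq) auto
  finally show "outer (\<Union>i. E i) \<le> (\<Sum>i. outer (E i)) + ennreal e" .
qed

text \<open>This is the nontrivial half of Caratheodory's criterion for open sets. Choose
  \<open>V\<close> almost optimal for \<open>E\<close> and \<open>f\<close> below
  \<open>V \<inter> G\<close>. A function \<open>g\<close> below \<open>V - {w. d \<le> f w}\<close>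
  and the cut of \<open>f\<close> at height \<open>d\<close> are never both nonzero, so their sum is
  below \<open>V\<close>. As \<open>f\<close> vanishes off \<open>G\<close>, the set
  \<open>V - G\<close> lies in the domain left to \<open>g\<close>.\<close>

lemma outer_open_split:
  assumes G: "open G"
  shows "outer (E \<inter> G) + outer (E - G) \<le> outer E"
proof (rule ennreal_le_epsilon)
  fix e :: real assume e: "0 < e"
  obtain V where V: "open V" "E \<subseteq> V" "open_content V \<le> outer E + ennreal e"
    using e by (rule outer_approx)
  have "outer (E \<inter> G) + outer (E - G) \<le> open_content (V \<inter> G) + outer (V - G)"
    using V G by (subst outer_open[symmetric]) (auto intro!: add_mono outer_mono)
  also have "open_content (V \<inter> G) \<le> open_content V - outer (V - G)"
  proof (rule open_content_leI)
    fix f and d :: real assume f: "below (V \<inter> G) f" and d: "0 < d"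
    let ?f = "\<lambda>w. max (f w - d) 0" and ?W = "V - {w. d \<le> f w}"
    have "closed {w. d \<le> f w}"
      using f by (intro closed_Collect_le) (auto simp: below_def nonneg_cont_def)
    then have W: "open ?W" using V by blast
    have fd: "below (V \<inter> G) ?f" using d by (intro below_cut[OF f]) auto
    have "open_content ?W \<le> open_content V - ennreal (\<Lambda> ?f)"
    proof (rule open_content_least)
      fix g assume g: "below ?W g"
      have "below V (\<lambda>w. g w + ?f w)"
        unfolding below_def
      proof (intro conjI allI impI)
        show "nonneg_cont (\<lambda>w. g w + ?f w)"
          using g fd by (auto simp: below_def nonneg_cont_def intro!: continuous_intros)
        show "g w + ?f w \<le> 1" for w
        proof (cases "d \<le> f w")
          case True
          then have "g w = 0" using g by (auto simp: below_def)
          then show ?thesis using fd by (simp add: below_def)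
        next
          case False
          then show ?thesis using g by (simp add: below_def)
        qed
        show "g w + ?f w = 0" if "w \<notin> V" for w
          using that g fd unfolding below_def by auto
      qed
      from open_content_ge[OF this] have "ennreal (\<Lambda> g) + ennreal (\<Lambda> ?f) \<le> open_content V"
        using g fd by (subst (asm) add) (auto simp: below_def nonneg)
      then show "ennreal (\<Lambda> g) \<le> open_content V - ennreal (\<Lambda> ?f)"
        by (simp add: ennreal_le_minus_iff add.commute)
    qed
    moreover have "outer (V - G) \<le> open_content ?W"
      unfolding outer_open[OF W, symmetric]
    proof (rule outer_mono)
      show "V - G \<subseteq> ?W" using f d by (force simp: below_def)
    qed
    ultimately have "outer (V - G) \<le> open_content V - ennreal (\<Lambda> ?f)" by (rule order_trans[rotated])
    moreover have "ennreal (\<Lambda> ?f) \<le> open_content V"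
      by (rule order_trans[OF open_content_ge[OF fd] open_content_mono]) auto
    ultimately have "outer (V - G) + ennreal (\<Lambda> ?f) \<le> open_content V"
      using add_right_mono[of "outer (V - G)" "open_content V - ennreal (\<Lambda> ?f)" "ennreal (\<Lambda> ?f)"]
      by (simp add: diff_add_cancel_ennreal)
    then show "ennreal (\<Lambda> ?f) \<le> open_content V - outer (V - G)"
      by (simp add: ennreal_le_minus_iff add.commute)
  qed
  also have "open_content V - outer (V - G) + outer (V - G) = open_content V"
  proof (rule diff_add_cancel_ennreal)
    show "outer (V - G) \<le> open_content V"
      using outer_mono[of "V - G" V] outer_open[OF V(1)] by auto
  qed
  also note V(3)
  finally show "outer (E \<inter> G) + outer (E - G) \<le> outer E + ennreal e"
    by (simp add: add_right_mono)
qed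

text \<open>Caratheodory's theorem is applied with all subsets as the ambient algebra; the
  measurable sets form a sigma-algebra containing the open sets, hence the Borel sets.\<close>

lemma measure_space_outer: "measure_space UNIV (sets borel) outer"
proof (rule measure_down)
  interpret sigma_algebra UNIV "UNIV :: 'w set set"
    using sigma_algebra_Pow[of "UNIV :: 'w set"] by simp
  have oms: "outer_measure_space UNIV outer"
    unfolding outer_measure_space_def positive_def increasing_def countably_subadditive_def
    using outer_UN outer_mono outer_open[of "{}"] open_content_empty by auto
  then show L: "measure_space UNIV (lambda_system UNIV UNIV outer) outer"
    by (rule caratheodory_lemma)
  have "open G \<Longrightarrow> G \<in> lambda_system UNIV UNIV outer" for G
    unfolding lambda_system_def
  proof (safe intro!: antisym UNIV_I)
    fix E assume "open G"
    then show "outer (G \<inter> E) + outer ((UNIV - G) \<inter> E) \<le> outer E"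
      using outer_open_split[of G E] by (simp add: Int_commute Diff_eq)
    have "outer E = outer (\<Union>i. binaryset (G \<inter> E) ((UNIV - G) \<inter> E) i)"
      by (rule arg_cong[where f = outer]) (auto simp: UN_binaryset_eq)
    also have "\<dots> \<le> (\<Sum>i. outer (binaryset (G \<inter> E) ((UNIV - G) \<inter> E) i))"
      by (rule outer_UN)
    also have "\<dots> = outer (G \<inter> E) + outer ((UNIV - G) \<inter> E)"
      using outer_open[of "{}"] open_content_empty by (intro suminf_binaryset_eq) simp
    finally show "outer E \<le> outer (G \<inter> E) + outer ((UNIV - G) \<inter> E)" .
  qed
  then have "sigma_sets UNIV {G :: 'w set. open G} \<subseteq> lambda_system UNIV UNIV outer"
    using L by (intro sigma_algebra.sigma_sets_subset) (auto simp: measure_space_def)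
  then show "sets borel \<subseteq> lambda_system UNIV UNIV outer"
    by (simp add: borel_def)
  show "sigma_algebra UNIV (sets (borel :: 'w measure))"
    using sets.sigma_algebra_axioms[of "borel :: 'w measure"] by simp
qed

definition the_measure :: "'w measure"
  where "the_measure = measure_of UNIV (sets borel) outer"

lemma sets_the_measure [simp]: "sets the_measure = sets borel"
  unfolding the_measure_def by (simp add: sigma_algebra.sigma_sets_eq[OF sets.sigma_algebra_axioms[of borel, simplified]])

lemma space_the_measure [simp]: "space the_measure = UNIV"
  by (simp add: the_measure_def)

lemma emeasure_the_measure:
  "E \<in> sets borel \<Longrightarrow> emeasure the_measure E = outer E"
  unfolding the_measure_def
  by (rule emeasure_measure_of_sigma)
    (use measure_space_outer in \<open>auto simp: measure_space_def\<close>)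

lemma finite_measure_the_measure: "finite_measure the_measure"
  by (rule finite_measureI) (use outer_le[of UNIV] in \<open>auto simp: emeasure_the_measure top_unique\<close>)

lemma measure_the_measure_le:
  assumes "E \<in> sets borel"
  shows "measure the_measure E \<le> \<Lambda> (\<lambda>_. 1)"
proof -
  have "0 \<le> \<Lambda> (\<lambda>_. 1)" by (simp add: nonneg nonneg_cont_const)
  then show ?thesis
    using outer_le[of E] assms by (simp add: measure_def emeasure_the_measure enn2real_leI)
qed

lemma the_measure_outer_regular:
  assumes E: "E \<in> sets borel" and e: "0 < e"
  obtains G where "open G" "E \<subseteq> G" "measure the_measure (G - E) < e"
proof -
  interpret finite_measure the_measure by (rule finite_measure_the_measure)
  obtain G where G: "open G" "E \<subseteq> G" "open_content G \<le> outer E + ennreal (e / 2)"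
    using half_gt_zero[OF e] by (rule outer_approx)
  have G': "G \<in> sets borel" using G by simp
  have "ennreal (measure the_measure G) \<le> ennreal (measure the_measure E + e / 2)"
    using G E e by (simp add: emeasure_the_measure outer_open flip: emeasure_eq_measure)
  then have "measure the_measure G \<le> measure the_measure E + e / 2"
    using e by (subst (asm) ennreal_le_iff) (auto intro: add_nonneg_nonneg)
  then show thesis
    using that[OF G(1,2)] finite_measure_Diff[of G E] G G' E e by simp
qed

text \<open>Inner regularity is outer regularity of the complement: the complement of an open
  \<open>H\<close> around \<open>- E\<close> is compact, and a point of \<open>G \<inter> H\<close>
  lies in \<open>G - E\<close> or in \<open>H \<inter> E\<close>.\<close>

lemma the_measure_regular:
  assumes E: "E \<in> sets borel" and e: "0 < e"
  obtains F G where "compact F" "open G" "F \<subseteq> E" "E \<subseteq> G" "measure the_measure (G - F) < e"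
proof -
  interpret finite_measure the_measure by (rule finite_measure_the_measure)
  obtain G where G: "open G" "E \<subseteq> G" "measure the_measure (G - E) < e / 2"
    by (rule the_measure_outer_regular[OF E half_gt_zero[OF e]])
  have "- E \<in> sets borel" using E by (simp add: Compl_eq_Diff_UNIV)
  then obtain H where H: "open H" "- E \<subseteq> H" "measure the_measure (H - - E) < e / 2"
    using half_gt_zero[OF e] by (rule the_measure_outer_regular)
  have "closed (- H)" using H(1) by (rule closed_Compl)
  then have "compact (- H)" using compact_Int_closed[OF compact, of "- H"] by simp
  have "measure the_measure (G - - H) \<le> measure the_measure ((G - E) \<union> (H - - E))"
    using G H E by (intro finite_measure_mono) auto
  also have "\<dots> \<le> measure the_measure (G - E) + measure the_measure (H - - E)"
    using G H E by (intro measure_Un_le) auto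
  also have "\<dots> < e" using G H by simp
  finally show thesis
    using that[OF \<open>compact (- H)\<close> G(1)] G H by blast
qed

section \<open>Comparison of the functional with the integral\<close>

lemma integrable_cont:
  fixes f :: "'w \<Rightarrow> 'b::{banach, second_countable_topology}"
  assumes "continuous_on UNIV f"
  shows "integrable the_measure f"
proof -
  interpret finite_measure the_measure by (rule finite_measure_the_measure)
  have "bounded (range f)"
    using assms compact by (intro compact_imp_bounded compact_continuous_image)
  then obtain B where "\<And>w. norm (f w) \<le> B" by (auto simp: bounded_iff)
  moreover have "f \<in> borel_measurable the_measure"
    using borel_measurable_continuous_onI[OF assms] by (simp cong: measurable_cong_sets)
  ultimately show ?thesis by (intro integrable_const_bound[where B = B]) auto
qed

text \<open>The quotient of \<open>f\<close> by \<open>d\<close> is a competitor for the content of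
  the open set where \<open>f\<close> is positive.\<close>

lemma le_level:
  assumes f: "nonneg_cont f" and d: "0 < d" and fd: "\<And>w. f w \<le> d"
  shows "\<Lambda> f \<le> d * measure the_measure {w. 0 < f w}"
proof -
  interpret finite_measure the_measure by (rule finite_measure_the_measure)
  have "open {w. 0 < f w}"
    using f by (intro open_Collect_less) (auto simp: nonneg_cont_def)
  have b: "below {w. 0 < f w} (\<lambda>w. inverse d * f w)"
    using f d fd by (auto simp: below_def nonneg_cont_def field_simps order.order_iff_strict intro!: continuous_intros)
  have "ennreal (inverse d * \<Lambda> f) \<le> open_content {w. 0 < f w}"
    using open_content_ge[OF b] scale[OF f, of "inverse d"] d by simp
  also have "\<dots> = ennreal (measure the_measure {w. 0 < f w})"
    using \<open>open _\<close> by (simp add: emeasure_the_measure outer_open flip: emeasure_eq_measure)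
  finally show ?thesis
    using d by (simp add: field_simps)
qed

text \<open>Induction on the number of layers of height \<open>d\<close>: the lowest layer is bounded by the previous
  lemma, and the error term \<open>d\<close> is passed on from the support of \<open>max (f - d) 0\<close>.\<close>

lemma le_integral_layers:
  assumes d: "0 < d"
  shows "nonneg_cont f \<Longrightarrow> (\<And>w. f w \<le> real n * d) \<Longrightarrow>
    \<Lambda> f \<le> (LINT w|the_measure. f w) + d * measure the_measure {w. 0 < f w}"
proof (induction n arbitrary: f)
  case 0
  then have "f w = 0" for w
    using antisym[of "f w" 0] by (simp add: nonneg_cont_def)
  then have "f = (\<lambda>_. 0)" ..
  then show ?case using add[of f f] 0 by simp
next
  case (Suc n)
  interpret finite_measure the_measure by (rule finite_measure_the_measure)
  let ?g = "\<lambda>w. max (f w - d) 0" and ?m = "\<lambda>w. min (f w) d"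
  have f: "continuous_on UNIV f" "\<And>w. 0 \<le> f w" using Suc.prems(1) by (auto simp: nonneg_cont_def)
  have g: "nonneg_cont ?g" by (rule nonneg_cont_cut[OF Suc.prems(1)])
  have m: "nonneg_cont ?m" using d by (intro nonneg_cont_min Suc.prems) simp
  have open_d: "open {w. d < f w}" using f by (intro open_Collect_less) auto
  have ig: "integrable the_measure ?g"
    using g by (intro integrable_cont) (simp add: nonneg_cont_def)
  have ii: "integrable the_measure (\<lambda>w. d * indicat_real {w. d < f w} w)"
    using open_d by (intro integrable_mult_right integrable_real_indicator) (auto simp: less_top[symmetric])
  have "?g w \<le> real n * d" for w
    using Suc.prems(2)[of w] d by (simp add: algebra_simps)
  then have "\<Lambda> ?g \<le> (LINT w|the_measure. ?g w) + d * measure the_measure {w. 0 < ?g w}"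
    by (rule Suc.IH[OF g])
  also have "{w. 0 < ?g w} = {w. d < f w}" by auto
  also have "(LINT w|the_measure. ?g w) + d * measure the_measure {w. d < f w}
      = (LINT w|the_measure. ?g w + d * indicat_real {w. d < f w} w)"
    using open_d by (subst Bochner_Integration.integral_add[OF ig ii]) simp
  \<comment> \<open>Pointwise, the cut function plus \<open>d\<close> on \<open>{w. d < f w}\<close>
    is at most \<open>f\<close>: the error of the induction hypothesis is absorbed by the integral,
    and only the lowest layer creates a new one.\<close>
  also have "\<dots> \<le> (LINT w|the_measure. f w)"
    using f d by (intro integral_mono Bochner_Integration.integrable_add ig ii integrable_cont)
      (auto simp: indicator_def)
  finally have 1: "\<Lambda> ?g \<le> (LINT w|the_measure. f w)" .
  have 2: "\<Lambda> ?m \<le> d * measure the_measure {w. 0 < ?m w}"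
    using m d by (intro le_level) auto
  have "f = (\<lambda>w. ?g w + ?m w)" by auto
  then have "\<Lambda> f = \<Lambda> ?g + \<Lambda> ?m"
    using add[OF g m] by simp
  moreover have "{w. 0 < ?m w} = {w. 0 < f w}" using d by auto
  ultimately show ?case using 1 2 by simp
qed

text \<open>The layers are made thin: their error is at most \<open>d\<close> times the total mass,
  and any number \<open>n\<close> of layers with \<open>real n * d\<close> above the maximum of
  \<open>f\<close> will do. Through this estimate \<open>l\<close> becomes continuous for the L^1
  seminorm.\<close>

theorem le_integral:
  assumes f: "nonneg_cont f"
  shows "\<Lambda> f \<le> (LINT w|the_measure. f w)"
proof (rule field_le_epsilon)
  fix e :: real assume e: "0 < e"
  interpret finite_measure the_measure by (rule finite_measure_the_measure)
  define d where "d = e / (measure the_measure UNIV + 1)"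
  have d: "0 < d" using e by (simp add: d_def add_nonneg_pos)
  have "bounded (range f)"
    using f compact by (intro compact_imp_bounded compact_continuous_image) (auto simp: nonneg_cont_def)
  then obtain B where B: "\<And>w. f w \<le> B" by (auto simp: bounded_iff abs_le_iff)
  obtain n where "B \<le> real n * d"
    using reals_Archimedean3[OF d] by (meson less_imp_le)
  then have "\<Lambda> f \<le> (LINT w|the_measure. f w) + d * measure the_measure {w. 0 < f w}"
    by (intro le_integral_layers[OF d f]) (rule order_trans[OF B])
  also have "d * measure the_measure {w. 0 < f w} \<le> d * measure the_measure UNIV"
    using d finite_measure_mono[of "{w. 0 < f w}" UNIV] by (intro mult_left_mono) auto
  also have "\<dots> \<le> e"
    using e by (simp add: d_def divide_simps add_nonneg_pos)
  finally show "\<Lambda> f \<le> (LINT w|the_measure. f w) + e" by simp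
qed

end

section \<open>Second countability of the scalars and simple functions on compact spaces\<close>

text \<open>Scalar functions are integrated with the Bochner integral, whose values are taken in
  second countable spaces; preimages of a countable basis under the isometry \<open>\<iota>\<close>
  form a basis.\<close>

instance real_or_complex \<subseteq> second_countable_topology
proof
  obtain \<iota> :: "'a \<Rightarrow> complex" where
    add: "\<And>a b. \<iota> (a + b) = \<iota> a + \<iota> b" and nrm: "\<And>a. norm (\<iota> a) = norm a"
    using real_or_complex by metis
  have dist: "dist (\<iota> a) (\<iota> b) = dist a b" for a b
    using add[of "a - b" b] nrm[of "a - b"] by (simp add: dist_norm)
  have cont: "continuous_on UNIV \<iota>"
    by (auto simp: continuous_on_iff dist)
  obtain B :: "complex set set" where B: "countable B" "topological_basis B"
    using ex_countable_basis by auto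
  have "topological_basis ((\<lambda>U. \<iota> -` U) ` B)"
  proof (rule topological_basisI)
    show "open U" if "U \<in> (\<lambda>U. \<iota> -` U) ` B" for U
      using that topological_basis_open[OF B(2)] open_vimage[OF _ cont] by auto
  next
    fix O' :: "'a set" and x assume "open O'" "x \<in> O'"
    then obtain e where e: "0 < e" "ball x e \<subseteq> O'" by (auto simp: open_contains_ball)
    obtain U where U: "U \<in> B" "\<iota> x \<in> U" "U \<subseteq> ball (\<iota> x) e"
      using topological_basisE[OF B(2), of "ball (\<iota> x) e" "\<iota> x"] e by auto
    have "\<iota> -` U \<subseteq> ball x e"
    proof
      fix y assume "y \<in> \<iota> -` U"
      then have "\<iota> y \<in> ball (\<iota> x) e" using U by auto
      then show "y \<in> ball x e" by (simp add: dist)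
    qed
    then show "\<exists>B'\<in>(\<lambda>U. \<iota> -` U) ` B. x \<in> B' \<and> B' \<subseteq> O'" using U e by blast
  qed
  then show "\<exists>B :: 'a set set. countable B \<and> open = generate_topology B"
    using B(1) topological_basis_imp_subbasis by blast
qed

text \<open>The fibres of \<open>\<tau>\<close> are a finite Borel partition subordinate to the
  cover: the fibre over \<open>c\<close> lies in \<open>V c\<close>, and \<open>c\<close> itself is
  its tag. Overlaps in a finite subcover are resolved by letting a newly inserted tag take
  precedence.\<close>

lemma simple_function_tag:
  fixes V :: "'w::topological_space \<Rightarrow> 'w set"
  assumes compact: "compact (UNIV :: 'w set)" and V: "\<And>w. open (V w)" "\<And>w. w \<in> V w"
  obtains \<tau> where "simple_function borel \<tau>" "\<And>w. w \<in> V (\<tau> w)"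
proof -
  obtain C where C: "finite C" "UNIV \<subseteq> (\<Union>c\<in>C. V c)"
  proof (rule compactE_image[OF compact, of UNIV V])
    show "UNIV \<subseteq> (\<Union>c\<in>UNIV. V c)" using V(2) by auto
  qed (use V(1) that in auto)
  have "finite C \<Longrightarrow> \<exists>\<tau>. simple_function borel \<tau> \<and> (\<forall>w\<in>(\<Union>c\<in>C. V c). w \<in> V (\<tau> w))" for C
  proof (induction C rule: finite_induct)
    case empty
    show ?case by (rule exI[of _ "\<lambda>_. undefined"]) simp
  next
    case (insert c C)
    then obtain \<tau> where \<tau>: "simple_function borel \<tau>" "\<forall>w\<in>(\<Union>c\<in>C. V c). w \<in> V (\<tau> w)" by blast
    have "simple_function borel (\<lambda>w. if w \<in> V c then c else \<tau> w)"
      using \<tau>(1) V(1)[of c] by (intro simple_function_If_set) auto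
    then show ?case using \<tau>(2) by (intro exI[of _ "\<lambda>w. if w \<in> V c then c else \<tau> w"]) auto
  qed
  from this[OF C(1)] obtain \<tau> where "simple_function borel \<tau>" "\<forall>w\<in>(\<Union>c\<in>C. V c). w \<in> V (\<tau> w)"
    by (elim exE conjE)
  then show thesis using that[of \<tau>] C(2) by (metis UNIV_I subsetD)
qed

lemma apply_Bcontfun_compact:
  assumes "compact (UNIV :: 'w::topological_space set)" "continuous_on UNIV f"
  shows "apply_bcontfun (Bcontfun f :: 'w \<Rightarrow>\<^sub>C 'b::metric_space) = f"
proof (rule Bcontfun_inverse)
  show "f \<in> bcontfun"
    using assms by (auto simp: bcontfun_def intro: compact_imp_bounded compact_continuous_image)
qed

lemma simple_function_approx:
  fixes \<phi> :: "'w::topological_space \<Rightarrow> 'b::metric_space"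
  assumes compact: "compact (UNIV :: 'w set)" and \<phi>: "continuous_on UNIV \<phi>" and e: "0 < e"
  obtains s where "simple_function borel s" "\<And>w. dist (s w) (\<phi> w) < e"
proof -
  have "open (\<phi> -` ball (\<phi> w) e)" for w
    by (intro open_vimage \<phi>) auto
  then obtain \<tau> where \<tau>: "simple_function borel \<tau>" "\<And>w. w \<in> \<phi> -` ball (\<phi> (\<tau> w)) e"
    using simple_function_tag[OF compact, of "\<lambda>w. \<phi> -` ball (\<phi> w) e"] e by auto
  show thesis
    by (rule that[of "\<phi> \<circ> \<tau>"]) (use \<tau> in \<open>auto intro: simple_function_compose\<close>)
qed

lemma tendsto_dist_boundI:
  assumes "\<And>n. dist (X n) a \<le> b n" "b \<longlonglongrightarrow> 0"
  shows "X \<longlonglongrightarrow> a"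
  by (rule metric_tendsto_imp_tendsto[OF assms(2)])
    (auto intro!: always_eventually order_trans[OF assms(1)])

section \<open>The Riesz representation theorem\<close>

locale cont_functional =
  fixes l :: "('w::t2_space \<Rightarrow>\<^sub>C 'k::real_or_complex) \<Rightarrow> 'k" and L :: real
  assumes compact: "compact (UNIV :: 'w set)"
    and l_add: "l (f + g) = l f + l g"
    and l_scale: "l (cont_scale (*) a f) = a * l f"
    and l_bound: "norm (l f) \<le> L * norm f"
    and L: "0 \<le> L"
begin

interpretation scalars: banach_space_over "(*) :: 'k \<Rightarrow> _"
  by (rule banach_space_over_scalars)

definition modulus :: "('w \<Rightarrow> real) \<Rightarrow> real"
  where "modulus f = (SUP g\<in>{g. \<forall>w. norm (apply_bcontfun g w) \<le> f w}. norm (l g))"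

lemma modulus_ge:
  assumes f: "nonneg_cont f" and g: "\<And>w. norm (apply_bcontfun g w) \<le> f w"
  shows "norm (l g) \<le> modulus f"
  unfolding modulus_def
proof (rule cSUP_upper)
  have "bounded (range f)"
    using f compact by (intro compact_imp_bounded compact_continuous_image) (auto simp: nonneg_cont_def)
  then obtain B where B: "\<And>w. f w \<le> B" by (auto simp: bounded_iff abs_le_iff)
  show "bdd_above ((\<lambda>g. norm (l g)) ` {g. \<forall>w. norm (apply_bcontfun g w) \<le> f w})"
  proof (rule bdd_aboveI2)
    fix g :: "'w \<Rightarrow>\<^sub>C 'k" assume "g \<in> {g. \<forall>w. norm (apply_bcontfun g w) \<le> f w}"
    then have "norm g \<le> B" by (intro norm_bound) (auto intro: order_trans[OF _ B])
    then show "norm (l g) \<le> L * B" using L by (intro order_trans[OF l_bound] mult_left_mono)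
  qed
qed (use g in simp)

lemma modulus_least:
  assumes f: "nonneg_cont f" and c: "\<And>g. (\<And>w. norm (apply_bcontfun g w) \<le> f w) \<Longrightarrow> norm (l g) \<le> c"
  shows "modulus f \<le> c"
  unfolding modulus_def
proof (rule cSUP_least)
  show "{g :: 'w \<Rightarrow>\<^sub>C 'k. \<forall>w. norm (apply_bcontfun g w) \<le> f w} \<noteq> {}"
    using f by (auto simp: nonneg_cont_def intro: exI[of _ 0])
qed (use c in simp)

lemma modulus_scale_le:
  assumes f: "nonneg_cont f" and c: "0 < c"
  shows "modulus (\<lambda>w. c * f w) \<le> c * modulus f"
proof (rule modulus_least)
  show "nonneg_cont (\<lambda>w. c * f w)"
    using f c by (auto simp: nonneg_cont_def intro!: continuous_intros)
  fix g :: "'w \<Rightarrow>\<^sub>C 'k" assume g: "\<And>w. norm (apply_bcontfun g w) \<le> c * f w"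
  have "norm (l (cont_scale (*) (of_real (inverse c)) g)) \<le> modulus f"
  proof (rule modulus_ge[OF f])
    fix w
    have "norm (apply_bcontfun (cont_scale (*) (of_real (inverse c)) g) w) = inverse c * norm (apply_bcontfun g w)"
      using c by (simp add: scalars.cont_scale_apply norm_mult norm_inverse)
    also have "\<dots> \<le> f w" using g[of w] c by (simp add: field_simps)
    finally show "norm (apply_bcontfun (cont_scale (*) (of_real (inverse c)) g) w) \<le> f w" .
  qed
  then have "inverse c * norm (l g) \<le> modulus f"
    using c by (simp add: l_scale norm_mult norm_inverse)
  then show "norm (l g) \<le> c * modulus f"
    using c by (simp add: field_simps)
qed

text \<open>Rotating \<open>g1\<close> and \<open>g2\<close> separately makes both values of
  \<open>l\<close> nonnegative reals, so that their absolute values add without loss.\<close>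

lemma modulus_add_ge:
  assumes f: "nonneg_cont f1" "nonneg_cont f2"
  shows "modulus f1 + modulus f2 \<le> modulus (\<lambda>w. f1 w + f2 w)"
proof -
  have *: "norm (l g1) + norm (l g2) \<le> modulus (\<lambda>w. f1 w + f2 w)"
    if g: "\<And>w. norm (apply_bcontfun g1 w) \<le> f1 w" "\<And>w. norm (apply_bcontfun g2 w) \<le> f2 w" for g1 g2
  proof -
    obtain u1 where u1: "norm u1 = 1" "u1 * l g1 = of_real (norm (l g1))" by (rule unimodular_multiplier)
    obtain u2 where u2: "norm u2 = 1" "u2 * l g2 = of_real (norm (l g2))" by (rule unimodular_multiplier)
    have "norm (l (cont_scale (*) u1 g1 + cont_scale (*) u2 g2)) \<le> modulus (\<lambda>w. f1 w + f2 w)"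
      by (intro modulus_ge)
        (use f g u1 u2 in \<open>auto simp: scalars.cont_scale_apply nonneg_cont_def norm_mult
          intro!: continuous_intros norm_triangle_mono\<close>)
    also have "l (cont_scale (*) u1 g1 + cont_scale (*) u2 g2) = of_real (norm (l g1) + norm (l g2))"
      by (simp add: l_add l_scale u1 u2)
    finally show ?thesis by (simp only: norm_of_real)
  qed
  have "norm (l g1) \<le> modulus (\<lambda>w. f1 w + f2 w) - modulus f2"
    if "\<And>w. norm (apply_bcontfun g1 w) \<le> f1 w" for g1
  proof -
    have "modulus f2 \<le> modulus (\<lambda>w. f1 w + f2 w) - norm (l g1)"
      using *[OF that] by (intro modulus_least[OF f(2)]) (simp add: algebra_simps)
    then show ?thesis by simp
  qed
  then have "modulus f1 \<le> modulus (\<lambda>w. f1 w + f2 w) - modulus f2"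
    by (rule modulus_least[OF f(1)])
  then show ?thesis by simp
qed

text \<open>A function \<open>g\<close> bounded by \<open>f1 + f2\<close> is split in proportion to \<open>f1\<close> and \<open>f2\<close>; the summand \<open>e\<close>
  in the denominator keeps the parts continuous at the common zeros of \<open>f1\<close> and \<open>f2\<close>.\<close>

lemma modulus_add_le:
  assumes f: "nonneg_cont f1" "nonneg_cont f2"
  shows "modulus (\<lambda>w. f1 w + f2 w) \<le> modulus f1 + modulus f2"
proof (rule modulus_least)
  show "nonneg_cont (\<lambda>w. f1 w + f2 w)"
    using f by (auto simp: nonneg_cont_def intro!: continuous_intros)
  fix g :: "'w \<Rightarrow>\<^sub>C 'k" assume g: "\<And>w. norm (apply_bcontfun g w) \<le> f1 w + f2 w"
  have cont: "continuous_on UNIV f1" "continuous_on UNIV f2" and f0: "\<And>w. 0 \<le> f1 w" "\<And>w. 0 \<le> f2 w"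
    using f by (auto simp: nonneg_cont_def)
  have *: "norm (l g) \<le> modulus f1 + modulus f2 + L * e" if e: "0 < e" for e
  proof -
    define q where "q = (\<lambda>h w. of_real (h w / (f1 w + f2 w + e)) * apply_bcontfun g w)"
    have pos: "0 < f1 w + f2 w + e" for w using f0[of w] e by simp
    have q_cont: "continuous_on UNIV (q h)" if "continuous_on UNIV h" for h
      unfolding q_def using that cont pos by (intro continuous_intros) (auto simp: less_imp_neq[symmetric])
    have q_le: "norm (q h w) \<le> h w" if "0 \<le> h w" for h w
    proof -
      have "norm (q h w) = h w * (norm (apply_bcontfun g w) / (f1 w + f2 w + e))"
        using that pos[of w] by (simp add: q_def norm_mult norm_divide flip: of_real_add)
      also have "\<dots> \<le> h w * 1"
        using that pos[of w] g[of w] e by (intro mult_left_mono) auto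
      finally show ?thesis by simp
    qed
    define Q where "Q = (\<lambda>h. Bcontfun (q h))"
    have Q: "apply_bcontfun (Q h) = q h" if "continuous_on UNIV h" for h
      unfolding Q_def by (rule apply_Bcontfun_compact[OF compact q_cont[OF that]])
    \<comment> \<open>The third part belongs to the summand \<open>e\<close> of the denominator; it
      has norm at most \<open>e\<close> and costs at most \<open>L * e\<close>.\<close>
    have "g = Q f1 + Q f2 + Q (\<lambda>_. e)"
    proof (rule bcontfun_eqI)
      fix w
      have "q f1 w + q f2 w + q (\<lambda>_. e) w = of_real ((f1 w + f2 w + e) / (f1 w + f2 w + e)) * apply_bcontfun g w"
        unfolding q_def by (simp only: flip: distrib_right of_real_add add_divide_distrib)
      then show "apply_bcontfun g w = apply_bcontfun (Q f1 + Q f2 + Q (\<lambda>_. e)) w"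
        using pos[of w] cont by (simp add: Q)
    qed
    then have "l g = l (Q f1) + l (Q f2) + l (Q (\<lambda>_. e))" by (metis l_add)
    also have "norm \<dots> \<le> norm (l (Q f1)) + norm (l (Q f2)) + norm (l (Q (\<lambda>_. e)))"
      by (intro norm_triangle_le add_right_mono norm_triangle_ineq)
    also have "\<dots> \<le> modulus f1 + modulus f2 + L * e"
    proof (intro add_mono modulus_ge f)
      have "norm (Q (\<lambda>_. e)) \<le> e"
        using e q_le[of "\<lambda>_. e"] by (intro norm_bound) (simp add: Q)
      then show "norm (l (Q (\<lambda>_. e))) \<le> L * e"
        using L by (intro order_trans[OF l_bound] mult_left_mono)
    qed (use f0 cont q_le in \<open>auto simp: Q\<close>)
    finally show ?thesis .
  qed
  show "norm (l g) \<le> modulus f1 + modulus f2"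
  proof (rule field_le_epsilon)
    fix e :: real assume e: "0 < e"
    then have "norm (l g) \<le> modulus f1 + modulus f2 + L * (e / (L + 1))"
      using L by (intro *) simp
    also have "L * (e / (L + 1)) \<le> e" using L e by (simp add: field_simps)
    finally show "norm (l g) \<le> modulus f1 + modulus f2 + e" by simp
  qed
qed

sublocale modulus: positive_functional modulus
proof
  show "0 \<le> modulus f" if "nonneg_cont f" for f
    using modulus_ge[OF that, of 0] that by (auto simp: nonneg_cont_def intro: order_trans[OF norm_ge_zero])
  show "modulus (\<lambda>w. f w + g w) = modulus f + modulus g" if "nonneg_cont f" "nonneg_cont g" for f g
    using modulus_add_le[OF that] modulus_add_ge[OF that] by (rule antisym)
  show "modulus (\<lambda>w. c * f w) = c * modulus f" if f: "nonneg_cont f" and c: "0 < c" for f c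
  proof (rule antisym[OF modulus_scale_le[OF that]])
    have "nonneg_cont (\<lambda>w. c * f w)"
      using f c by (auto simp: nonneg_cont_def intro!: continuous_intros)
    from modulus_scale_le[OF this, of "inverse c"] c show "c * modulus f \<le> modulus (\<lambda>w. c * f w)"
      by (simp add: field_simps)
  qed
qed (rule compact)

section \<open>The dominating measure and the extension of \<open>l\<close> to L^1\<close>

abbreviation \<nu> :: "'w measure" where "\<nu> \<equiv> modulus.the_measure"

lemma modulus_one_le: "modulus (\<lambda>_. 1) \<le> L"
proof (rule modulus_least)
  fix g :: "'w \<Rightarrow>\<^sub>C 'k" assume "\<And>w. norm (apply_bcontfun g w) \<le> 1"
  then have "norm g \<le> 1" by (rule norm_bound)
  then show "norm (l g) \<le> L"
    using order_trans[OF l_bound mult_left_mono[OF _ L]] by fastforce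
qed (simp add: nonneg_cont_const)

lemma measure_\<nu>_le: "E \<in> sets borel \<Longrightarrow> measure \<nu> E \<le> L"
  using modulus.measure_the_measure_le modulus_one_le by (rule order_trans)

lemma l_le_integral: "norm (l f) \<le> (LINT w|\<nu>. norm (apply_bcontfun f w))"
proof -
  have f: "nonneg_cont (\<lambda>w. norm (apply_bcontfun f w))"
    by (auto simp: nonneg_cont_def intro!: continuous_intros)
  show ?thesis
    using modulus_ge[OF f, of f] modulus.le_integral[OF f] by simp
qed

sublocale \<nu>: finite_measure \<nu>
  by (rule modulus.finite_measure_the_measure)

text \<open>The graph of the continuous extension of \<open>l\<close> to \<open>L\<^sup>1(\<nu>)\<close>.\<close>

definition ext :: "('w \<Rightarrow> 'k) \<Rightarrow> 'k \<Rightarrow> bool"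
  where "ext s a \<longleftrightarrow> integrable \<nu> s \<and>
    (\<forall>e>0. \<exists>\<phi>. (LINT w|\<nu>. norm (apply_bcontfun \<phi> w - s w)) < e \<and> norm (l \<phi> - a) < e)"

lemma integrable_apply: "integrable \<nu> (apply_bcontfun \<phi> :: 'w \<Rightarrow> 'k)"
  by (rule modulus.integrable_cont) simp

lemma extD:
  assumes "ext s a" "0 < e"
  obtains \<phi> where "(LINT w|\<nu>. norm (apply_bcontfun \<phi> w - s w)) < e" "norm (l \<phi> - a) < e"
  using assms unfolding ext_def by blast

lemma ext_add:
  assumes s: "ext s a" and t: "ext t b"
  shows "ext (\<lambda>w. s w + t w) (a + b)"
  unfolding ext_def
proof (intro conjI allI impI)
  have i: "integrable \<nu> s" "integrable \<nu> t" using s t by (auto simp: ext_def)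
  then show "integrable \<nu> (\<lambda>w. s w + t w)" by simp
  fix e :: real assume e: "0 < e"
  obtain \<phi> where \<phi>: "(LINT w|\<nu>. norm (apply_bcontfun \<phi> w - s w)) < e / 2" "norm (l \<phi> - a) < e / 2"
    by (rule extD[OF s half_gt_zero[OF e]])
  obtain \<psi> where \<psi>: "(LINT w|\<nu>. norm (apply_bcontfun \<psi> w - t w)) < e / 2" "norm (l \<psi> - b) < e / 2"
    by (rule extD[OF t half_gt_zero[OF e]])
  have "(LINT w|\<nu>. norm (apply_bcontfun (\<phi> + \<psi>) w - (s w + t w)))
      \<le> (LINT w|\<nu>. norm (apply_bcontfun \<phi> w - s w) + norm (apply_bcontfun \<psi> w - t w))"
  proof (rule integral_mono)
    show "norm (apply_bcontfun (\<phi> + \<psi>) w - (s w + t w))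
        \<le> norm (apply_bcontfun \<phi> w - s w) + norm (apply_bcontfun \<psi> w - t w)" for w
      using norm_triangle_ineq[of "apply_bcontfun \<phi> w - s w" "apply_bcontfun \<psi> w - t w"]
      by (simp add: algebra_simps)
  qed (use i integrable_apply in simp_all)
  also have "\<dots> = (LINT w|\<nu>. norm (apply_bcontfun \<phi> w - s w)) + (LINT w|\<nu>. norm (apply_bcontfun \<psi> w - t w))"
    using i integrable_apply by simp
  finally have "(LINT w|\<nu>. norm (apply_bcontfun (\<phi> + \<psi>) w - (s w + t w))) < e"
    using \<phi> \<psi> by simp
  moreover have "norm (l (\<phi> + \<psi>) - (a + b)) < e"
    using norm_triangle_ineq[of "l \<phi> - a" "l \<psi> - b"] \<phi> \<psi> by (simp add: l_add algebra_simps)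
  ultimately show "\<exists>\<phi>. (LINT w|\<nu>. norm (apply_bcontfun \<phi> w - (s w + t w))) < e \<and> norm (l \<phi> - (a + b)) < e"
    by blast
qed

lemma ext_scale:
  assumes s: "ext s a"
  shows "ext (\<lambda>w. c * s w) (c * a)"
  unfolding ext_def
proof (intro conjI allI impI)
  have i: "integrable \<nu> s" using s by (auto simp: ext_def)
  then show "integrable \<nu> (\<lambda>w. c * s w)" by simp
  fix e :: real assume e: "0 < e"
  have c: "0 < norm c + 1" by (simp add: add_nonneg_pos)
  obtain \<phi> where \<phi>: "(LINT w|\<nu>. norm (apply_bcontfun \<phi> w - s w)) < e / (norm c + 1)"
      "norm (l \<phi> - a) < e / (norm c + 1)"
    by (rule extD[OF s divide_pos_pos[OF e c]])
  have le: "norm c * r < e" if "r < e / (norm c + 1)" "0 \<le> r" for r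
  proof -
    have "norm c * r \<le> (norm c + 1) * r" using that by (simp add: distrib_right)
    also have "\<dots> < e" using that c by (simp add: field_simps)
    finally show ?thesis .
  qed
  have "(LINT w|\<nu>. norm (apply_bcontfun (cont_scale (*) c \<phi>) w - c * s w))
      = (LINT w|\<nu>. norm c * norm (apply_bcontfun \<phi> w - s w))"
    by (simp add: scalars.cont_scale_apply norm_mult flip: right_diff_distrib)
  also have "\<dots> = norm c * (LINT w|\<nu>. norm (apply_bcontfun \<phi> w - s w))"
    by simp
  also have "\<dots> < e" by (rule le[OF \<phi>(1)]) simp
  finally have "(LINT w|\<nu>. norm (apply_bcontfun (cont_scale (*) c \<phi>) w - c * s w)) < e" .
  moreover have "norm (l (cont_scale (*) c \<phi>) - c * a) < e"
    using le[OF \<phi>(2)] by (simp add: l_scale norm_mult flip: right_diff_distrib)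
  ultimately show "\<exists>\<phi>. (LINT w|\<nu>. norm (apply_bcontfun \<phi> w - c * s w)) < e \<and> norm (l \<phi> - c * a) < e"
    by blast
qed

lemma ext_diff: "ext s a \<Longrightarrow> ext t b \<Longrightarrow> ext (\<lambda>w. s w - t w) (a - b)"
  using ext_add[of s a "\<lambda>w. - 1 * t w" "- 1 * b"] ext_scale[of t b "- 1"] by simp

lemma ext_cont: "ext (apply_bcontfun \<phi>) (l \<phi>)"
  unfolding ext_def by (auto intro!: exI[of _ \<phi>] integrable_apply)

lemma ext_sum:
  "finite A \<Longrightarrow> (\<And>i. i \<in> A \<Longrightarrow> ext (s i) (a i)) \<Longrightarrow> ext (\<lambda>w. \<Sum>i\<in>A. s i w) (\<Sum>i\<in>A. a i)"
proof (induction A rule: finite_induct)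
  case empty
  have "apply_bcontfun 0 = (\<lambda>_. 0 :: 'k)" by auto
  then show ?case using ext_cont[of 0] l_add[of 0 0] by simp
qed (simp add: ext_add)

text \<open>The bound of \<open>l\<close> by the L^1 seminorm survives the passage to limits.
  Applied to differences, it makes \<open>ext\<close> single valued and continuous.\<close>

lemma ext_bound:
  assumes s: "ext s a"
  shows "norm a \<le> (LINT w|\<nu>. norm (s w))"
proof (rule field_le_epsilon)
  fix e :: real assume e: "0 < e"
  have i: "integrable \<nu> s" using s by (auto simp: ext_def)
  obtain \<phi> where \<phi>: "(LINT w|\<nu>. norm (apply_bcontfun \<phi> w - s w)) < e / 2" "norm (l \<phi> - a) < e / 2"
    by (rule extD[OF s half_gt_zero[OF e]])
  have "norm a \<le> norm (l \<phi>) + norm (l \<phi> - a)"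
    using norm_triangle_ineq4[of "l \<phi>" "l \<phi> - a"] by simp
  also have "norm (l \<phi>) \<le> (LINT w|\<nu>. norm (s w) + norm (apply_bcontfun \<phi> w - s w))"
  proof (rule order_trans[OF l_le_integral integral_mono])
    show "norm (apply_bcontfun \<phi> w) \<le> norm (s w) + norm (apply_bcontfun \<phi> w - s w)" for w
      using norm_triangle_ineq[of "s w" "apply_bcontfun \<phi> w - s w"] by simp
  qed (use i integrable_apply in simp_all)
  also have "\<dots> = (LINT w|\<nu>. norm (s w)) + (LINT w|\<nu>. norm (apply_bcontfun \<phi> w - s w))"
    using i integrable_apply by simp
  finally show "norm a \<le> (LINT w|\<nu>. norm (s w)) + e" using \<phi> by simp
qed

lemma ext_dist: "ext s a \<Longrightarrow> ext t b \<Longrightarrow> dist a b \<le> (LINT w|\<nu>. norm (s w - t w))"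
  using ext_bound[OF ext_diff] by (simp add: dist_norm)

text \<open>Regularity supplies Urysohn functions converging to the indicator in L^1;
  \<open>ext_dist\<close> makes their values under \<open>l\<close> a Cauchy sequence, and the
  scalars are complete.\<close>

lemma ext_indicator_ex:
  assumes E: "E \<in> sets borel"
  shows "\<exists>a. ext (indicator E) a"
proof -
  have iE: "integrable \<nu> (indicator E :: _ \<Rightarrow> 'k)"
  proof (rule \<nu>.integrable_const_bound[where B = 1])
    show "(indicator E :: _ \<Rightarrow> 'k) \<in> borel_measurable \<nu>"
      using E by (intro borel_measurable_indicator) simp
  qed (auto simp: indicator_def)
  have "\<exists>\<phi>. (LINT w|\<nu>. norm (apply_bcontfun \<phi> w - (indicator E w :: 'k))) < e" if e: "0 < e" for e
  proof -
    obtain F G where FG: "compact F" "open G" "F \<subseteq> E" "E \<subseteq> G" "measure \<nu> (G - F) < e"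
      by (rule modulus.the_measure_regular[OF E e])
    have F: "closed F" using FG by (simp add: compact_imp_closed)
    have "- G \<inter> F = {}" using FG by auto
    then obtain h :: "'w \<Rightarrow> real" where h: "continuous_on UNIV h" "\<And>w. 0 \<le> h w" "\<And>w. h w \<le> 1"
      "\<And>w. w \<in> - G \<Longrightarrow> h w = 0" "\<And>w. w \<in> F \<Longrightarrow> h w = 1"
      by (rule Urysohn_compact_t2[OF compact closed_Compl[OF FG(2)] F]) (rule that)
    have \<phi>: "apply_bcontfun (Bcontfun (\<lambda>w. of_real (h w) :: 'k)) = (\<lambda>w. of_real (h w))"
      using h by (intro apply_Bcontfun_compact[OF compact]) (auto intro!: continuous_intros)
    have FG': "G - F \<in> sets borel" using FG F by auto
    have "(LINT w|\<nu>. norm (of_real (h w) - (indicator E w :: 'k))) \<le> (LINT w|\<nu>. indicator (G - F) w)"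
    proof (rule integral_mono)
      have "integrable \<nu> (\<lambda>w. of_real (h w) :: 'k)"
        using integrable_apply[of "Bcontfun (\<lambda>w. of_real (h w))"] by (simp add: \<phi>)
      then show "integrable \<nu> (\<lambda>w. norm (of_real (h w) - (indicator E w :: 'k)))"
        using iE by simp
      show "integrable \<nu> (indicator (G - F) :: _ \<Rightarrow> real)"
        using FG' by (intro integrable_real_indicator) (auto simp: less_top[symmetric])
      fix w
      have "norm (of_real (h w) - 1 :: 'k) = \<bar>h w - 1\<bar>"
        by (metis norm_of_real of_real_1 of_real_diff)
      then show "norm (of_real (h w) - (indicator E w :: 'k)) \<le> indicator (G - F) w"
        using h(2-5)[of w] FG(3,4) by (auto simp: indicator_def)
    qed
    then show ?thesis using FG(5) FG' by (intro exI[of _ "Bcontfun (\<lambda>w. of_real (h w))"]) (simp add: \<phi>)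
  qed
  then have "\<exists>\<phi>. (LINT w|\<nu>. norm (apply_bcontfun \<phi> w - (indicator E w :: 'k))) < 1 / real (Suc n)" for n
    by simp
  then obtain \<phi> where \<phi>: "\<And>n. (LINT w|\<nu>. norm (apply_bcontfun (\<phi> n) w - (indicator E w :: 'k))) < 1 / real (Suc n)"
    by metis
  have small: "\<exists>N. \<forall>n\<ge>N. 1 / real (Suc n) < e" if "0 < e" for e
    using LIMSEQ_Suc[OF lim_inverse_n'] order_tendstoD(2)[of _ 0 sequentially e] that
    unfolding eventually_sequentially by blast
  have "Cauchy (\<lambda>n. l (\<phi> n))"
    unfolding Cauchy_def
  proof (intro allI impI)
    fix e :: real assume "0 < e"
    then obtain N where N: "\<And>n. n \<ge> N \<Longrightarrow> 1 / real (Suc n) < e / 2"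
      using small[of "e / 2"] by auto
    have "dist (l (\<phi> m)) (l (\<phi> n)) < e" if "m \<ge> N" "n \<ge> N" for m n
    proof -
      have "dist (l (\<phi> m)) (l (\<phi> n)) \<le> (LINT w|\<nu>. norm (apply_bcontfun (\<phi> m) w - apply_bcontfun (\<phi> n) w))"
        by (intro ext_dist ext_cont)
      also have "\<dots> \<le> (LINT w|\<nu>. norm (apply_bcontfun (\<phi> m) w - indicator E w) + norm (apply_bcontfun (\<phi> n) w - indicator E w))"
      proof (rule integral_mono)
        show "norm (apply_bcontfun (\<phi> m) w - apply_bcontfun (\<phi> n) w)
          \<le> norm (apply_bcontfun (\<phi> m) w - indicator E w) + norm (apply_bcontfun (\<phi> n) w - indicator E w)" for w
          using norm_triangle_ineq4[of "apply_bcontfun (\<phi> m) w - indicator E w" "apply_bcontfun (\<phi> n) w - indicator E w"]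
          by simp
      qed (use iE integrable_apply in simp_all)
      also have "\<dots> = (LINT w|\<nu>. norm (apply_bcontfun (\<phi> m) w - indicator E w)) + (LINT w|\<nu>. norm (apply_bcontfun (\<phi> n) w - indicator E w))"
        using iE integrable_apply by simp
      also have "\<dots> < e" using \<phi>[of m] \<phi>[of n] N[OF that(1)] N[OF that(2)] by simp
      finally show ?thesis .
    qed
    then show "\<exists>M. \<forall>m\<ge>M. \<forall>n\<ge>M. dist (l (\<phi> m)) (l (\<phi> n)) < e" by blast
  qed
  then obtain a where a: "(\<lambda>n. l (\<phi> n)) \<longlonglongrightarrow> a"
    using Cauchy_convergent convergent_def by blast
  have "ext (indicator E) a"
    unfolding ext_def
  proof (intro conjI allI impI iE)
    fix e :: real assume e: "0 < e"
    obtain N where N: "\<And>n. n \<ge> N \<Longrightarrow> 1 / real (Suc n) < e" using small[OF e] by auto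
    obtain M where M: "\<And>n. n \<ge> M \<Longrightarrow> norm (l (\<phi> n) - a) < e"
      using LIMSEQ_D[OF a e] by blast
    show "\<exists>\<phi>. (LINT w|\<nu>. norm (apply_bcontfun \<phi> w - (indicator E w :: 'k))) < e \<and> norm (l \<phi> - a) < e"
      using \<phi>[of "max M N"] N[of "max M N"] M[of "max M N"] by (intro exI[of _ "\<phi> (max M N)"]) simp
  qed
  then show ?thesis ..
qed

section \<open>The scalar measure obtained from the extension\<close>

text \<open>For Borel \<open>E\<close> the choice is forced, since \<open>ext_dist\<close> leaves
  only one possible value.\<close>

definition riesz_measure :: "'w set \<Rightarrow> 'k"
  where "riesz_measure E = (SOME a. ext (indicator E) a)"

lemma ext_indicator: "E \<in> sets borel \<Longrightarrow> ext (indicator E) (riesz_measure E)"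
  unfolding riesz_measure_def by (rule someI_ex) (rule ext_indicator_ex)

lemma norm_riesz_measure_le:
  assumes E: "E \<in> sets borel"
  shows "norm (riesz_measure E) \<le> measure \<nu> E"
proof -
  have "norm (riesz_measure E) \<le> (LINT w|\<nu>. norm (indicator E w :: 'k))"
    by (rule ext_bound[OF ext_indicator[OF E]])
  also have "(\<lambda>w. norm (indicator E w :: 'k)) = indicat_real E" by (auto simp: indicator_def)
  finally show ?thesis using E by simp
qed

text \<open>The error of a partial sum is at most the \<open>\<nu>\<close>-measure of the remaining
  union, which tends to 0.\<close>

lemma riesz_measure_sums:
  fixes A :: "nat \<Rightarrow> 'w set"
  assumes A: "range A \<subseteq> sets borel" "disjoint_family A"
  shows "(\<lambda>i. riesz_measure (A i)) sums riesz_measure (\<Union>i. A i)"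
proof -
  have A': "A i \<in> sets borel" for i using A by auto
  have le: "dist (\<Sum>i<n. riesz_measure (A i)) (riesz_measure (\<Union>i. A i)) \<le> measure \<nu> (\<Union>i. A i) - (\<Sum>i<n. measure \<nu> (A i))" for n
  proof -
    have "ext (\<lambda>w. \<Sum>i<n. indicator (A i) w) (\<Sum>i<n. riesz_measure (A i))"
      using A' by (intro ext_sum ext_indicator) auto
    moreover have "(\<lambda>w. \<Sum>i<n. indicator (A i) w :: 'k) = indicator (\<Union>i<n. A i)"
      using A(2) by (intro ext indicator_UN_disjoint[symmetric]) (auto intro: disjoint_family_on_mono)
    ultimately have "dist (\<Sum>i<n. riesz_measure (A i)) (riesz_measure (\<Union>i. A i))
        \<le> (LINT w|\<nu>. norm (indicator (\<Union>i<n. A i) w - indicator (\<Union>i. A i) w :: 'k))"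
      using A' by (intro ext_dist ext_indicator) auto
    also have "(\<lambda>w. norm (indicator (\<Union>i<n. A i) w - indicator (\<Union>i. A i) w :: 'k)) = indicat_real ((\<Union>i. A i) - (\<Union>i<n. A i))"
      by (auto simp: indicator_def fun_eq_iff)
    also have "(LINT w|\<nu>. indicat_real ((\<Union>i. A i) - (\<Union>i<n. A i)) w) = measure \<nu> ((\<Union>i. A i) - (\<Union>i<n. A i))"
      using A' by simp
    also have "\<dots> = measure \<nu> (\<Union>i. A i) - measure \<nu> (\<Union>i<n. A i)"
      using A' by (intro \<nu>.finite_measure_Diff) auto
    also have "measure \<nu> (\<Union>i<n. A i) = (\<Sum>i<n. measure \<nu> (A i))"
      using A A' by (intro \<nu>.finite_measure_finite_Union) (auto intro: disjoint_family_on_mono)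
    finally show ?thesis .
  qed
  have "(\<lambda>i. measure \<nu> (A i)) sums measure \<nu> (\<Union>i. A i)"
    using A by (intro \<nu>.finite_measure_UNION) auto
  then have "(\<lambda>n. measure \<nu> (\<Union>i. A i) - (\<Sum>i<n. measure \<nu> (A i))) \<longlonglongrightarrow> measure \<nu> (\<Union>i. A i) - measure \<nu> (\<Union>i. A i)"
    unfolding sums_def by (rule tendsto_diff[OF tendsto_const])
  then show ?thesis
    unfolding sums_def by (intro tendsto_dist_boundI[OF le]) (simp only: diff_self)
qed

lemma regular_riesz_measure: "regular_borel_measure riesz_measure"
  unfolding regular_borel_measure_def
proof (intro conjI allI impI ballI riesz_measure_sums)
  fix E :: "'w set" and e :: real assume "E \<in> sets borel" "0 < e"
  then obtain F G where FG: "compact F" "open G" "F \<subseteq> E" "E \<subseteq> G" "measure \<nu> (G - F) < e"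
    by (rule modulus.the_measure_regular)
  have "norm (riesz_measure A) < e" if A: "A \<in> sets borel" "A \<subseteq> G - F" for A
  proof -
    have "measure \<nu> A \<le> measure \<nu> (G - F)"
      using that FG by (intro \<nu>.finite_measure_mono) (auto simp: compact_imp_closed borel_closed)
    then show ?thesis using norm_riesz_measure_le[OF A(1)] FG(5) by simp
  qed
  then show "\<exists>F G. compact F \<and> open G \<and> F \<subseteq> E \<and> E \<subseteq> G \<and>
      (\<forall>A\<in>sets borel. A \<subseteq> G - F \<longrightarrow> norm (riesz_measure A) < e)"
    using FG by blast
qed

text \<open>On a simple function the extension is exactly the sum that defines the integral, so
  uniform approximation within \<open>1 / real (Suc n)\<close> costs at most that times the total
  mass of \<open>\<nu>\<close>.\<close>

lemma riesz_measure_integral: "has_measure_integral riesz_measure (apply_bcontfun \<phi>) (l \<phi>)"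
proof -
  have "\<exists>s. simple_function borel s \<and> (\<forall>w. dist (s w) (apply_bcontfun \<phi> w) < 1 / real (Suc n))" for n
    using simple_function_approx[OF compact continuous_on_apply_bcontfun, of "1 / real (Suc n)"]
    by (metis divide_pos_pos of_nat_0_less_iff zero_less_Suc zero_less_one)
  then obtain s where s: "\<And>n. simple_function borel (s n)"
    "\<And>n w. dist (s n w) (apply_bcontfun \<phi> w) < 1 / real (Suc n)" by metis
  let ?I = "\<lambda>n. \<Sum>a\<in>range (s n). a * riesz_measure (s n -` {a})"
  have lim: "(\<lambda>n. 1 / real (Suc n)) \<longlonglongrightarrow> 0" by (rule LIMSEQ_Suc[OF lim_inverse_n'])
  have "uniform_limit UNIV s (apply_bcontfun \<phi>) sequentially"
  proof (rule uniform_limitI)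
    fix e :: real assume "0 < e"
    with lim have "\<forall>\<^sub>F n in sequentially. 1 / real (Suc n) < e" by (rule order_tendstoD)
    then show "\<forall>\<^sub>F n in sequentially. \<forall>w\<in>UNIV. dist (s n w) (apply_bcontfun \<phi> w) < e"
      by eventually_elim (use s(2) in \<open>meson less_trans\<close>)
  qed
  moreover have "?I \<longlonglongrightarrow> l \<phi>"
  proof -
    have "dist (?I n) (l \<phi>) \<le> 1 / real (Suc n) * measure \<nu> UNIV" for n
    proof -
      have fin: "finite (range (s n))" and fib: "\<And>a. s n -` {a} \<in> sets borel"
        using s(1)[of n] simple_functionD[OF s(1)[of n]] by (auto simp: simple_function_def)
      have "ext (\<lambda>w. \<Sum>a\<in>range (s n). a * indicator (s n -` {a}) w) (?I n)"
        using fin fib by (intro ext_sum ext_scale ext_indicator)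
      moreover have "(\<Sum>a\<in>range (s n). a * indicator (s n -` {a}) w) = s n w" for w
        using fin by (subst sum.remove[of _ "s n w"]) (auto simp: indicator_def)
      ultimately have sn: "ext (s n) (?I n)" by simp
      have "dist (?I n) (l \<phi>) \<le> (LINT w|\<nu>. norm (s n w - apply_bcontfun \<phi> w))"
        by (intro ext_dist sn ext_cont)
      also have "\<dots> \<le> (LINT w|\<nu>. 1 / real (Suc n))"
        using sn s(2)[of n] integrable_apply
        by (intro integral_mono) (auto simp: ext_def dist_norm less_imp_le)
      finally show ?thesis by simp
    qed
    moreover have "(\<lambda>n. 1 / real (Suc n) * measure \<nu> UNIV) \<longlonglongrightarrow> 0 * measure \<nu> UNIV"
      by (intro tendsto_intros lim)
    then have "(\<lambda>n. 1 / real (Suc n) * measure \<nu> UNIV) \<longlonglongrightarrow> 0"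
      by (simp only: mult_zero_left)
    ultimately show ?thesis by (rule tendsto_dist_boundI)
  qed
  ultimately show ?thesis unfolding has_measure_integral_def using s(1) by blast
qed

end

theorem riesz_representation:
  assumes "cont_functional l L"
  obtains \<mu> where "regular_borel_measure \<mu>" "\<And>\<phi>. has_measure_integral \<mu> (apply_bcontfun \<phi>) (l \<phi>)"
    "\<And>E. E \<in> sets borel \<Longrightarrow> norm (\<mu> E) \<le> L"
proof -
  interpret cont_functional l L by fact
  show thesis
    using that regular_riesz_measure riesz_measure_integral
      order_trans[OF norm_riesz_measure_le measure_\<nu>_le] by blast
qed

section \<open>Integration against finitely additive set functions\<close>

definition simple_integral_of :: "('w::topological_space set \<Rightarrow> 'k::real_normed_field) \<Rightarrow> ('w \<Rightarrow> 'k) \<Rightarrow> 'k"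
  where "simple_integral_of \<mu> s = (\<Sum>a\<in>range s. a * \<mu> (s -` {a}))"

lemma borel_fibre: "simple_function borel p \<Longrightarrow> p -` {c} \<in> sets borel"
  using simple_functionD(2)[of borel p "{c}"] by simp

lemma finite_range_simple: "simple_function borel p \<Longrightarrow> finite (range p)"
  using simple_functionD(1)[of borel p] by simp

locale additive_set_function =
  fixes \<mu> :: "'w::topological_space set \<Rightarrow> 'k::real_or_complex"
  assumes Un: "A \<in> sets borel \<Longrightarrow> B \<in> sets borel \<Longrightarrow> A \<inter> B = {} \<Longrightarrow> \<mu> (A \<union> B) = \<mu> A + \<mu> B"
begin

lemma empty: "\<mu> {} = 0"
  using Un[of "{}" "{}"] by simp

lemma UN:
  "finite I \<Longrightarrow> (\<And>i. i \<in> I \<Longrightarrow> B i \<in> sets borel) \<Longrightarrow> disjoint_family_on B I \<Longrightarrow>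
    \<mu> (\<Union>i\<in>I. B i) = (\<Sum>i\<in>I. \<mu> (B i))"
proof (induction I rule: finite_induct)
  case (insert i I)
  have d: "disjoint_family_on B I" "B i \<inter> (\<Union>i\<in>I. B i) = {}"
    using insert.prems(2) insert.hyps(2) by (auto simp: disjoint_family_on_def)
  have "\<mu> (B i \<union> (\<Union>i\<in>I. B i)) = \<mu> (B i) + \<mu> (\<Union>i\<in>I. B i)"
    using insert by (intro Un d) auto
  then show ?case using insert d by simp
qed (simp add: empty)

text \<open>Within one sign class of \<open>r (\<mu> (B i))\<close> the sum of absolute values is
  the absolute value at a single union, hence at most \<open>M\<close>; two classes give the factor
  2. Here \<open>r\<close> stands for either real coordinate of the scalars.\<close>

lemma sum_abs_le:
  fixes r :: "'k \<Rightarrow> real"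
  assumes r: "\<And>a b. r (a + b) = r a + r b" "\<And>a. \<bar>r a\<bar> \<le> norm a"
    and I: "finite I" "\<And>i. i \<in> I \<Longrightarrow> B i \<in> sets borel" "disjoint_family_on B I" "\<And>i. i \<in> I \<Longrightarrow> B i \<subseteq> D"
    and M: "\<And>A. A \<in> sets borel \<Longrightarrow> A \<subseteq> D \<Longrightarrow> norm (\<mu> A) \<le> M"
  shows "(\<Sum>i\<in>I. \<bar>r (\<mu> (B i))\<bar>) \<le> 2 * M"
proof -
  have r0: "r 0 = 0" using r(1)[of 0 0] by simp
  have part: "\<bar>\<Sum>i\<in>J. r (\<mu> (B i))\<bar> \<le> M" if "J \<subseteq> I" for J
  proof -
    have J: "finite J" using that I(1) by (rule finite_subset)
    have "(\<Sum>i\<in>J. r (\<mu> (B i))) = r (\<Sum>i\<in>J. \<mu> (B i))"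
      using sum_comp_morphism[of r "\<lambda>i. \<mu> (B i)" J] r0 r(1) by (simp add: comp_def)
    also have "(\<Sum>i\<in>J. \<mu> (B i)) = \<mu> (\<Union>i\<in>J. B i)"
      using J I that by (intro UN[symmetric]) (auto intro: disjoint_family_on_mono)
    also have "\<bar>r \<dots>\<bar> \<le> norm (\<mu> (\<Union>i\<in>J. B i))" by (rule r(2))
    also have "\<dots> \<le> M" using J I that by (intro M sets.finite_UN) auto
    finally show ?thesis .
  qed
  have "(\<Sum>i\<in>I. \<bar>r (\<mu> (B i))\<bar>) =
      (\<Sum>i\<in>{i\<in>I. 0 \<le> r (\<mu> (B i))}. r (\<mu> (B i))) + (\<Sum>i\<in>{i\<in>I. \<not> 0 \<le> r (\<mu> (B i))}. - r (\<mu> (B i)))"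
  proof -
    have "(\<Sum>i\<in>I. \<bar>r (\<mu> (B i))\<bar>) = (\<Sum>i\<in>I. if 0 \<le> r (\<mu> (B i)) then r (\<mu> (B i)) else - r (\<mu> (B i)))"
      by (intro sum.cong) (auto simp: abs_if)
    also have "\<dots> = (\<Sum>i\<in>I \<inter> {i. 0 \<le> r (\<mu> (B i))}. r (\<mu> (B i))) + (\<Sum>i\<in>I \<inter> - {i. 0 \<le> r (\<mu> (B i))}. - r (\<mu> (B i)))"
      by (rule sum.If_cases[OF I(1)])
    also have "I \<inter> {i. 0 \<le> r (\<mu> (B i))} = {i\<in>I. 0 \<le> r (\<mu> (B i))}" by auto
    also have "I \<inter> - {i. 0 \<le> r (\<mu> (B i))} = {i\<in>I. \<not> 0 \<le> r (\<mu> (B i))}" by auto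
    finally show ?thesis .
  qed
  also have "\<dots> \<le> M + M"
    using part[of "{i\<in>I. 0 \<le> r (\<mu> (B i))}"] part[of "{i\<in>I. \<not> 0 \<le> r (\<mu> (B i))}"]
    by (intro add_mono) (auto simp: sum_negf abs_le_iff)
  finally show ?thesis by simp
qed

text \<open>The 4 is the factor 2 of \<open>sum_abs_le\<close> once for each of the two
  coordinates.\<close>

lemma sum_mult_le:
  assumes I: "finite I" "\<And>i. i \<in> I \<Longrightarrow> B i \<in> sets borel" "disjoint_family_on B I" "\<And>i. i \<in> I \<Longrightarrow> B i \<subseteq> D"
    and M: "\<And>A. A \<in> sets borel \<Longrightarrow> A \<subseteq> D \<Longrightarrow> norm (\<mu> A) \<le> M"
    and a: "\<And>i. i \<in> I \<Longrightarrow> norm (a i) \<le> R" and R: "0 \<le> R"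
  shows "norm (\<Sum>i\<in>I. a i * \<mu> (B i)) \<le> 4 * R * M"
proof -
  obtain re im :: "'k \<Rightarrow> real" and j :: 'k where
    re: "\<And>a b. re (a + b) = re a + re b" and im: "\<And>a b. im (a + b) = im a + im b" and
    le: "\<And>a. \<bar>re a\<bar> \<le> norm a" "\<And>a. \<bar>im a\<bar> \<le> norm a" "\<And>a. norm a \<le> \<bar>re a\<bar> + \<bar>im a\<bar>" and
    "\<And>a. a = of_real (re a) + j * of_real (im a)"
    "\<And>r s. re (of_real r + j * of_real s) = r"
    "j * j = -1 \<or> (j = 0 \<and> (\<forall>a. im a = 0))"
    by (rule real_or_complex_parts) (rule that)
  have "norm (\<Sum>i\<in>I. a i * \<mu> (B i)) \<le> (\<Sum>i\<in>I. R * (\<bar>re (\<mu> (B i))\<bar> + \<bar>im (\<mu> (B i))\<bar>))"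
    using a R le(3) by (intro sum_norm_le) (auto simp: norm_mult intro!: mult_mono)
  also have "\<dots> = R * ((\<Sum>i\<in>I. \<bar>re (\<mu> (B i))\<bar>) + (\<Sum>i\<in>I. \<bar>im (\<mu> (B i))\<bar>))"
    by (simp add: sum_distrib_left sum.distrib distrib_left)
  also have "\<dots> \<le> R * (2 * M + 2 * M)"
    using sum_abs_le[of re, OF re le(1) I M] sum_abs_le[of im, OF im le(2) I M]
    by (intro mult_left_mono add_mono R) auto
  finally show ?thesis by simp
qed

text \<open>The integral may be computed on the fibres of any simple \<open>p\<close> through which
  the function factors. This puts two integrands on a common partition and allows tags as
  values.\<close>

lemma simple_integral_of_comp:
  assumes p: "simple_function borel p"
  shows "simple_integral_of \<mu> (\<lambda>w. h (p w)) = (\<Sum>c\<in>range p. h c * \<mu> (p -` {c}))"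
proof -
  have fin: "finite (range p)" by (rule finite_range_simple[OF p])
  have rng: "range (\<lambda>w. h (p w)) = h ` range p" by auto
  have "a * \<mu> ((\<lambda>w. h (p w)) -` {a}) = (\<Sum>c\<in>{c\<in>range p. h c = a}. h c * \<mu> (p -` {c}))" for a
  proof -
    have "(\<lambda>w. h (p w)) -` {a} = (\<Union>c\<in>{c\<in>range p. h c = a}. p -` {c})" by auto
    also have "\<mu> \<dots> = (\<Sum>c\<in>{c\<in>range p. h c = a}. \<mu> (p -` {c}))"
      using fin borel_fibre[OF p] by (intro UN) (auto simp: disjoint_family_on_def)
    finally show ?thesis by (simp add: sum_distrib_left)
  qed
  then have "simple_integral_of \<mu> (\<lambda>w. h (p w)) = (\<Sum>a\<in>h ` range p. \<Sum>c\<in>{c\<in>range p. h c = a}. h c * \<mu> (p -` {c}))"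
    unfolding simple_integral_of_def rng by simp
  also have "\<dots> = (\<Sum>c\<in>range p. h c * \<mu> (p -` {c}))"
    by (rule sum.image_gen[OF fin, symmetric])
  finally show ?thesis .
qed

lemma simple_integral_of_indicator:
  assumes E: "E \<in> sets borel"
  shows "simple_integral_of \<mu> (indicator E) = \<mu> E"
proof -
  have p: "simple_function borel (\<lambda>w. w \<in> E)"
    unfolding simple_function_def
  proof (intro conjI ballI)
    show "finite ((\<lambda>w. w \<in> E) ` space borel)" by (rule finite_subset[of _ "{True, False}"]) auto
    fix c
    have "(\<lambda>w. w \<in> E) -` {c} = (if c then E else - E)" by auto
    then show "(\<lambda>w. w \<in> E) -` {c} \<inter> space borel \<in> sets borel"
      using E by (simp add: Compl_eq_Diff_UNIV)
  qed
  have "simple_integral_of \<mu> (\<lambda>w. of_bool (w \<in> E)) = (\<Sum>c\<in>range (\<lambda>w. w \<in> E). of_bool c * \<mu> ((\<lambda>w. w \<in> E) -` {c}))"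
    by (rule simple_integral_of_comp[OF p])
  also have "\<dots> = (\<Sum>c\<in>{True, False}. of_bool c * \<mu> ((\<lambda>w. w \<in> E) -` {c}))"
  proof (rule sum.mono_neutral_left)
    show "\<forall>c\<in>{True, False} - range (\<lambda>w. w \<in> E). of_bool c * \<mu> ((\<lambda>w. w \<in> E) -` {c}) = 0"
    proof
      fix c assume "c \<in> {True, False} - range (\<lambda>w. w \<in> E)"
      then have "(\<lambda>w. w \<in> E) -` {c} = {}" by auto
      then show "of_bool c * \<mu> ((\<lambda>w. w \<in> E) -` {c}) = 0" by (simp only: empty mult_zero_right)
    qed
  qed auto
  also have "\<dots> = \<mu> E" by (simp add: vimage_def)
  also have "(\<lambda>w. of_bool (w \<in> E)) = indicator E" by (auto simp: indicator_def)
  finally show ?thesis .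
qed

text \<open>Two regimes are kept apart: on \<open>D\<close> the functions may differ by much
  (\<open>R1\<close>) if \<open>\<mu>\<close> is small there (\<open>M1\<close>); off
  \<open>D\<close> they differ by little (\<open>R2\<close>) and the global bound \<open>M2\<close>
  suffices.\<close>

lemma simple_integral_of_dist:
  assumes s: "simple_function borel s" and t: "simple_function borel t" and D: "D \<in> sets borel"
    and R: "\<And>w. w \<in> D \<Longrightarrow> norm (s w - t w) \<le> R1" "\<And>w. w \<notin> D \<Longrightarrow> norm (s w - t w) \<le> R2" "0 \<le> R1" "0 \<le> R2"
    and M: "\<And>A. A \<in> sets borel \<Longrightarrow> A \<subseteq> D \<Longrightarrow> norm (\<mu> A) \<le> M1" "\<And>A. A \<in> sets borel \<Longrightarrow> norm (\<mu> A) \<le> M2"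
  shows "norm (simple_integral_of \<mu> s - simple_integral_of \<mu> t) \<le> 4 * R1 * M1 + 4 * R2 * M2"
proof -
  define p where "p = (\<lambda>w. (s w, t w))"
  have p: "simple_function borel p" unfolding p_def using s t by (rule simple_function_Pair)
  note fib = borel_fibre[OF p] and fin = finite_range_simple[OF p]
  \<comment> \<open>On a fibre that misses \<open>D\<close> the difference of values has no bound in
    terms of \<open>D\<close>; setting it to 0 changes nothing, because it multiplies the measure of
    the empty set.\<close>
  define a where "a = (\<lambda>D c. if p -` {c} \<inter> D = {} then 0 else fst c - snd c)"
  have a: "(fst c - snd c) * \<mu> (p -` {c} \<inter> D) = a D c * \<mu> (p -` {c} \<inter> D)" for D c
    by (simp add: a_def empty)
  have a_le: "norm (a D c) \<le> R" if "\<And>w. w \<in> D \<Longrightarrow> norm (s w - t w) \<le> R" "0 \<le> R" for D c R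
    using that by (auto simp: a_def p_def)
  have "simple_integral_of \<mu> s = (\<Sum>c\<in>range p. fst c * \<mu> (p -` {c}))"
    using simple_integral_of_comp[OF p, of fst] by (simp add: p_def)
  moreover have "simple_integral_of \<mu> t = (\<Sum>c\<in>range p. snd c * \<mu> (p -` {c}))"
    using simple_integral_of_comp[OF p, of snd] by (simp add: p_def)
  ultimately have "simple_integral_of \<mu> s - simple_integral_of \<mu> t = (\<Sum>c\<in>range p. (fst c - snd c) * \<mu> (p -` {c}))"
    by (simp add: sum_subtractf left_diff_distrib)
  also have "\<dots> = (\<Sum>c\<in>range p. (fst c - snd c) * (\<mu> (p -` {c} \<inter> D) + \<mu> (p -` {c} \<inter> - D)))"
  proof (rule sum.cong[OF refl])
    fix c
    have "p -` {c} = (p -` {c} \<inter> D) \<union> (p -` {c} \<inter> - D)" by auto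
    then have "\<mu> (p -` {c}) = \<mu> ((p -` {c} \<inter> D) \<union> (p -` {c} \<inter> - D))" by (rule arg_cong)
    also have "\<dots> = \<mu> (p -` {c} \<inter> D) + \<mu> (p -` {c} \<inter> - D)"
      using fib D by (intro Un) (auto simp: Compl_eq_Diff_UNIV)
    finally show "(fst c - snd c) * \<mu> (p -` {c}) = (fst c - snd c) * (\<mu> (p -` {c} \<inter> D) + \<mu> (p -` {c} \<inter> - D))"
      by (rule arg_cong)
  qed
  also have "\<dots> = (\<Sum>c\<in>range p. a D c * \<mu> (p -` {c} \<inter> D)) + (\<Sum>c\<in>range p. a (- D) c * \<mu> (p -` {c} \<inter> - D))"
    by (simp only: distrib_left sum.distrib a)
  also have "norm \<dots> \<le> norm (\<Sum>c\<in>range p. a D c * \<mu> (p -` {c} \<inter> D)) + norm (\<Sum>c\<in>range p. a (- D) c * \<mu> (p -` {c} \<inter> - D))"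
    by (rule norm_triangle_ineq)
  also have "\<dots> \<le> 4 * R1 * M1 + 4 * R2 * M2"
  proof (rule add_mono)
    show "norm (\<Sum>c\<in>range p. a D c * \<mu> (p -` {c} \<inter> D)) \<le> 4 * R1 * M1"
      by (rule sum_mult_le[where D = D, OF fin]) (use fib D R M a_le in \<open>auto simp: disjoint_family_on_def\<close>)
    show "norm (\<Sum>c\<in>range p. a (- D) c * \<mu> (p -` {c} \<inter> - D)) \<le> 4 * R2 * M2"
    proof (rule sum_mult_le[where D = UNIV, OF fin])
      show "norm (a (- D) c) \<le> R2" for c using R by (intro a_le) auto
    qed (use fib D R M in \<open>auto simp: disjoint_family_on_def Compl_eq_Diff_UNIV\<close>)
  qed
  finally show ?thesis .
qed

lemma integral_dist_simple:
  assumes I: "has_measure_integral \<mu> f I" and t: "simple_function borel t" and D: "D \<in> sets borel"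
    and R: "\<And>w. w \<in> D \<Longrightarrow> norm (f w - t w) \<le> R1" "\<And>w. w \<notin> D \<Longrightarrow> norm (f w - t w) \<le> R2" "0 \<le> R1" "0 \<le> R2"
    and M: "\<And>A. A \<in> sets borel \<Longrightarrow> A \<subseteq> D \<Longrightarrow> norm (\<mu> A) \<le> M1" "\<And>A. A \<in> sets borel \<Longrightarrow> norm (\<mu> A) \<le> M2"
  shows "norm (I - simple_integral_of \<mu> t) \<le> 4 * R1 * M1 + 4 * R2 * M2"
proof (rule field_le_epsilon)
  fix e :: real assume e: "0 < e"
  have M0: "0 \<le> M1" "0 \<le> M2" using M(1)[of "{}"] M(2)[of "{}"] by (auto simp: empty)
  \<comment> \<open>A simple function uniformly \<open>d\<close>-close to \<open>f\<close> raises
    both \<open>R1\<close> and \<open>R2\<close> by \<open>d\<close>, which changes the bound by at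
    most \<open>e\<close>.\<close>
  define d where "d = e / (4 * M1 + 4 * M2 + 1)"
  have d: "0 < d" "d * (4 * M1 + 4 * M2) \<le> e" using e M0 by (auto simp: d_def field_simps)
  obtain s where s: "\<And>n. simple_function borel (s n)" "uniform_limit UNIV s f sequentially"
    and lim: "(\<lambda>n. simple_integral_of \<mu> (s n)) \<longlonglongrightarrow> I"
    using I unfolding has_measure_integral_def simple_integral_of_def by blast
  have "\<forall>\<^sub>F n in sequentially. norm (simple_integral_of \<mu> (s n) - simple_integral_of \<mu> t) \<le> 4 * (R1 + d) * M1 + 4 * (R2 + d) * M2"
    using uniform_limitD[OF s(2) d(1)]
  proof eventually_elim
    case (elim n)
    have *: "norm (s n w - t w) \<le> r + d" if "norm (f w - t w) \<le> r" for w r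
    proof -
      have "norm (s n w - f w) < d" using elim by (simp add: dist_norm)
      then show ?thesis using norm_triangle_ineq[of "f w - t w" "s n w - f w"] that by simp
    qed
    show ?case
      by (rule simple_integral_of_dist[OF s(1) t D]) (use * R d(1) M in simp_all)
  qed
  then have "norm (I - simple_integral_of \<mu> t) \<le> 4 * (R1 + d) * M1 + 4 * (R2 + d) * M2"
    by (intro tendsto_upperbound[OF tendsto_norm[OF tendsto_diff[OF lim tendsto_const]]]) auto
  also have "\<dots> \<le> 4 * R1 * M1 + 4 * R2 * M2 + e"
    using d(2) by (simp add: algebra_simps)
  finally show "norm (I - simple_integral_of \<mu> t) \<le> 4 * R1 * M1 + 4 * R2 * M2 + e" .
qed

end

section \<open>Regular Borel measures: boundedness, and comparison with continuous functions\<close>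

lemma regular_borel_measure_additive:
  assumes "regular_borel_measure \<mu>"
  shows "additive_set_function \<mu>"
proof
  have sums: "(\<lambda>i. \<mu> (A i)) sums \<mu> (\<Union>i. A i)" if "range A \<subseteq> sets borel" "disjoint_family A" for A :: "nat \<Rightarrow> _"
    using assms that unfolding regular_borel_measure_def by blast
  \<comment> \<open>A convergent series with constant terms has zero terms; this yields the value at
    the empty set.\<close>
  have "(\<lambda>_ :: nat. \<mu> {}) sums \<mu> {}"
    using sums[of "\<lambda>_. {}"] by (simp add: disjoint_family_on_def)
  then have "(\<lambda>_ :: nat. \<mu> {}) \<longlonglongrightarrow> 0" by (intro summable_LIMSEQ_zero) (rule sums_summable)
  then have empty: "\<mu> {} = 0" by (simp add: LIMSEQ_const_iff)
  fix A B :: "'a set" assume "A \<in> sets borel" "B \<in> sets borel" "A \<inter> B = {}"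
  then have "(\<lambda>i. \<mu> (binaryset A B i)) sums \<mu> (\<Union>i. binaryset A B i)"
    by (intro sums) (auto simp: range_binaryset_eq disjoint_family_on_def binaryset_def)
  moreover have "(\<lambda>i. \<mu> (binaryset A B i)) sums (\<mu> A + \<mu> B)"
    using empty by (rule binaryset_sums)
  ultimately show "\<mu> (A \<union> B) = \<mu> A + \<mu> B"
    by (simp add: UN_binaryset_eq sums_unique2)
qed

lemma regular_borel_measureD:
  assumes "regular_borel_measure \<mu>" "E \<in> sets borel" "0 < e"
  obtains F G where "compact F" "open G" "F \<subseteq> E" "E \<subseteq> G"
    "\<And>A. A \<in> sets borel \<Longrightarrow> A \<subseteq> G - F \<Longrightarrow> norm (\<mu> A) < e"
  using assms unfolding regular_borel_measure_def by meson

text \<open>Regularity at a point gives a neighbourhood on which the measure is bounded.\<close>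

lemma regular_borel_measure_bounded:
  fixes \<mu> :: "'w::t2_space set \<Rightarrow> 'k::real_or_complex"
  assumes compact: "compact (UNIV :: 'w set)" and \<mu>: "regular_borel_measure \<mu>"
  obtains M where "\<And>A. A \<in> sets borel \<Longrightarrow> norm (\<mu> A) \<le> M"
proof -
  interpret additive_set_function \<mu> by (rule regular_borel_measure_additive[OF \<mu>])
  have "\<exists>G. open G \<and> w \<in> G \<and> (\<forall>A\<in>sets borel. A \<subseteq> G \<longrightarrow> norm (\<mu> A) \<le> norm (\<mu> {w}) + 1)" for w
  proof -
    obtain F G where FG: "compact F" "open G" "F \<subseteq> {w}" "{w} \<subseteq> G"
      "\<And>A. A \<in> sets borel \<Longrightarrow> A \<subseteq> G - F \<Longrightarrow> norm (\<mu> A) < 1"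
    proof (rule regular_borel_measureD[OF \<mu>, of "{w}" 1])
      show "{w} \<in> sets borel" by simp
      show "0 < (1 :: real)" by simp
    qed (rule that)
    have "norm (\<mu> A) \<le> norm (\<mu> {w}) + 1" if A: "A \<in> sets borel" "A \<subseteq> G" for A
    proof -
      have "\<mu> A = \<mu> ((A \<inter> {w}) \<union> (A - {w}))" by (rule arg_cong[of _ _ \<mu>]) auto
      also have "\<dots> = \<mu> (A \<inter> {w}) + \<mu> (A - {w})" using A by (intro Un) auto
      also have "norm \<dots> \<le> norm (\<mu> (A \<inter> {w})) + norm (\<mu> (A - {w}))" by (rule norm_triangle_ineq)
      also have "norm (\<mu> (A \<inter> {w})) \<le> norm (\<mu> {w})" by (cases "w \<in> A") (auto simp: empty)
      also have "norm (\<mu> (A - {w})) < 1" using A FG(3) by (intro FG(5)) auto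
      finally show ?thesis by simp
    qed
    then show ?thesis using FG by blast
  qed
  then obtain G where G: "\<And>w. open (G w)" "\<And>w. w \<in> G w"
    "\<And>w A. A \<in> sets borel \<Longrightarrow> A \<subseteq> G w \<Longrightarrow> norm (\<mu> A) \<le> norm (\<mu> {w}) + 1" by metis
  obtain \<tau> where \<tau>: "simple_function borel \<tau>" "\<And>w. w \<in> G (\<tau> w)"
    by (rule simple_function_tag[OF compact G(1,2)]) (rule that)
  note fib = borel_fibre[OF \<tau>(1)] and fin = finite_range_simple[OF \<tau>(1)]
  show thesis
  proof (rule that)
    fix A :: "'w set" assume A: "A \<in> sets borel"
    have "A = (\<Union>c\<in>range \<tau>. A \<inter> \<tau> -` {c})" by auto
    then have "\<mu> A = \<mu> (\<Union>c\<in>range \<tau>. A \<inter> \<tau> -` {c})" by (rule arg_cong)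
    also have "\<dots> = (\<Sum>c\<in>range \<tau>. \<mu> (A \<inter> \<tau> -` {c}))"
      using A fib fin by (intro UN) (auto simp: disjoint_family_on_def)
    also have "norm \<dots> \<le> (\<Sum>c\<in>range \<tau>. norm (\<mu> {c}) + 1)"
    proof (rule sum_norm_le)
      fix c
      have "\<tau> -` {c} \<subseteq> G c" using \<tau>(2) by auto
      then show "norm (\<mu> (A \<inter> \<tau> -` {c})) \<le> norm (\<mu> {c}) + 1" using A fib by (intro G(3)) auto
    qed
    finally show "norm (\<mu> A) \<le> (\<Sum>c\<in>range \<tau>. norm (\<mu> {c}) + 1)" .
  qed
qed

definition represents :: "('w::t2_space set \<Rightarrow> 'k::real_or_complex) \<Rightarrow> (('w \<Rightarrow>\<^sub>C 'k) \<Rightarrow> 'k) \<Rightarrow> bool"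
  where "represents \<mu> l \<longleftrightarrow> regular_borel_measure \<mu> \<and>
    (\<forall>\<phi>. has_measure_integral \<mu> (apply_bcontfun \<phi>) (l \<phi>))"

text \<open>\<open>h\<close> and the indicator of \<open>E\<close> agree off \<open>G - F\<close>
  and differ by at most 1 on it, so \<open>integral_dist_simple\<close> applies with
  \<open>R1 = 1\<close> and \<open>R2 = 0\<close>.\<close>

lemma represents_near:
  fixes \<mu> :: "'w::t2_space set \<Rightarrow> 'k::real_or_complex"
  assumes compact: "compact (UNIV :: 'w set)" and \<mu>: "represents \<mu> l" and E: "E \<in> sets borel"
    and FG: "compact F" "open G" "F \<subseteq> E" "E \<subseteq> G"
    and small: "\<And>A. A \<in> sets borel \<Longrightarrow> A \<subseteq> G - F \<Longrightarrow> norm (\<mu> A) \<le> e"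
    and \<phi>: "\<And>w. apply_bcontfun \<phi> w = of_real (h w)" "\<And>w. 0 \<le> h w" "\<And>w. h w \<le> 1"
      "\<And>w. w \<in> F \<Longrightarrow> h w = 1" "\<And>w. w \<notin> G \<Longrightarrow> h w = 0"
  shows "norm (l \<phi> - \<mu> E) \<le> 4 * e"
proof -
  have reg: "regular_borel_measure \<mu>" using \<mu> by (simp add: represents_def)
  interpret additive_set_function \<mu> by (rule regular_borel_measure_additive[OF reg])
  obtain M where M: "\<And>A. A \<in> sets borel \<Longrightarrow> norm (\<mu> A) \<le> M"
    using regular_borel_measure_bounded[OF compact reg] by metis
  have "norm (l \<phi> - simple_integral_of \<mu> (indicator E)) \<le> 4 * 1 * e + 4 * 0 * M"
  proof (rule integral_dist_simple)
    show "has_measure_integral \<mu> (apply_bcontfun \<phi>) (l \<phi>)" using \<mu> by (simp add: represents_def)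
    show "simple_function borel (indicator E :: 'w \<Rightarrow> 'k)" using E by (rule simple_function_indicator)
    show "G - F \<in> sets borel" using FG by (auto simp: compact_imp_closed)
    have "norm (of_real (h w) - 1 :: 'k) = \<bar>h w - 1\<bar>" for w
      by (metis norm_of_real of_real_1 of_real_diff)
    then show "norm (apply_bcontfun \<phi> w - indicator E w) \<le> 1" if "w \<in> G - F" for w
      using \<phi>(2,3)[of w] by (simp add: \<phi>(1) indicator_def)
    show "norm (apply_bcontfun \<phi> w - indicator E w) \<le> 0" if "w \<notin> G - F" for w
      using that FG(3,4) \<phi>(4,5)[of w] by (cases "w \<in> F") (auto simp: \<phi>(1) indicator_def)
  qed (use small M in auto)
  then show ?thesis by (simp add: simple_integral_of_indicator[OF E])
qed

text \<open>Uniting the compact sets and intersecting the open ones keeps the gap small for every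
  measure, so one Urysohn function serves all pairs. Identities between functionals at
  \<open>\<phi>\<close> thereby become identities between measures at \<open>E\<close>.\<close>

lemma represents_near_finite:
  fixes P :: "(('w::t2_space set \<Rightarrow> 'k::real_or_complex) \<times> (('w \<Rightarrow>\<^sub>C 'k) \<Rightarrow> 'k)) set"
  assumes compact: "compact (UNIV :: 'w set)" and P: "finite P" "\<And>\<mu> l. (\<mu>, l) \<in> P \<Longrightarrow> represents \<mu> l"
    and E: "E \<in> sets borel" and e: "0 < e"
  obtains \<phi> where "\<And>\<mu> l. (\<mu>, l) \<in> P \<Longrightarrow> norm (l \<phi> - \<mu> E) \<le> e"
proof -
  have "\<exists>F G. compact F \<and> open G \<and> F \<subseteq> E \<and> E \<subseteq> G \<and>
      (\<forall>(\<mu>, l)\<in>P. \<forall>A\<in>sets borel. A \<subseteq> G - F \<longrightarrow> norm (\<mu> A) \<le> e / 4)"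
    using P
  proof (induction P rule: finite_induct)
    case empty
    show ?case by (rule exI[of _ "{}"], rule exI[of _ UNIV]) simp
  next
    case (insert x P)
    obtain \<mu> l where x: "x = (\<mu>, l)" by (cases x)
    obtain F G where FG: "compact F" "open G" "F \<subseteq> E" "E \<subseteq> G"
      "\<forall>(\<mu>, l)\<in>P. \<forall>A\<in>sets borel. A \<subseteq> G - F \<longrightarrow> norm (\<mu> A) \<le> e / 4"
      using insert.IH insert.prems by (auto simp: x)
    have \<mu>: "regular_borel_measure \<mu>" using insert.prems[of \<mu> l] by (simp add: x represents_def)
    have e4: "0 < e / 4" using e by simp
    obtain F' G' where FG': "compact F'" "open G'" "F' \<subseteq> E" "E \<subseteq> G'"
      "\<And>A. A \<in> sets borel \<Longrightarrow> A \<subseteq> G' - F' \<Longrightarrow> norm (\<mu> A) < e / 4"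
      by (rule regular_borel_measureD[OF \<mu> E e4]) (rule that)
    show ?case
    proof (rule exI[of _ "F \<union> F'"], rule exI[of _ "G \<inter> G'"], intro conjI)
      show "\<forall>(\<mu>, l)\<in>insert x P. \<forall>A\<in>sets borel. A \<subseteq> G \<inter> G' - (F \<union> F') \<longrightarrow> norm (\<mu> A) \<le> e / 4"
      proof safe
        fix \<mu>' l' A assume A: "A \<in> sets borel" "A \<subseteq> G \<inter> G' - (F \<union> F')"
        have sub: "A \<subseteq> G - F" "A \<subseteq> G' - F'" using A(2) by auto
        show "norm (\<mu>' A) \<le> e / 4" if "x = (\<mu>', l')"
          using FG'(5)[OF A(1) sub(2)] that by (simp add: x)
        show "norm (\<mu>' A) \<le> e / 4" if "(\<mu>', l') \<in> P"
          using FG(5) A(1) sub(1) that by blast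
      qed
    qed (use FG FG' in auto)
  qed
  then obtain F G where FG: "compact F" "open G" "F \<subseteq> E" "E \<subseteq> G"
    "\<And>\<mu> l A. (\<mu>, l) \<in> P \<Longrightarrow> A \<in> sets borel \<Longrightarrow> A \<subseteq> G - F \<Longrightarrow> norm (\<mu> A) \<le> e / 4"
    by fast
  have F: "closed F" using FG(1) by (rule compact_imp_closed)
  have disj: "- G \<inter> F = {}" using FG by auto
  obtain h :: "'w \<Rightarrow> real" where h: "continuous_on UNIV h" "\<And>w. 0 \<le> h w" "\<And>w. h w \<le> 1"
    "\<And>w. w \<in> - G \<Longrightarrow> h w = 0" "\<And>w. w \<in> F \<Longrightarrow> h w = 1"
    by (rule Urysohn_compact_t2[OF compact closed_Compl[OF FG(2)] F disj]) (rule that)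
  have \<phi>: "apply_bcontfun (Bcontfun (\<lambda>w. of_real (h w) :: 'k)) = (\<lambda>w. of_real (h w))"
    using h by (intro apply_Bcontfun_compact[OF compact]) (auto intro!: continuous_intros)
  show thesis
  proof (rule that)
    fix \<mu> l assume in_P: "(\<mu>, l) \<in> P"
    have "norm (l (Bcontfun (\<lambda>w. of_real (h w))) - \<mu> E) \<le> 4 * (e / 4)"
      by (rule represents_near[OF compact P(2)[OF in_P] E FG(1-4) FG(5)[OF in_P], where h = h])
        (use h in \<open>auto simp: \<phi>\<close>)
    then show "norm (l (Bcontfun (\<lambda>w. of_real (h w))) - \<mu> E) \<le> e" by simp
  qed
qed

text \<open>Both values are close to \<open>l \<phi>\<close> for a common \<open>\<phi>\<close>.
  This gives the \<open>THE\<close> in \<open>indicator_bidual\<close> its meaning.\<close>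

lemma represents_unique:
  fixes \<mu> :: "'w::t2_space set \<Rightarrow> 'k::real_or_complex"
  assumes "compact (UNIV :: 'w set)" "represents \<mu> l" "represents \<mu>' l" "E \<in> sets borel"
  shows "\<mu> E = \<mu>' E"
proof -
  have "dist (\<mu> E) (\<mu>' E) \<le> 0"
  proof (rule field_le_epsilon)
    fix e :: real assume "0 < e"
    then have e2: "0 < e / 2" by simp
    obtain \<phi> where \<phi>: "\<And>\<nu> l'. (\<nu>, l') \<in> {(\<mu>, l), (\<mu>', l)} \<Longrightarrow> norm (l' \<phi> - \<nu> E) \<le> e / 2"
    proof (rule represents_near_finite[OF assms(1) _ _ assms(4) e2])
      show "finite {(\<mu>, l), (\<mu>', l)}" by simp
      show "represents \<nu> l'" if "(\<nu>, l') \<in> {(\<mu>, l), (\<mu>', l)}" for \<nu> l'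
        using that assms(2,3) by auto
    qed (rule that)
    have "norm (l \<phi> - \<mu> E) \<le> e / 2" "norm (l \<phi> - \<mu>' E) \<le> e / 2" by (rule \<phi>, simp)+
    then show "dist (\<mu> E) (\<mu>' E) \<le> 0 + e"
      using dist_triangle3[of "\<mu> E" "\<mu>' E" "l \<phi>"]
      by (simp add: dist_norm)
  qed
  then show ?thesis by simp
qed

section \<open>Iterated duals\<close>

text \<open>Records what the supremum norm on the dual relies on and what passes to the dual again;
  a nonempty ball keeps that supremum from ranging over the empty set.\<close>

definition wf_space :: "('k::real_or_complex, 'v) normed_space_over \<Rightarrow> bool"
  where "wf_space V \<longleftrightarrow> (\<forall>u\<in>carrier V. \<forall>v\<in>carrier V. add V u v \<in> carrier V) \<and>
    (\<forall>a. \<forall>v\<in>carrier V. smult V a v \<in> carrier V) \<and> (\<forall>v\<in>carrier V. 0 \<le> nrm V v) \<and> unit_ball V \<noteq> {}"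

lemma wf_space_of: "wf_space (space_of s)"
  by (auto simp: wf_space_def space_of_def unit_ball_def intro: exI[of _ 0])

lemma dual_bdd:
  assumes V: "wf_space V" and f: "f \<in> carrier (dual V)"
  shows "bdd_above ((\<lambda>v. norm (f v)) ` unit_ball V)"
proof -
  obtain C where C: "\<And>v. v \<in> carrier V \<Longrightarrow> norm (f v) \<le> C * nrm V v"
    using f unfolding dual_def by fastforce
  show ?thesis
  proof (rule bdd_aboveI2)
    fix v assume v: "v \<in> unit_ball V"
    then have "norm (f v) \<le> C * nrm V v" by (intro C) (simp add: unit_ball_def)
    also have "\<dots> \<le> \<bar>C\<bar> * 1"
      using v V by (intro mult_mono) (auto simp: unit_ball_def wf_space_def)
    finally show "norm (f v) \<le> \<bar>C\<bar>" by simp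
  qed
qed

lemma dual_apply_le:
  assumes "wf_space V" "f \<in> carrier (dual V)" "v \<in> unit_ball V"
  shows "norm (f v) \<le> nrm (dual V) f"
  using cSUP_upper[OF assms(3) dual_bdd[OF assms(1,2)]] by (simp add: dual_def)

lemma dual_nrm_le:
  assumes "wf_space V" "\<And>v. v \<in> unit_ball V \<Longrightarrow> norm (f v) \<le> c"
  shows "nrm (dual V) f \<le> c"
  using assms unfolding dual_def wf_space_def by (auto intro!: cSUP_least)

lemma carrier_dualI:
  assumes "f \<in> extensional (carrier V)"
    "\<And>u v. u \<in> carrier V \<Longrightarrow> v \<in> carrier V \<Longrightarrow> f (add V u v) = f u + f v"
    "\<And>a v. v \<in> carrier V \<Longrightarrow> f (smult V a v) = a * f v"
    "\<And>v. v \<in> carrier V \<Longrightarrow> norm (f v) \<le> C * nrm V v"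
  shows "f \<in> carrier (dual V)"
  using assms unfolding dual_def by (auto intro!: exI[of _ C])

lemma carrier_dualD:
  assumes "f \<in> carrier (dual V)"
  shows "u \<in> carrier V \<Longrightarrow> v \<in> carrier V \<Longrightarrow> f (add V u v) = f u + f v"
    "v \<in> carrier V \<Longrightarrow> f (smult V a v) = a * f v"
    "\<exists>C. \<forall>v\<in>carrier V. norm (f v) \<le> C * nrm V v"
    "f \<in> extensional (carrier V)"
  using assms by (auto simp: dual_def)

lemma dual_add: "add (dual V) f g = (\<lambda>v\<in>carrier V. f v + g v)"
  and dual_smult: "smult (dual V) a f = (\<lambda>v\<in>carrier V. a * f v)"
  by (simp_all add: dual_def)

lemma wf_space_dual:
  fixes V :: "('k::real_or_complex, 'v) normed_space_over"
  assumes V: "wf_space V"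
  shows "wf_space (dual V)"
proof -
  have closed: "u \<in> carrier V \<Longrightarrow> v \<in> carrier V \<Longrightarrow> add V u v \<in> carrier V"
    "v \<in> carrier V \<Longrightarrow> smult V a v \<in> carrier V" "v \<in> carrier V \<Longrightarrow> 0 \<le> nrm V v" for u v a
    using V by (auto simp: wf_space_def)
  have "add (dual V) f g \<in> carrier (dual V)" if f: "f \<in> carrier (dual V)" and g: "g \<in> carrier (dual V)" for f g
  proof -
    obtain C D where C: "\<And>v. v \<in> carrier V \<Longrightarrow> norm (f v) \<le> C * nrm V v"
      and D: "\<And>v. v \<in> carrier V \<Longrightarrow> norm (g v) \<le> D * nrm V v"
      using carrier_dualD(3)[OF f] carrier_dualD(3)[OF g] by blast
    show ?thesis
      unfolding dual_add
    proof (rule carrier_dualI[where C = "C + D"])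
      fix v assume v: "v \<in> carrier V"
      have "norm (f v + g v) \<le> norm (f v) + norm (g v)" by (rule norm_triangle_ineq)
      also have "\<dots> \<le> (C + D) * nrm V v" using C[OF v] D[OF v] by (simp add: distrib_right)
      finally show "norm ((\<lambda>v\<in>carrier V. f v + g v) v) \<le> (C + D) * nrm V v" using v by simp
    qed (simp_all add: closed carrier_dualD[OF f] carrier_dualD[OF g] distrib_left)
  qed
  moreover have smult: "smult (dual V) a f \<in> carrier (dual V)" if f: "f \<in> carrier (dual V)" for a f
  proof -
    obtain C where C: "\<And>v. v \<in> carrier V \<Longrightarrow> norm (f v) \<le> C * nrm V v"
      using carrier_dualD(3)[OF f] by blast
    show ?thesis
      unfolding dual_smult
      by (rule carrier_dualI[where C = "norm a * C"])
        (use C in \<open>simp_all add: closed carrier_dualD[OF f] distrib_left norm_mult mult.assoc mult_left_mono\<close>)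
  qed
  moreover have "0 \<le> nrm (dual V) f" if "f \<in> carrier (dual V)" for f
  proof -
    obtain v where "v \<in> unit_ball V" using V by (auto simp: wf_space_def)
    from dual_apply_le[OF V that this] show ?thesis by (rule order_trans[OF norm_ge_zero])
  qed
  moreover have "(\<lambda>v\<in>carrier V. 0) \<in> unit_ball (dual V)"
    unfolding unit_ball_def
  proof safe
    show "(\<lambda>v\<in>carrier V. 0) \<in> carrier (dual V)"
      by (rule carrier_dualI[where C = 0]) (simp_all add: closed)
    show "nrm (dual V) (\<lambda>v\<in>carrier V. 0) \<le> 1"
      by (rule dual_nrm_le[OF V]) (simp add: unit_ball_def)
  qed
  ultimately show ?thesis by (auto simp: wf_space_def)
qed

lemma dual_apply_le_norm:
  fixes scale :: "'k::real_or_complex \<Rightarrow> 'a::real_normed_vector \<Rightarrow> 'a"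
  assumes norm_scale: "\<And>a x. norm (scale a x) = norm a * norm x"
    and f: "f \<in> carrier (dual (space_of scale))"
  shows "norm (f x) \<le> nrm (dual (space_of scale)) f * norm x"
proof (cases "x = 0")
  case True
  have "f 0 = 0"
    using carrier_dualD(1)[OF f, of 0 0] by (simp add: space_of_def)
  then show ?thesis using True by simp
next
  case False
  have "norm (f (scale (of_real (inverse (norm x))) x)) \<le> nrm (dual (space_of scale)) f"
  proof (rule dual_apply_le[OF wf_space_of f])
    have "norm (scale (of_real (inverse (norm x))) x) = 1"
      using False by (simp only: norm_scale norm_of_real) simp
    then show "scale (of_real (inverse (norm x))) x \<in> unit_ball (space_of scale)"
      by (simp only: unit_ball_def space_of_def) simp
  qed
  also have "f (scale (of_real (inverse (norm x))) x) = of_real (inverse (norm x)) * f x"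
    using carrier_dualD(2)[OF f, of x] by (simp add: space_of_def)
  finally have "inverse (norm x) * norm (f x) \<le> nrm (dual (space_of scale)) f"
    by (simp add: norm_mult norm_inverse)
  then show ?thesis using False by (simp add: field_simps)
qed

lemma (in banach_space_over) norm_cont_scale:
  fixes f :: "'w::topological_space \<Rightarrow>\<^sub>C 'a"
  shows "norm (cont_scale scale a f) = norm a * norm f"
proof (cases "a = 0")
  interpret C: vector_space "cont_scale scale :: 'k \<Rightarrow> ('w \<Rightarrow>\<^sub>C 'a) \<Rightarrow> _"
    by (rule vector_space_cont_scale)
  {
    case True
    then show ?thesis by simp
  next
    case False
    have le: "norm (cont_scale scale a f) \<le> norm a * norm f" for a and f :: "'w \<Rightarrow>\<^sub>C 'a"
      by (rule norm_bound) (simp add: cont_scale_apply norm_scale mult_left_mono norm_bounded)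
    have "norm f = norm (cont_scale scale (inverse a) (cont_scale scale a f))"
      using False by simp
    also have "\<dots> \<le> inverse (norm a) * norm (cont_scale scale a f)"
      using le[of "inverse a" "cont_scale scale a f"] False by (simp only: norm_inverse)
    finally have "norm a * norm f \<le> norm (cont_scale scale a f)"
      using False by (simp add: field_simps)
    then show ?thesis using le by (intro antisym) auto
  }
qed

section \<open>The bidual element of a Borel set\<close>

lemma cont_functional_dual:
  fixes l :: "('w::t2_space \<Rightarrow>\<^sub>C 'k::real_or_complex) \<Rightarrow> 'k"
  assumes compact: "compact (UNIV :: 'w set)" and l: "l \<in> carrier (dual cont_space)"
  shows "cont_functional l (nrm (dual cont_space) l)"
proof -
  interpret S: banach_space_over "(*) :: 'k \<Rightarrow> _" by (rule banach_space_over_scalars)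
  show ?thesis
  proof
    show "l (f + g) = l f + l g" for f g
      using carrier_dualD(1)[OF l, of f g] by (simp add: cont_space_def space_of_def)
    show "l (cont_scale (*) a f) = a * l f" for a f
      using carrier_dualD(2)[OF l, of f a] by (simp add: cont_space_def space_of_def)
    show "norm (l f) \<le> nrm (dual cont_space) l * norm f" for f
      using dual_apply_le_norm[OF S.norm_cont_scale, of l f] l by (simp add: cont_space_def)
    show "0 \<le> nrm (dual cont_space) l"
      using wf_space_dual[OF wf_space_of] l unfolding cont_space_def wf_space_def by blast
  qed (rule compact)
qed

lemma represents_indicator_bidual:
  fixes l :: "('w::t2_space \<Rightarrow>\<^sub>C 'k::real_or_complex) \<Rightarrow> 'k"
  assumes compact: "compact (UNIV :: 'w set)" and l: "l \<in> carrier (dual cont_space)"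
  obtains \<mu> where "represents \<mu> l" "\<And>E. E \<in> sets borel \<Longrightarrow> indicator_bidual E l = \<mu> E"
    "\<And>E. E \<in> sets borel \<Longrightarrow> norm (\<mu> E) \<le> nrm (dual cont_space) l"
proof -
  obtain \<mu> where \<mu>: "regular_borel_measure \<mu>" "\<And>\<phi>. has_measure_integral \<mu> (apply_bcontfun \<phi>) (l \<phi>)"
    "\<And>E. E \<in> sets borel \<Longrightarrow> norm (\<mu> E) \<le> nrm (dual cont_space) l"
    by (rule riesz_representation[OF cont_functional_dual[OF compact l]]) (rule that)
  have rep: "represents \<mu> l" using \<mu> by (simp add: represents_def)
  have "indicator_bidual E l = \<mu> E" if E: "E \<in> sets borel" for E
  proof -
    have "indicator_bidual E l = (THE a. \<exists>\<mu>. represents \<mu> l \<and> a = \<mu> E)"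
      using l by (simp add: indicator_bidual_def represents_def conj_assoc)
    also have "\<dots> = \<mu> E"
    proof (rule the_equality)
      show "\<exists>\<mu>'. represents \<mu>' l \<and> \<mu> E = \<mu>' E" using rep by blast
      fix a assume "\<exists>\<mu>'. represents \<mu>' l \<and> a = \<mu>' E"
      then obtain \<mu>' where "represents \<mu>' l" "a = \<mu>' E" by blast
      then show "a = \<mu> E" using represents_unique[OF compact _ rep E] by simp
    qed
    finally show ?thesis .
  qed
  with rep \<mu>(3) show thesis using that by blast
qed

text \<open>Linearity is checked at a continuous \<open>\<phi>\<close> that is close to the
  indicator for all the measures involved. Membership matters because \<open>biadjoint_op\<close> is
  extensional and yields the intended value only on the carrier of the bidual.\<close>

lemma indicator_bidual_carrier:
  fixes E :: "'w::t2_space set"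
  assumes compact: "compact (UNIV :: 'w set)" and E: "E \<in> sets borel"
  shows "(indicator_bidual E :: (('w \<Rightarrow>\<^sub>C 'k::real_or_complex) \<Rightarrow> 'k) \<Rightarrow> 'k) \<in> carrier (dual (dual cont_space))"
    (is "?I \<in> _")
proof (rule carrier_dualI[where C = 1])
  have wf: "wf_space (dual (cont_space :: ('k, 'w \<Rightarrow>\<^sub>C 'k) normed_space_over))"
    unfolding cont_space_def by (intro wf_space_dual wf_space_of)
  have carrier: "carrier cont_space = (UNIV :: ('w \<Rightarrow>\<^sub>C 'k) set)" by (simp add: cont_space_def space_of_def)
  show "?I \<in> extensional (carrier (dual cont_space))" by (simp add: indicator_bidual_def)
  show "norm (?I l) \<le> 1 * nrm (dual cont_space) l" if "l \<in> carrier (dual cont_space)" for l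
    by (rule represents_indicator_bidual[OF compact that]) (simp add: E)
  show "?I (add (dual cont_space) l1 l2) = ?I l1 + ?I l2"
    if l1: "l1 \<in> carrier (dual cont_space)" and l2: "l2 \<in> carrier (dual cont_space)" for l1 l2
  proof -
    let ?l = "add (dual cont_space) l1 l2"
    have l: "?l \<in> carrier (dual cont_space)" using wf l1 l2 by (simp add: wf_space_def)
    obtain \<mu>1 where 1: "represents \<mu>1 l1" "?I l1 = \<mu>1 E"
      by (rule represents_indicator_bidual[OF compact l1]) (simp add: E)
    obtain \<mu>2 where 2: "represents \<mu>2 l2" "?I l2 = \<mu>2 E"
      by (rule represents_indicator_bidual[OF compact l2]) (simp add: E)
    obtain \<mu> where 3: "represents \<mu> ?l" "?I ?l = \<mu> E"
      by (rule represents_indicator_bidual[OF compact l]) (simp add: E)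
    have "norm (\<mu> E - (\<mu>1 E + \<mu>2 E)) \<le> 0"
    proof (rule field_le_epsilon)
      fix e :: real assume e: "0 < e"
      obtain \<phi> where \<phi>: "\<And>\<mu>' l'. (\<mu>', l') \<in> {(\<mu>1, l1), (\<mu>2, l2), (\<mu>, ?l)} \<Longrightarrow> norm (l' \<phi> - \<mu>' E) \<le> e / 3"
        by (rule represents_near_finite[OF compact _ _ E, of "{(\<mu>1, l1), (\<mu>2, l2), (\<mu>, ?l)}" "e / 3"])
          (use e 1 2 3 in auto)
      have "\<mu> E - (\<mu>1 E + \<mu>2 E) = (l1 \<phi> - \<mu>1 E) + (l2 \<phi> - \<mu>2 E) - (?l \<phi> - \<mu> E)"
        by (simp add: dual_add carrier)
      also have "norm \<dots> \<le> norm (l1 \<phi> - \<mu>1 E) + norm (l2 \<phi> - \<mu>2 E) + norm (?l \<phi> - \<mu> E)"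
        by (intro order_trans[OF norm_triangle_ineq4] add_right_mono norm_triangle_ineq)
      also have "\<dots> \<le> e / 3 + e / 3 + e / 3"
        by (intro add_mono \<phi>) auto
      finally show "norm (\<mu> E - (\<mu>1 E + \<mu>2 E)) \<le> 0 + e" by simp
    qed
    then show ?thesis by (simp add: 1 2 3)
  qed
  show "?I (smult (dual cont_space) a l) = a * ?I l" if l: "l \<in> carrier (dual cont_space)" for a l
  proof -
    let ?l = "smult (dual cont_space) a l"
    have al: "?l \<in> carrier (dual cont_space)" using wf l by (simp add: wf_space_def)
    obtain \<mu>1 where 1: "represents \<mu>1 l" "?I l = \<mu>1 E"
      by (rule represents_indicator_bidual[OF compact l]) (simp add: E)
    obtain \<mu> where 2: "represents \<mu> ?l" "?I ?l = \<mu> E"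
      by (rule represents_indicator_bidual[OF compact al]) (simp add: E)
    have "norm (\<mu> E - a * \<mu>1 E) \<le> 0"
    proof (rule field_le_epsilon)
      fix e :: real assume e: "0 < e"
      define d where "d = e / (norm a + 1)"
      have d: "0 < d" "norm a * d + d = e"
      proof -
        have a: "0 < norm a + 1" by (simp add: add_nonneg_pos)
        then show "0 < d" using e by (simp add: d_def)
        have "norm a * d + d = (norm a + 1) * d" by (simp add: distrib_right)
        then show "norm a * d + d = e" using a by (simp add: d_def)
      qed
      obtain \<phi> where \<phi>: "\<And>\<mu>' l'. (\<mu>', l') \<in> {(\<mu>1, l), (\<mu>, ?l)} \<Longrightarrow> norm (l' \<phi> - \<mu>' E) \<le> d"
        by (rule represents_near_finite[OF compact _ _ E, of "{(\<mu>1, l), (\<mu>, ?l)}" d])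
          (use d 1 2 in auto)
      have "\<mu> E - a * \<mu>1 E = a * (l \<phi> - \<mu>1 E) - (?l \<phi> - \<mu> E)"
        by (simp add: dual_smult carrier algebra_simps)
      also have "norm \<dots> \<le> norm a * norm (l \<phi> - \<mu>1 E) + norm (?l \<phi> - \<mu> E)"
        by (simp only: norm_mult[symmetric] norm_triangle_ineq4)
      also have "\<dots> \<le> norm a * d + d"
        by (intro add_mono mult_left_mono \<phi>) auto
      finally show "norm (\<mu> E - a * \<mu>1 E) \<le> 0 + e" using d by simp
    qed
    then show ?thesis by (simp add: 1 2)
  qed
qed

section \<open>Extending a bounded linear relation by density\<close>

lemma le_of_le_add_mult:
  fixes a b K :: real
  assumes "\<And>e. 0 < e \<Longrightarrow> a \<le> b + e * K"
  shows "a \<le> b"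
proof (rule field_le_epsilon)
  fix e :: real assume e: "0 < e"
  have "a \<le> b + e / (\<bar>K\<bar> + 1) * K" using e by (intro assms) (simp add: add_nonneg_pos)
  also have "e / (\<bar>K\<bar> + 1) * K \<le> e / (\<bar>K\<bar> + 1) * (\<bar>K\<bar> + 1)"
    using e by (intro mult_left_mono) (auto intro: divide_nonneg_nonneg)
  also have "\<dots> = e" by (simp add: add_nonneg_eq_0_iff)
  finally show "a \<le> b + e" by simp
qed

text \<open>The operator is built from its graph, so that independence of the chosen representation
  of an element need not be argued separately: the bound passes to the closure of \<open>R\<close>
  and makes it single valued, and completeness makes it total.\<close>

lemma dense_relation_extension:
  fixes R :: "('a::real_normed_vector \<times> 'b::banach) set"
  assumes R: "subspace R" and bound: "\<And>g y. (g, y) \<in> R \<Longrightarrow> norm y \<le> c * norm g"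
    and dense: "\<And>f e. 0 < e \<Longrightarrow> \<exists>g y. (g, y) \<in> R \<and> norm (f - g) < e"
  obtains U where "\<And>f. (f, blinfun_apply U f) \<in> closure R" "\<And>f y. (f, y) \<in> closure R \<Longrightarrow> y = blinfun_apply U f"
proof -
  have closure_seq: "\<exists>p. (\<forall>n. p n \<in> R) \<and> p \<longlonglongrightarrow> z" if "z \<in> closure R" for z
    using that unfolding closure_sequential by blast
  have closure_add: "z + z' \<in> closure R" if z: "z \<in> closure R" "z' \<in> closure R" for z z'
  proof -
    obtain p p' where "\<And>n. p n \<in> R" "p \<longlonglongrightarrow> z" "\<And>n. p' n \<in> R" "p' \<longlonglongrightarrow> z'"
      using closure_seq[OF z(1)] closure_seq[OF z(2)] by metis
    then show ?thesis
      unfolding closure_sequential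
      by (intro exI[of _ "\<lambda>n. p n + p' n"]) (auto intro: subspace_add[OF R] tendsto_add)
  qed
  have closure_scale: "r *\<^sub>R z \<in> closure R" if z: "z \<in> closure R" for r z
  proof -
    obtain p where "\<And>n. p n \<in> R" "p \<longlonglongrightarrow> z"
      using closure_seq[OF z] by metis
    then show ?thesis
      unfolding closure_sequential
      by (intro exI[of _ "\<lambda>n. r *\<^sub>R p n"]) (auto intro: subspace_scale[OF R] tendsto_scaleR)
  qed
  have closure_bound: "norm y \<le> c * norm f" if "(f, y) \<in> closure R" for f y
  proof -
    have "closed {p :: 'a \<times> 'b. norm (snd p) \<le> c * norm (fst p)}"
      by (intro closed_Collect_le continuous_intros)
    then have "closure R \<subseteq> {p. norm (snd p) \<le> c * norm (fst p)}"
      by (intro closure_minimal) (auto intro: bound)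
    then show ?thesis using that by auto
  qed
  have unique: "y = y'" if "(f, y) \<in> closure R" "(f, y') \<in> closure R" for f y y'
    \<comment> \<open>The difference of the two pairs is \<open>(0, y - y')\<close>, and its second
      entry is bounded by \<open>c * norm 0\<close>.\<close>
    using closure_bound[of 0 "y - y'"] closure_add[OF that(1) closure_scale[OF that(2), of "- 1"]] by simp
  have ex: "\<exists>y. (f, y) \<in> closure R" for f
  proof -
    have "\<exists>g y. (g, y) \<in> R \<and> norm (f - g) < 1 / real (Suc n)" for n
      by (rule dense) simp
    then obtain g y where gy: "\<And>n. (g n, y n) \<in> R" and g: "\<And>n. norm (f - g n) < 1 / real (Suc n)"
      by metis
    have lim: "(\<lambda>n. 1 / real (Suc n)) \<longlonglongrightarrow> 0" by (rule LIMSEQ_Suc[OF lim_inverse_n'])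
    have g_lim: "g \<longlonglongrightarrow> f"
      by (rule tendsto_dist_boundI[OF _ lim]) (use g in \<open>simp add: dist_norm norm_minus_commute less_imp_le\<close>)
    then have "Cauchy g" by (rule LIMSEQ_imp_Cauchy)
    have "Cauchy y"
    proof (rule CauchyI)
      fix e :: real assume e: "0 < e"
      then obtain N where N: "\<And>m n. m \<ge> N \<Longrightarrow> n \<ge> N \<Longrightarrow> norm (g m - g n) < e / (\<bar>c\<bar> + 1)"
        using CauchyD[OF \<open>Cauchy g\<close>, of "e / (\<bar>c\<bar> + 1)"] by (auto simp: add_nonneg_pos)
      have "norm (y m - y n) < e" if "m \<ge> N" "n \<ge> N" for m n
      proof -
        have "norm (y m - y n) \<le> c * norm (g m - g n)"
          using bound subspace_diff[OF R gy gy, of m n] by simp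
        also have "\<dots> \<le> (\<bar>c\<bar> + 1) * norm (g m - g n)" by (intro mult_right_mono) auto
        also have "\<dots> < e" using N[OF that] by (simp add: field_simps add_nonneg_pos)
        finally show ?thesis .
      qed
      then show "\<exists>M. \<forall>m\<ge>M. \<forall>n\<ge>M. norm (y m - y n) < e" by blast
    qed
    then obtain z where "y \<longlonglongrightarrow> z" using Cauchy_convergent convergent_def by blast
    then have "(f, z) \<in> closure R"
      unfolding closure_sequential using gy g_lim
      by (intro exI[of _ "\<lambda>n. (g n, y n)"]) (auto intro: tendsto_Pair)
    then show ?thesis ..
  qed
  then obtain u where u: "\<And>f. (f, u f) \<in> closure R" by metis
  have "bounded_linear u"
  proof (rule bounded_linear_intro[of _ c])
    show "u (f + g) = u f + u g" for f g
      using unique[OF u[of "f + g"]] closure_add[OF u[of f] u[of g]] by simp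
    show "u (r *\<^sub>R f) = r *\<^sub>R u f" for r f
      using unique[OF u[of "r *\<^sub>R f"]] closure_scale[OF u[of f], of r] by simp
    show "norm (u f) \<le> norm f * c" for f
      using closure_bound[OF u[of f]] by (simp add: mult.commute)
  qed
  then have "blinfun_apply (Blinfun u) = u" by (rule bounded_linear_Blinfun_apply)
  then show thesis using that[of "Blinfun u"] u unique by metis
qed

lemma apply_bcontfun_sum:
  fixes f :: "'i \<Rightarrow> 'w::topological_space \<Rightarrow>\<^sub>C 'b::real_normed_vector"
  shows "apply_bcontfun (\<Sum>i\<in>A. f i) w = (\<Sum>i\<in>A. apply_bcontfun (f i) w)"
  by (induction A rule: infinite_finite_induct) auto

text \<open>The \<open>\<phi> c\<close> are a partition of unity obtained by normalising finitely many Urysohn functions.\<close>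

lemma (in banach_space_over) cont_tensor_dense:
  fixes f :: "'w::t2_space \<Rightarrow>\<^sub>C 'a"
  assumes compact: "compact (UNIV :: 'w set)" and e: "0 < e"
  obtains C :: "'w set" and \<phi> :: "'w \<Rightarrow> 'w \<Rightarrow>\<^sub>C 'k" where "finite C"
    "norm (f - (\<Sum>c\<in>C. cont_tensor scale (\<phi> c) (apply_bcontfun f c))) \<le> e"
proof -
  define V where "V = (\<lambda>w. apply_bcontfun f -` ball (apply_bcontfun f w) e)"
  have V: "open (V w)" for w
    unfolding V_def by (intro open_vimage) auto
  have "\<exists>h :: 'w \<Rightarrow> real. continuous_on UNIV h \<and> (\<forall>v. 0 \<le> h v) \<and> (\<forall>v. v \<notin> V w \<longrightarrow> h v = 0) \<and> h w = 1" for w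
  proof -
    have disj: "- V w \<inter> {w} = {}" using e by (simp add: V_def)
    obtain h :: "'w \<Rightarrow> real" where "continuous_on UNIV h" "\<And>v. 0 \<le> h v" "\<And>v. h v \<le> 1"
      "\<And>v. v \<in> - V w \<Longrightarrow> h v = 0" "\<And>v. v \<in> {w} \<Longrightarrow> h v = 1"
      by (rule Urysohn_compact_t2[OF compact closed_Compl[OF V[of w]] closed_singleton disj]) (rule that)
    then show ?thesis by (intro exI[of _ h]) auto
  qed
  then obtain h :: "'w \<Rightarrow> 'w \<Rightarrow> real" where h: "\<And>w. continuous_on UNIV (h w)" "\<And>w v. 0 \<le> h w v"
    "\<And>w v. v \<notin> V w \<Longrightarrow> h w v = 0" "\<And>w. h w w = 1" by metis
  have pos_open: "open {v. 0 < h w v}" for w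
    using h(1) by (intro open_Collect_less) auto
  \<comment> \<open>The tagging serves to extract a finite subcover: its finitely many tags index
    the partition of unity, and the tag of \<open>v\<close> witnesses positivity of the sum
    \<open>H\<close> at \<open>v\<close>.\<close>
  obtain \<tau> where \<tau>: "simple_function borel \<tau>" "\<And>w. w \<in> {v. 0 < h (\<tau> w) v}"
  proof (rule simple_function_tag[OF compact pos_open])
    show "w \<in> {v. 0 < h w v}" for w using h(4) by simp
  qed (rule that)
  define C where "C = range \<tau>"
  have C: "finite C" unfolding C_def by (rule finite_range_simple[OF \<tau>(1)])
  define H where "H = (\<lambda>v. \<Sum>c\<in>C. h c v)"
  have H: "0 < H v" for v
    unfolding H_def using C h(2) \<tau>(2)[of v] by (intro sum_pos2[of _ "\<tau> v"]) (auto simp: C_def)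
  have H_cont: "continuous_on UNIV H" unfolding H_def by (intro continuous_intros h)
  define \<phi> where "\<phi> = (\<lambda>c. Bcontfun (\<lambda>v. of_real (h c v / H v)) :: 'w \<Rightarrow>\<^sub>C 'k)"
  have \<phi>: "apply_bcontfun (\<phi> c) v = of_real (h c v / H v)" for c v
  proof -
    have "continuous_on UNIV (\<lambda>v. of_real (h c v / H v) :: 'k)"
      using H by (intro continuous_intros h H_cont) (auto simp: less_imp_neq[symmetric])
    then show ?thesis unfolding \<phi>_def by (subst apply_Bcontfun_compact[OF compact]) auto
  qed
  have one: "(\<Sum>c\<in>C. h c v / H v) = 1" for v
  proof -
    have "(\<Sum>c\<in>C. h c v / H v) = H v / H v" unfolding H_def by (rule sum_divide_distrib[symmetric])
    then show ?thesis using H[of v] by simp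
  qed
  show thesis
  proof (rule that[OF C])
    show "norm (f - (\<Sum>c\<in>C. cont_tensor scale (\<phi> c) (apply_bcontfun f c))) \<le> e"
    proof (rule norm_bound)
      fix v
      have "apply_bcontfun f v = (\<Sum>c\<in>C. (h c v / H v) *\<^sub>R apply_bcontfun f v)"
        by (simp add: one flip: scaleR_left.sum)
      then have "apply_bcontfun (f - (\<Sum>c\<in>C. cont_tensor scale (\<phi> c) (apply_bcontfun f c))) v
          = (\<Sum>c\<in>C. (h c v / H v) *\<^sub>R (apply_bcontfun f v - apply_bcontfun f c))"
        by (simp add: apply_bcontfun_sum cont_tensor_apply \<phi> scale_of_real scaleR_diff_right sum_subtractf del: of_real_divide)
      also have "norm \<dots> \<le> (\<Sum>c\<in>C. (h c v / H v) * e)"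
      proof (rule sum_norm_le)
        fix c assume "c \<in> C"
        show "norm ((h c v / H v) *\<^sub>R (apply_bcontfun f v - apply_bcontfun f c)) \<le> (h c v / H v) * e"
        proof (cases "v \<in> V c")
          case True
          then have "norm (apply_bcontfun f v - apply_bcontfun f c) \<le> e"
            by (simp add: V_def dist_norm norm_minus_commute)
          then have "\<bar>h c v / H v\<bar> * norm (apply_bcontfun f v - apply_bcontfun f c) \<le> \<bar>h c v / H v\<bar> * e"
            by (intro mult_left_mono) auto
          then show ?thesis using h(2)[of c v] H[of v] by simp
        next
          case False
          then show ?thesis using h(3) by simp
        qed
      qed
      also have "\<dots> = e" by (simp only: one mult_1 flip: sum_distrib_right)
      finally show "norm (apply_bcontfun (f - (\<Sum>c\<in>C. cont_tensor scale (\<phi> c) (apply_bcontfun f c))) v) \<le> e" .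
    qed
  qed
qed

section \<open>The representing measure of an operator\<close>

text \<open>The canonical embedding into the bidual. Used with the dual of Y as \<open>V\<close>, it
  turns points of the dual ball into test functionals for \<open>weak_l1_norm\<close>.\<close>

lemma evaluation_unit_ball:
  assumes V: "wf_space V" and v: "v \<in> unit_ball V"
  shows "(\<lambda>Q\<in>carrier (dual V). Q v) \<in> unit_ball (dual (dual V))"
  unfolding unit_ball_def[of "dual (dual V)"]
proof (safe intro!: carrier_dualI[where C = 1] dual_nrm_le[OF wf_space_dual[OF V]])
  have v': "v \<in> carrier V" using v by (simp add: unit_ball_def)
  have closed: "Q \<in> carrier (dual V) \<Longrightarrow> Q' \<in> carrier (dual V) \<Longrightarrow> add (dual V) Q Q' \<in> carrier (dual V)"
    "Q \<in> carrier (dual V) \<Longrightarrow> smult (dual V) a Q \<in> carrier (dual V)" for Q Q' a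
    using wf_space_dual[OF V] by (auto simp: wf_space_def)
  fix Q assume Q: "Q \<in> carrier (dual V)"
  show "(\<lambda>Q\<in>carrier (dual V). Q v) (add (dual V) Q Q') = (\<lambda>Q\<in>carrier (dual V). Q v) Q + (\<lambda>Q\<in>carrier (dual V). Q v) Q'"
    if "Q' \<in> carrier (dual V)" for Q'
    using closed(1)[OF Q that] Q that v' by (simp add: dual_add)
  show "(\<lambda>Q\<in>carrier (dual V). Q v) (smult (dual V) a Q) = a * (\<lambda>Q\<in>carrier (dual V). Q v) Q" for a
    using closed(2)[OF Q] Q v' by (simp add: dual_smult)
  show "norm ((\<lambda>Q\<in>carrier (dual V). Q v) Q) \<le> 1 * nrm (dual V) Q"
    using dual_apply_le[OF V Q v] Q by simp
next
  fix Q assume "Q \<in> unit_ball (dual V)"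
  then have "Q \<in> carrier (dual V)" "nrm (dual V) Q \<le> 1" by (auto simp: unit_ball_def)
  then show "norm ((\<lambda>Q\<in>carrier (dual V). Q v) Q) \<le> 1"
    using dual_apply_le[OF V _ v, of Q] by simp
qed simp

locale cont_operator = X: banach_space_over scaleX + Y: banach_space_over scaleY
  for scaleX :: "'k::real_or_complex \<Rightarrow> 'x::banach \<Rightarrow> 'x"
    and scaleY :: "'k \<Rightarrow> 'y::banach \<Rightarrow> 'y" +
  fixes S :: "('w::t2_space \<Rightarrow>\<^sub>C 'k) \<Rightarrow>\<^sub>L ('x \<Rightarrow>\<^sub>L 'y)"
  assumes compact: "compact (UNIV :: 'w set)"
    and S: "S \<in> bounded_ops (cont_scale (*)) (blinfun_scale scaleY)"
    and S_range: "range (blinfun_apply S) \<subseteq> bounded_ops scaleX scaleY"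
begin

abbreviation "T \<phi> x \<equiv> blinfun_apply (blinfun_apply S \<phi>) x"
abbreviation "Y' \<equiv> dual (space_of scaleY)"
abbreviation "m \<equiv> operator_representing_measure scaleY S"

lemma T_add: "T (\<phi> + \<psi>) x = T \<phi> x + T \<psi> x" "T \<phi> (x + x') = T \<phi> x + T \<phi> x'"
  by (simp_all add: blinfun.add_right blinfun.add_left)

lemma T_scale: "T (cont_scale (*) a \<phi>) x = scaleY a (T \<phi> x)" "T \<phi> (scaleX a x) = scaleY a (T \<phi> x)"
proof -
  have "blinfun_apply S (cont_scale (*) a \<phi>) = blinfun_scale scaleY a (blinfun_apply S \<phi>)"
    using S unfolding bounded_ops_def Vector_Spaces.linear_iff by blast
  then show "T (cont_scale (*) a \<phi>) x = scaleY a (T \<phi> x)"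
    by (simp add: Y.blinfun_scale_apply)
  have "blinfun_apply S \<phi> \<in> bounded_ops scaleX scaleY" using S_range by blast
  then show "T \<phi> (scaleX a x) = scaleY a (T \<phi> x)"
    unfolding bounded_ops_def Vector_Spaces.linear_iff by blast
qed

lemma T_le: "norm (T \<phi> x) \<le> norm S * norm x * norm \<phi>"
proof -
  have "norm (T \<phi> x) \<le> norm (blinfun_apply S \<phi>) * norm x" by (rule norm_blinfun)
  also have "\<dots> \<le> (norm S * norm \<phi>) * norm x" by (intro mult_right_mono norm_blinfun) simp
  finally show ?thesis by (simp add: mult_ac)
qed

lemma wf_dual: "wf_space Y'" "wf_space (dual Y')"
  by (intro wf_space_dual wf_space_of)+

lemma Y'_add: "g \<in> carrier Y' \<Longrightarrow> g (u + v) = g u + g v"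
  using carrier_dualD(1)[of g "space_of scaleY" u v] by (simp add: space_of_def)

lemma Y'_scale: "g \<in> carrier Y' \<Longrightarrow> g (scaleY a v) = a * g v"
  using carrier_dualD(2)[of g "space_of scaleY" v a] by (simp add: space_of_def)

lemma Y'_sum: "g \<in> carrier Y' \<Longrightarrow> g (\<Sum>i\<in>I. v i) = (\<Sum>i\<in>I. g (v i))"
proof -
  assume g: "g \<in> carrier Y'"
  have "g 0 = 0" using Y'_add[OF g, of 0 0] by simp
  then show ?thesis using sum_comp_morphism[of g v I] Y'_add[OF g] by (simp add: comp_def)
qed

lemma Y'_le: "g \<in> carrier Y' \<Longrightarrow> norm (g v) \<le> nrm Y' g * norm v"
  by (rule dual_apply_le_norm[OF Y.norm_scale])

lemma unit_ball_Y'_le: "g \<in> unit_ball Y' \<Longrightarrow> norm (g v) \<le> norm v"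
  using order_trans[OF Y'_le[of g v] mult_right_mono[of "nrm Y' g" 1 "norm v"]]
  by (simp add: unit_ball_def)

lemma pull_bound:
  assumes g: "g \<in> carrier Y'"
  shows "norm (g (T \<phi> x)) \<le> (norm S * norm x * nrm Y' g) * norm \<phi>"
proof -
  have "0 \<le> nrm Y' g" using wf_dual(1) g by (simp add: wf_space_def)
  then have "norm (g (T \<phi> x)) \<le> nrm Y' g * (norm S * norm x * norm \<phi>)"
    by (intro order_trans[OF Y'_le[OF g]] mult_left_mono T_le)
  then show ?thesis by (simp add: mult_ac)
qed

lemma carrier_cont_space: "carrier cont_space = UNIV"
  by (simp add: cont_space_def space_of_def)

lemma pull_carrier:
  assumes g: "g \<in> carrier Y'"
  shows "(\<lambda>\<phi>. g (T \<phi> x)) \<in> carrier (dual cont_space)"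
  by (rule carrier_dualI[where C = "norm S * norm x * nrm Y' g"])
    (use pull_bound[OF g] in \<open>auto simp: cont_space_def space_of_def T_add T_scale Y'_add[OF g] Y'_scale[OF g]\<close>)

lemma pull_nrm:
  assumes g: "g \<in> carrier Y'"
  shows "nrm (dual cont_space) (\<lambda>\<phi>. g (T \<phi> x)) \<le> norm S * norm x * nrm Y' g"
proof (rule dual_nrm_le)
  show "wf_space (cont_space :: ('k, 'w \<Rightarrow>\<^sub>C 'k) normed_space_over)"
    unfolding cont_space_def by (rule wf_space_of)
  fix \<phi> :: "'w \<Rightarrow>\<^sub>C 'k" assume "\<phi> \<in> unit_ball cont_space"
  then have "norm \<phi> \<le> 1" by (simp add: unit_ball_def cont_space_def space_of_def)
  moreover have "0 \<le> nrm Y' g" using wf_dual(1) g by (simp add: wf_space_def)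
  ultimately show "norm (g (T \<phi> x)) \<le> norm S * norm x * nrm Y' g"
    using order_trans[OF pull_bound[OF g] mult_left_le] by simp
qed

text \<open>The biadjoint at the indicator, tested with \<open>g\<close>, is the indicator tested
  with the pulled back functional; the membership of \<open>indicator_bidual E\<close> in the bidual
  removes the outer restriction.\<close>

lemma m_apply:
  assumes E: "E \<in> sets borel"
  shows "m E x = (\<lambda>g\<in>carrier Y'. indicator_bidual E (\<lambda>\<phi>. g (T \<phi> x)))"
  using indicator_bidual_carrier[OF compact E, where 'k = 'k]
  by (simp add: operator_representing_measure_def representing_measure_def biadjoint_op_def adjoint_op_def
      carrier_cont_space restrict_UNIV cong: restrict_cong)

lemma m_represents:
  assumes g: "g \<in> carrier Y'"
  obtains \<mu> where "represents \<mu> (\<lambda>\<phi>. g (T \<phi> x))" "\<And>E. E \<in> sets borel \<Longrightarrow> m E x g = \<mu> E"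
proof -
  obtain \<mu> where "represents \<mu> (\<lambda>\<phi>. g (T \<phi> x))"
    "\<And>E. E \<in> sets borel \<Longrightarrow> indicator_bidual E (\<lambda>\<phi>. g (T \<phi> x)) = \<mu> E"
    by (rule represents_indicator_bidual[OF compact pull_carrier[OF g, of x]]) (rule that)
  then show thesis using that g by (simp add: m_apply)
qed

text \<open>Linearity and the bound are inherited from \<open>indicator_bidual E\<close> through the
  pullback of \<open>g\<close> along \<open>S\<close> and \<open>x\<close>, which is linear in
  \<open>g\<close>. Functionals on the bidual can then be applied to \<open>m E x\<close>.\<close>

lemma m_carrier:
  assumes E: "E \<in> sets borel"
  shows "m E x \<in> carrier (dual Y')"
proof (rule carrier_dualI[where C = "norm S * norm x"])
  note ind = indicator_bidual_carrier[OF compact E, where 'k = 'k]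
  have closed: "g \<in> carrier Y' \<Longrightarrow> g' \<in> carrier Y' \<Longrightarrow> add Y' g g' \<in> carrier Y'"
    "g \<in> carrier Y' \<Longrightarrow> smult Y' a g \<in> carrier Y'" for g g' a
    using wf_dual(1) by (auto simp: wf_space_def)
  have carrier_Y: "carrier (space_of scaleY) = UNIV" by (simp add: space_of_def)
  show "m E x \<in> extensional (carrier Y')" by (simp add: m_apply[OF E])
  fix g assume g: "g \<in> carrier Y'"
  show "m E x (add Y' g g') = m E x g + m E x g'" if g': "g' \<in> carrier Y'" for g'
  proof -
    have "m E x (add Y' g g') = indicator_bidual E (\<lambda>\<phi>. add Y' g g' (T \<phi> x))"
      using closed(1)[OF g g'] by (simp only: m_apply[OF E] restrict_apply' if_True)
    also have "(\<lambda>\<phi>. add Y' g g' (T \<phi> x)) = add (dual cont_space) (\<lambda>\<phi>. g (T \<phi> x)) (\<lambda>\<phi>. g' (T \<phi> x))"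
      by (simp add: dual_add carrier_Y carrier_cont_space restrict_UNIV)
    finally have "m E x (add Y' g g') = indicator_bidual E \<dots>" .
    then show ?thesis
      by (simp add: carrier_dualD(1)[OF ind pull_carrier[OF g] pull_carrier[OF g']] m_apply[OF E] g g')
  qed
  show "m E x (smult Y' a g) = a * m E x g" for a
  proof -
    have "m E x (smult Y' a g) = indicator_bidual E (\<lambda>\<phi>. smult Y' a g (T \<phi> x))"
      using closed(2)[OF g] by (simp only: m_apply[OF E] restrict_apply' if_True)
    also have "(\<lambda>\<phi>. smult Y' a g (T \<phi> x)) = smult (dual cont_space) a (\<lambda>\<phi>. g (T \<phi> x))"
      by (simp add: dual_smult carrier_Y carrier_cont_space restrict_UNIV)
    finally have "m E x (smult Y' a g) = indicator_bidual E \<dots>" .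
    then show ?thesis
      by (simp add: carrier_dualD(2)[OF ind pull_carrier[OF g]] m_apply[OF E] g)
  qed
  show "norm (m E x g) \<le> norm S * norm x * nrm Y' g"
  proof (rule represents_indicator_bidual[OF compact pull_carrier[OF g, of x]])
    fix \<mu> assume "\<And>E. E \<in> sets borel \<Longrightarrow> indicator_bidual E (\<lambda>\<phi>. g (T \<phi> x)) = \<mu> E"
      "\<And>E. E \<in> sets borel \<Longrightarrow> norm (\<mu> E) \<le> nrm (dual cont_space) (\<lambda>\<phi>. g (T \<phi> x))"
    then show ?thesis using order_trans[OF _ pull_nrm[OF g]] E g by (simp add: m_apply)
  qed
qed

lemma m_linear:
  assumes E: "E \<in> sets borel" and g: "g \<in> carrier Y'"
  shows "m E (x + x') g = m E x g + m E x' g" "m E (scaleX a x) g = a * m E x g"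
proof -
  note ind = indicator_bidual_carrier[OF compact E, where 'k = 'k]
  have "(\<lambda>\<phi>. g (T \<phi> (x + x'))) = add (dual cont_space) (\<lambda>\<phi>. g (T \<phi> x)) (\<lambda>\<phi>. g (T \<phi> x'))"
    by (simp add: dual_add carrier_cont_space restrict_UNIV T_add Y'_add[OF g])
  then show "m E (x + x') g = m E x g + m E x' g"
    by (simp add: m_apply[OF E] g carrier_dualD(1)[OF ind pull_carrier[OF g] pull_carrier[OF g]])
  have "(\<lambda>\<phi>. g (T \<phi> (scaleX a x))) = smult (dual cont_space) a (\<lambda>\<phi>. g (T \<phi> x))"
    by (simp add: dual_smult carrier_cont_space restrict_UNIV T_scale Y'_scale[OF g])
  then show "m E (scaleX a x) g = a * m E x g"
    by (simp add: m_apply[OF E] g carrier_dualD(2)[OF ind pull_carrier[OF g]])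
qed

lemma m_sum:
  assumes E: "E \<in> sets borel" and g: "g \<in> carrier Y'"
  shows "m E (\<Sum>i\<in>I. x i) g = (\<Sum>i\<in>I. m E (x i) g)"
proof -
  have "m E 0 g = 0" using m_linear(1)[OF E g, of 0 0] by simp
  then show ?thesis
    using sum_comp_morphism[of "\<lambda>x. m E x g" x I] m_linear(1)[OF E g] by (simp add: comp_def)
qed

section \<open>From an operator on \<open>\<C>(\<Omega>,X)\<close> to bounded semivariation\<close>

text \<open>The sets \<open>E i\<close> are approximated from inside by compact sets \<open>F i\<close>. Dividing Urysohn functions
  of the \<open>F i\<close> by \<open>max 1\<close> of their sum makes the sum at most \<open>1\<close> without changing the values
  on any \<open>F i\<close>.\<close>

lemma semivariation_le:
  fixes U :: "('w \<Rightarrow>\<^sub>C 'x) \<Rightarrow>\<^sub>L 'y" and E :: "nat \<Rightarrow> 'w set" and x :: "nat \<Rightarrow> 'x"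
  assumes U: "\<And>\<phi> x. T \<phi> x = blinfun_apply U (cont_tensor scaleX \<phi> x)"
      "\<And>a f. blinfun_apply U (cont_scale scaleX a f) = scaleY a (blinfun_apply U f)"
    and E: "\<And>i. E i \<in> sets borel" "disjoint_family E" and x: "\<And>i. norm (x i) \<le> 1"
    and a: "\<And>i. norm (a i) \<le> 1" and g: "g \<in> unit_ball Y'"
  shows "norm (\<Sum>i<n. a i * m (E i) (x i) g) \<le> norm U"
proof (rule le_of_le_add_mult)
  fix e :: real assume e: "0 < e"
  have g': "g \<in> carrier Y'" using g by (simp add: unit_ball_def)
  have "\<exists>\<mu>. represents \<mu> (\<lambda>\<phi>. g (T \<phi> (x i))) \<and> m (E i) (x i) g = \<mu> (E i)" for i
    by (rule m_represents[OF g', of "x i"]) (use E in blast)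
  then obtain \<mu> where \<mu>: "\<And>i. represents (\<mu> i) (\<lambda>\<phi>. g (T \<phi> (x i)))" "\<And>i. m (E i) (x i) g = \<mu> i (E i)"
    by metis
  have "\<exists>F G. compact F \<and> open G \<and> F \<subseteq> E i \<and> E i \<subseteq> G \<and>
      (\<forall>A\<in>sets borel. A \<subseteq> G - F \<longrightarrow> norm (\<mu> i A) < e)" for i
    using \<mu>(1)[of i] E(1)[of i] e unfolding represents_def regular_borel_measure_def by blast
  then obtain F G where FG: "\<And>i. compact (F i)" "\<And>i. open (G i)" "\<And>i. F i \<subseteq> E i" "\<And>i. E i \<subseteq> G i"
    "\<And>i A. A \<in> sets borel \<Longrightarrow> A \<subseteq> G i - F i \<Longrightarrow> norm (\<mu> i A) < e" by metis
  have F: "closed (F i)" for i using FG(1) by (rule compact_imp_closed)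
  have "\<exists>h :: 'w \<Rightarrow> real. continuous_on UNIV h \<and> (\<forall>w. 0 \<le> h w) \<and> (\<forall>w. w \<notin> G i \<longrightarrow> h w = 0) \<and>
      (\<forall>j\<in>{..<n} - {i}. \<forall>w\<in>F j. h w = 0) \<and> (\<forall>w\<in>F i. h w = 1)" for i
  proof -
    \<comment> \<open>Letting \<open>h i\<close> vanish on the other sets \<open>F j\<close> as well
      makes the sum of the functions equal to 1 on each \<open>F i\<close>, so that the normaliser
      \<open>N\<close> is 1 there.\<close>
    let ?A = "- G i \<union> (\<Union>j\<in>{..<n} - {i}. F j)"
    have A: "closed ?A" using FG(2) F by (intro closed_Un closed_UN) auto
    have "F j \<inter> F i = {}" if "j \<noteq> i" for j
      using that E(2) FG(3)[of i] FG(3)[of j] unfolding disjoint_family_on_def by blast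
    then have disj: "?A \<inter> F i = {}" using FG(3,4)[of i] by blast
    obtain h :: "'w \<Rightarrow> real" where "continuous_on UNIV h" "\<And>v. 0 \<le> h v" "\<And>v. h v \<le> 1"
      "\<And>v. v \<in> ?A \<Longrightarrow> h v = 0" "\<And>v. v \<in> F i \<Longrightarrow> h v = 1"
      by (rule Urysohn_compact_t2[OF compact A F disj]) (rule that)
    then show ?thesis by (intro exI[of _ h]) auto
  qed
  then obtain h :: "nat \<Rightarrow> 'w \<Rightarrow> real" where h: "\<And>i. continuous_on UNIV (h i)" "\<And>i w. 0 \<le> h i w"
    "\<And>i w. w \<notin> G i \<Longrightarrow> h i w = 0" "\<And>i j w. j < n \<Longrightarrow> j \<noteq> i \<Longrightarrow> w \<in> F j \<Longrightarrow> h i w = 0"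
    "\<And>i w. w \<in> F i \<Longrightarrow> h i w = 1"
    by (metis DiffI lessThan_iff singletonD)
  define N where "N = (\<lambda>w. max 1 (\<Sum>j<n. h j w))"
  have N: "1 \<le> N w" for w by (simp add: N_def)
  have N_cont: "continuous_on UNIV N" unfolding N_def by (intro continuous_intros h)
  have N_F: "N w = 1" if "i < n" "w \<in> F i" for i w
  proof -
    have "(\<Sum>j<n. h j w) = h i w + (\<Sum>j\<in>{..<n} - {i}. h j w)"
      using that by (intro sum.remove) auto
    also have "\<dots> = 1" using h(4)[OF that(1)] h(5) that by simp
    finally show ?thesis by (simp add: N_def)
  qed
  define k where "k = (\<lambda>i w. h i w / N w)"
  have k0: "0 \<le> k i w" for i w using h(2)[of i w] N[of w] by (simp add: k_def)
  have k_cont: "continuous_on UNIV (k i)" for i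
    unfolding k_def using N by (intro continuous_intros h N_cont) (metis not_one_le_zero)
  have k_sum: "(\<Sum>i<n. k i w) \<le> 1" for w
  proof -
    have "(\<Sum>i<n. k i w) = (\<Sum>i<n. h i w) / N w" by (simp add: k_def sum_divide_distrib)
    also have "\<dots> \<le> 1" using N[of w] by (simp add: N_def field_simps)
    finally show ?thesis .
  qed
  have k1: "k i w \<le> 1" if "i < n" for i w
    using member_le_sum[of i "{..<n}" "\<lambda>i. k i w"] that k0 k_sum[of w] by (meson finite_lessThan lessThan_iff order_trans)
  define \<phi> where "\<phi> = (\<lambda>i. Bcontfun (\<lambda>w. of_real (k i w)) :: 'w \<Rightarrow>\<^sub>C 'k)"
  have \<phi>: "apply_bcontfun (\<phi> i) w = of_real (k i w)" for i w
    unfolding \<phi>_def by (subst apply_Bcontfun_compact[OF compact]) (auto intro!: continuous_intros k_cont)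
  have near: "norm (g (T (\<phi> i) (x i)) - m (E i) (x i) g) \<le> 4 * e" if i: "i < n" for i
    unfolding \<mu>(2)
  proof (rule represents_near[OF compact \<mu>(1) E(1) FG(1-4)])
    show "k i w = 1" if "w \<in> F i" for w using h(5)[OF that] N_F[OF i that] by (simp add: k_def)
    show "k i w = 0" if "w \<notin> G i" for w using h(3)[OF that] by (simp add: k_def)
  qed (use FG(5) k0 k1[OF i] \<phi> in \<open>auto intro: less_imp_le\<close>)
  define \<psi> where "\<psi> = (\<Sum>i<n. cont_scale scaleX (a i) (cont_tensor scaleX (\<phi> i) (x i)))"
  have "norm \<psi> \<le> 1"
  proof (rule norm_bound)
    fix w
    have "norm (apply_bcontfun \<psi> w) \<le> (\<Sum>i<n. k i w)"
      unfolding \<psi>_def apply_bcontfun_sum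
    proof (rule sum_norm_le)
      fix i
      have "norm (a i) * (k i w * norm (x i)) \<le> 1 * (k i w * 1)"
        using k0 by (intro mult_mono a x) auto
      then show "norm (apply_bcontfun (cont_scale scaleX (a i) (cont_tensor scaleX (\<phi> i) (x i))) w) \<le> k i w"
        using k0[of i w] by (simp add: X.cont_scale_apply X.cont_tensor_apply X.norm_scale \<phi> norm_mult mult.assoc)
    qed
    then show "norm (apply_bcontfun \<psi> w) \<le> 1" using k_sum by (rule order_trans)
  qed
  have "(\<Sum>i<n. a i * g (T (\<phi> i) (x i))) = g (blinfun_apply U \<psi>)"
    by (simp add: \<psi>_def blinfun.sum_right U(2) Y'_sum[OF g'] Y'_scale[OF g'] U(1))
  also have "norm \<dots> \<le> norm (blinfun_apply U \<psi>)" by (rule unit_ball_Y'_le[OF g])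
  also have "\<dots> \<le> norm U * 1"
    using \<open>norm \<psi> \<le> 1\<close> by (intro order_trans[OF norm_blinfun] mult_left_mono) auto
  finally have 1: "norm (\<Sum>i<n. a i * g (T (\<phi> i) (x i))) \<le> norm U" by simp
  have "norm (\<Sum>i<n. a i * (g (T (\<phi> i) (x i)) - m (E i) (x i) g)) \<le> (\<Sum>i<n. 4 * e)"
  proof (rule sum_norm_le)
    fix i assume "i \<in> {..<n}"
    then have "norm (a i) * norm (g (T (\<phi> i) (x i)) - m (E i) (x i) g) \<le> 1 * (4 * e)"
      using near by (intro mult_mono a) auto
    then show "norm (a i * (g (T (\<phi> i) (x i)) - m (E i) (x i) g)) \<le> 4 * e"
      by (simp add: norm_mult)
  qed
  then have 2: "norm (\<Sum>i<n. a i * (g (T (\<phi> i) (x i)) - m (E i) (x i) g)) \<le> e * (4 * n)"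
    by (simp add: mult_ac)
  have "(\<Sum>i<n. a i * m (E i) (x i) g)
      = (\<Sum>i<n. a i * g (T (\<phi> i) (x i))) - (\<Sum>i<n. a i * (g (T (\<phi> i) (x i)) - m (E i) (x i) g))"
    by (simp add: algebra_simps sum_subtractf)
  then show "norm (\<Sum>i<n. a i * m (E i) (x i) g) \<le> norm U + e * (4 * n)"
    using order_trans[OF norm_triangle_ineq4 add_mono[OF 1 2]] by (simp only:)
qed

text \<open>The functional \<open>f\<close> lives on the bidual, while
  \<open>semivariation_le\<close> speaks of points \<open>g\<close> of the dual. The bridge is the
  rotated and normalised partial sum \<open>Q n\<close>: its norm is a supremum over such
  \<open>g\<close>, hence at most 1, and \<open>f\<close> may be applied to it.\<close>

lemma weak_l1_norm_le:
  fixes U :: "('w \<Rightarrow>\<^sub>C 'x) \<Rightarrow>\<^sub>L 'y" and E :: "nat \<Rightarrow> 'w set" and x :: "nat \<Rightarrow> 'x"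
  assumes U: "\<And>\<phi> x. T \<phi> x = blinfun_apply U (cont_tensor scaleX \<phi> x)"
      "\<And>a f. blinfun_apply U (cont_scale scaleX a f) = scaleY a (blinfun_apply U f)"
    and E: "\<And>i. E i \<in> sets borel" "disjoint_family E" and x: "\<And>i. norm (x i) \<le> 1"
  shows "weak_l1_norm (dual Y') (\<lambda>i. m (E i) (x i)) \<le> ennreal (norm U + 1)"
  unfolding weak_l1_norm_def
proof (rule SUP_least)
  fix f assume "f \<in> unit_ball (dual (dual Y'))"
  then have f: "f \<in> carrier (dual (dual Y'))" "nrm (dual (dual Y')) f \<le> 1" by (auto simp: unit_ball_def)
  \<comment> \<open>The summand 1 allows division by \<open>?c\<close> even if \<open>U\<close> is
    zero.\<close>
  let ?c = "norm U + 1"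
  have c: "0 < ?c" by (simp add: add_nonneg_pos)
  have M: "m (E i) (x i) \<in> carrier (dual Y')" for i by (rule m_carrier[OF E(1)])
  have "\<exists>u. norm u = 1 \<and> u * f (m (E i) (x i)) = of_real (norm (f (m (E i) (x i))))" for i
    by (rule unimodular_multiplier[of "f (m (E i) (x i))"]) blast
  then obtain u where u: "\<And>i. norm (u i) = 1"
    "\<And>i. u i * f (m (E i) (x i)) = of_real (norm (f (m (E i) (x i))))" by metis
  define Q where "Q = (\<lambda>n. \<lambda>g\<in>carrier Y'. \<Sum>i<n. (u i / of_real ?c) * m (E i) (x i) g)"
  have Q: "Q n \<in> carrier (dual Y') \<and> f (Q n) = (\<Sum>i<n. (u i / of_real ?c) * f (m (E i) (x i)))" for n
  proof (induction n)
    case 0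
    \<comment> \<open>Writing the zero functional as 0 times an element gives both its membership
      and the value 0 under \<open>f\<close>.\<close>
    have "Q 0 = smult (dual Y') 0 (m (E 0) (x 0))" by (simp add: Q_def dual_smult)
    then show ?case
      using M carrier_dualD(2)[OF f(1) M] wf_dual(2) by (simp add: wf_space_def)
  next
    case (Suc n)
    let ?b = "u n / of_real ?c"
    have s: "smult (dual Y') ?b (m (E n) (x n)) \<in> carrier (dual Y')"
      using M wf_dual(2) by (simp add: wf_space_def)
    have "Q (Suc n) = add (dual Y') (Q n) (smult (dual Y') ?b (m (E n) (x n)))"
      unfolding Q_def dual_add dual_smult by (rule restrict_ext) simp
    then show ?case
      using Suc s carrier_dualD(1)[OF f(1) _ s] carrier_dualD(2)[OF f(1) M, of ?b n] wf_dual(2)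
      by (simp add: wf_space_def)
  qed
  have "(\<Sum>i<n. norm (f (m (E i) (x i)))) \<le> ?c" for n
  proof -
    have "nrm (dual Y') (Q n) \<le> 1"
    proof (rule dual_nrm_le[OF wf_dual(1)])
      fix g assume g: "g \<in> unit_ball Y'"
      then have "Q n g = inverse (of_real ?c) * (\<Sum>i<n. u i * m (E i) (x i) g)"
        by (simp add: Q_def unit_ball_def sum_distrib_left divide_inverse mult_ac)
      also have "norm \<dots> = inverse ?c * norm (\<Sum>i<n. u i * m (E i) (x i) g)"
        using c by (simp only: norm_mult norm_inverse norm_of_real abs_of_pos)
      also have "\<dots> \<le> inverse ?c * norm U"
        using c u(1) by (intro mult_left_mono semivariation_le U E x g) auto
      also have "\<dots> \<le> 1" using c by (simp add: field_simps)
      finally show "norm (Q n g) \<le> 1" .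
    qed
    then have "norm (f (Q n)) \<le> nrm (dual (dual Y')) f"
      using Q[of n] by (intro dual_apply_le[OF wf_dual(2) f(1)]) (simp add: unit_ball_def)
    also note f(2)
    also have "f (Q n) = inverse (of_real ?c) * (\<Sum>i<n. u i * f (m (E i) (x i)))"
      using Q[of n] by (simp add: sum_distrib_left divide_inverse mult_ac)
    also have "\<dots> = of_real (inverse ?c * (\<Sum>i<n. norm (f (m (E i) (x i)))))"
      by (simp add: u)
    also have "norm \<dots> = inverse ?c * (\<Sum>i<n. norm (f (m (E i) (x i))))"
      using c by (simp only: norm_of_real) (simp add: sum_nonneg)
    finally show ?thesis using c by (simp add: field_simps)
  qed
  then have "(\<Sum>i<n. ennreal (norm (f (m (E i) (x i))))) \<le> ennreal ?c" for n
    by (subst sum_ennreal) (auto intro!: ennreal_leI simp del: ennreal_plus)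
  then show "(\<Sum>i. ennreal (norm (f (m (E i) (x i))))) \<le> ennreal ?c"
    by (intro suminf_le_const) auto
qed

section \<open>From bounded semivariation to an operator on \<open>\<C>(\<Omega>,X)\<close>\<close>

context
  fixes c :: real
  assumes c: "0 < c"
    and semivariation: "\<And>(E :: nat \<Rightarrow> 'w set) x. range E \<subseteq> sets borel \<Longrightarrow> disjoint_family E \<Longrightarrow>
      (\<And>i. norm (x i) \<le> 1) \<Longrightarrow> weak_l1_norm (dual Y') (\<lambda>i. m (E i) (x i)) \<le> ennreal c"
begin

text \<open>The finite partition becomes a sequence of Borel sets, the vectors are scaled into the
  unit ball by \<open>inverse R\<close>, and the weak summing norm is tested with evaluation at
  \<open>g\<close>.\<close>

lemma sum_fibres_le:
  fixes \<tau> :: "'w \<Rightarrow> 'w"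
  assumes \<tau>: "simple_function borel \<tau>" and g: "g \<in> unit_ball Y'" and R: "0 < R" and z: "\<And>v. norm (z v) \<le> R"
  shows "(\<Sum>v\<in>range \<tau>. norm (m (\<tau> -` {v}) (z v) g)) \<le> c * R"
proof -
  have g': "g \<in> carrier Y'" using g by (simp add: unit_ball_def)
  note fib = borel_fibre[OF \<tau>] and fin = finite_range_simple[OF \<tau>]
  obtain h where h: "bij_betw h {0..<card (range \<tau>)} (range \<tau>)"
    using ex_bij_betw_nat_finite[OF fin] by blast
  let ?n = "card (range \<tau>)"
  \<comment> \<open>Indices beyond the partition get the empty set. The vectors \<open>x i\<close>
    at those indices are still admissible, since the bound on \<open>z\<close> holds at every
    point.\<close>
  define E where "E = (\<lambda>i. if i < ?n then \<tau> -` {h i} else {})"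
  define x where "x = (\<lambda>i. scaleX (of_real (inverse R)) (z (h i)))"
  have inj: "h i \<noteq> h j" if "i < ?n" "j < ?n" "i \<noteq> j" for i j
    using h that unfolding bij_betw_def inj_on_def by auto
  have E: "range E \<subseteq> sets borel" "disjoint_family E"
    using fib inj by (auto simp: E_def disjoint_family_on_def)
  have x: "norm (x i) \<le> 1" for i
  proof -
    have "norm (x i) = inverse R * norm (z (h i))"
      using R by (simp only: x_def X.norm_scale norm_of_real) simp
    also have "\<dots> \<le> inverse R * R" using z[of "h i"] R by (intro mult_left_mono) auto
    finally show ?thesis using R by simp
  qed
  have M: "m (E i) (x i) \<in> carrier (dual Y')" for i
    using E by (intro m_carrier) auto
  let ?ev = "\<lambda>Q\<in>carrier (dual Y'). Q g"
  have "(\<Sum>i<?n. ennreal (norm (?ev (m (E i) (x i))))) \<le> (\<Sum>i. ennreal (norm (?ev (m (E i) (x i)))))"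
    by (rule sum_le_suminf) auto
  also have "\<dots> \<le> weak_l1_norm (dual Y') (\<lambda>i. m (E i) (x i))"
    unfolding weak_l1_norm_def by (rule SUP_upper) (rule evaluation_unit_ball[OF wf_dual(1) g])
  also have "\<dots> \<le> ennreal c" by (rule semivariation[OF E x])
  finally have "ennreal (\<Sum>i<?n. norm (m (E i) (x i) g)) \<le> ennreal c"
    using M by (simp add: sum_ennreal)
  then have "(\<Sum>i<?n. norm (m (E i) (x i) g)) \<le> c"
    using c by (simp add: ennreal_le_iff)
  moreover have "norm (m (E i) (x i) g) = inverse R * norm (m (\<tau> -` {h i}) (z (h i)) g)" if "i < ?n" for i
  proof -
    have "m (E i) (x i) g = of_real (inverse R) * m (\<tau> -` {h i}) (z (h i)) g"
      using that unfolding E_def x_def by (simp only: if_True m_linear(2)[OF fib g'])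
    then show ?thesis using R by (simp only: norm_mult norm_of_real) simp
  qed
  ultimately have "inverse R * (\<Sum>i<?n. norm (m (\<tau> -` {h i}) (z (h i)) g)) \<le> c"
    by (simp add: sum_distrib_left)
  moreover have "(\<Sum>i<?n. norm (m (\<tau> -` {h i}) (z (h i)) g)) = (\<Sum>v\<in>range \<tau>. norm (m (\<tau> -` {v}) (z v) g))"
    using sum.reindex_bij_betw[OF h, of "\<lambda>v. norm (m (\<tau> -` {v}) (z v) g)"] by (simp add: atLeast0LessThan)
  ultimately show ?thesis using R by (simp add: field_simps)
qed

text \<open>All integrals are replaced by Riemann sums over one tagged partition. Interchanging the
  sums collects \<open>m\<close> of a fibre, applied to the value of the tensor sum at the tag, and
  this is the quantity that (b) controls. The norming \<open>g\<close> is fixed first, so the bounds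
  \<open>M j\<close> do not depend on \<open>e\<close>.\<close>

lemma tensor_sum_bound:
  fixes \<phi> :: "'j \<Rightarrow> 'w \<Rightarrow>\<^sub>C 'k"
  assumes J: "finite J"
  shows "norm (\<Sum>j\<in>J. T (\<phi> j) (x j)) \<le> c * norm (\<Sum>j\<in>J. cont_tensor scaleX (\<phi> j) (x j))"
proof -
  define f where "f = (\<Sum>j\<in>J. cont_tensor scaleX (\<phi> j) (x j))"
  have f_apply: "apply_bcontfun f w = (\<Sum>j\<in>J. scaleX (apply_bcontfun (\<phi> j) w) (x j))" for w
    by (simp add: f_def apply_bcontfun_sum X.cont_tensor_apply)
  obtain g where g: "g \<in> unit_ball Y'" "norm (\<Sum>j\<in>J. T (\<phi> j) (x j)) \<le> norm (g (\<Sum>j\<in>J. T (\<phi> j) (x j)))"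
    by (rule Y.norming_functional)
  have g': "g \<in> carrier Y'" using g by (simp add: unit_ball_def)
  have "\<exists>\<mu>. represents \<mu> (\<lambda>\<phi>. g (T \<phi> (x j))) \<and> (\<forall>E\<in>sets borel. m E (x j) g = \<mu> E)" for j
    by (rule m_represents[OF g', of "x j"]) blast
  then obtain \<mu> where \<mu>: "\<And>j. represents (\<mu> j) (\<lambda>\<phi>. g (T \<phi> (x j)))"
    "\<And>j E. E \<in> sets borel \<Longrightarrow> m E (x j) g = \<mu> j E" by metis
  have reg: "regular_borel_measure (\<mu> j)" for j using \<mu>(1) by (simp add: represents_def)
  have "\<exists>M. \<forall>A\<in>sets borel. norm (\<mu> j A) \<le> M" for j
    by (rule regular_borel_measure_bounded[OF compact reg[of j]]) blast
  then obtain M where M: "\<And>j A. A \<in> sets borel \<Longrightarrow> norm (\<mu> j A) \<le> M j" by metis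
  have "norm (g (\<Sum>j\<in>J. T (\<phi> j) (x j))) \<le> c * norm f"
  proof (rule le_of_le_add_mult)
    fix e :: real assume e: "0 < e"
    \<comment> \<open>Intersecting over \<open>J\<close> gives a partition on whose pieces every
      \<open>\<phi> j\<close> is within \<open>e\<close> of its value at the tag.\<close>
    define V where "V = (\<lambda>w. \<Inter>j\<in>J. apply_bcontfun (\<phi> j) -` ball (apply_bcontfun (\<phi> j) w) e)"
    have V: "open (V w)" "w \<in> V w" for w
      unfolding V_def using J e by (auto intro!: open_INT open_vimage)
    obtain \<tau> where \<tau>: "simple_function borel \<tau>" "\<And>w. w \<in> V (\<tau> w)"
      by (rule simple_function_tag[OF compact V]) (rule that)
    note fib = borel_fibre[OF \<tau>(1)]
    let ?I = "\<lambda>j. simple_integral_of (\<mu> j) (\<lambda>w. apply_bcontfun (\<phi> j) (\<tau> w))"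
    have near: "norm (g (T (\<phi> j) (x j)) - ?I j) \<le> 4 * e * M j" if j: "j \<in> J" for j
    proof -
      interpret additive_set_function "\<mu> j" by (rule regular_borel_measure_additive[OF reg])
      have "norm (g (T (\<phi> j) (x j)) - ?I j) \<le> 4 * e * M j + 4 * 0 * M j"
      proof (rule integral_dist_simple[where D = UNIV])
        show "has_measure_integral (\<mu> j) (apply_bcontfun (\<phi> j)) (g (T (\<phi> j) (x j)))"
          using \<mu>(1) by (simp add: represents_def)
        show "simple_function borel (\<lambda>w. apply_bcontfun (\<phi> j) (\<tau> w))"
          using simple_function_compose[OF \<tau>(1), of "apply_bcontfun (\<phi> j)"] by (simp add: comp_def)
        show "norm (apply_bcontfun (\<phi> j) w - apply_bcontfun (\<phi> j) (\<tau> w)) \<le> e" for w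
          using \<tau>(2)[of w] j by (auto simp: V_def dist_norm norm_minus_commute intro: less_imp_le)
      qed (use e M in auto)
      then show ?thesis by simp
    qed
    have I: "?I j = (\<Sum>v\<in>range \<tau>. m (\<tau> -` {v}) (scaleX (apply_bcontfun (\<phi> j) v) (x j)) g)" for j
    proof -
      interpret additive_set_function "\<mu> j" by (rule regular_borel_measure_additive[OF reg])
      have "?I j = (\<Sum>v\<in>range \<tau>. apply_bcontfun (\<phi> j) v * \<mu> j (\<tau> -` {v}))"
        by (rule simple_integral_of_comp[OF \<tau>(1)])
      then show ?thesis by (simp add: m_linear(2)[OF fib g'] \<mu>(2)[OF fib])
    qed
    have "(\<Sum>j\<in>J. ?I j) = (\<Sum>v\<in>range \<tau>. m (\<tau> -` {v}) (apply_bcontfun f v) g)"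
      unfolding I f_apply m_sum[OF fib g'] by (rule sum.swap)
    also have "norm \<dots> \<le> (\<Sum>v\<in>range \<tau>. norm (m (\<tau> -` {v}) (apply_bcontfun f v) g))"
      by (rule norm_sum)
    also have "\<dots> \<le> c * (norm f + e)"
    proof (rule sum_fibres_le[OF \<tau>(1) g(1)])
      \<comment> \<open>The radius must be positive even when \<open>f\<close> is zero.\<close>
      show "0 < norm f + e" using e by (simp add: add_nonneg_pos)
      show "norm (apply_bcontfun f v) \<le> norm f + e" for v
        using norm_bounded[of f v] e by simp
    qed
    finally have 1: "norm (\<Sum>j\<in>J. ?I j) \<le> c * (norm f + e)" .
    have 2: "norm (\<Sum>j\<in>J. g (T (\<phi> j) (x j)) - ?I j) \<le> (\<Sum>j\<in>J. 4 * e * M j)"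
      by (rule sum_norm_le) (rule near)
    have "g (\<Sum>j\<in>J. T (\<phi> j) (x j)) = (\<Sum>j\<in>J. ?I j) + (\<Sum>j\<in>J. g (T (\<phi> j) (x j)) - ?I j)"
      by (simp add: Y'_sum[OF g'] sum_subtractf)
    also have "norm \<dots> \<le> c * (norm f + e) + (\<Sum>j\<in>J. 4 * e * M j)"
      by (rule norm_triangle_mono[OF 1 2])
    also have "\<dots> = c * norm f + e * (c + (\<Sum>j\<in>J. 4 * M j))"
      by (simp add: algebra_simps sum_distrib_left)
    finally show "norm (g (\<Sum>j\<in>J. T (\<phi> j) (x j))) \<le> c * norm f + e * (c + (\<Sum>j\<in>J. 4 * M j))" .
  qed
  then show ?thesis using g(2) unfolding f_def by (rule order_trans[rotated])
qed

lemma ex_operator: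
  "\<exists>U \<in> bounded_ops (cont_scale scaleX) scaleY. associated_op scaleX U = S"
proof -
  \<comment> \<open>The graph of the prescribed map on elementary tensors; its real span is the
    relation to be closed.\<close>
  define B where "B = {p. \<exists>\<phi> x. p = (cont_tensor scaleX \<phi> x, T \<phi> x)}"
  have scale_tensor: "cont_scale scaleX a (cont_tensor scaleX \<phi> x) = cont_tensor scaleX \<phi> (scaleX a x)" for a x and \<phi> :: "'w \<Rightarrow>\<^sub>C 'k"
    by (rule bcontfun_eqI) (simp add: X.cont_scale_apply X.cont_tensor_apply mult.commute)
  have scaleR_tensor: "r *\<^sub>R cont_tensor scaleX \<phi> x = cont_tensor scaleX \<phi> (r *\<^sub>R x)" for r x and \<phi> :: "'w \<Rightarrow>\<^sub>C 'k"
    by (rule bcontfun_eqI) (simp add: X.cont_tensor_apply linear_simps(5)[OF X.bounded_linear_scale_right])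
  have bound: "norm y \<le> c * norm f" if fy: "(f, y) \<in> span B" for f y
  proof -
    \<comment> \<open>The real coefficients \<open>r p\<close> are moved onto the vectors, which
      turns an element of the span into a plain sum of tensors.\<close>
    obtain t r where t: "finite t" "t \<subseteq> B" "(f, y) = (\<Sum>p\<in>t. r p *\<^sub>R p)"
      using fy unfolding span_explicit mem_Collect_eq by (elim exE conjE) (rule that)
    have "\<forall>p\<in>t. \<exists>\<phi> x. p = (cont_tensor scaleX \<phi> x, T \<phi> x)" using t(2) by (auto simp: B_def)
    then obtain \<phi> x where p: "\<And>p. p \<in> t \<Longrightarrow> p = (cont_tensor scaleX (\<phi> p) (x p), T (\<phi> p) (x p))"
      by metis
    have "f = (\<Sum>p\<in>t. r p *\<^sub>R fst p)" "y = (\<Sum>p\<in>t. r p *\<^sub>R snd p)"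
      using arg_cong[OF t(3), of fst] arg_cong[OF t(3), of snd] by (simp_all add: fst_sum snd_sum)
    moreover have "r p *\<^sub>R fst p = cont_tensor scaleX (\<phi> p) (r p *\<^sub>R x p)" if "p \<in> t" for p
      by (subst p[OF that]) (simp add: scaleR_tensor)
    moreover have "r p *\<^sub>R snd p = T (\<phi> p) (r p *\<^sub>R x p)" if "p \<in> t" for p
      by (subst p[OF that]) (simp add: blinfun.scaleR_right)
    ultimately show ?thesis using tensor_sum_bound[OF t(1), of \<phi> "\<lambda>p. r p *\<^sub>R x p"] by simp
  qed
  have dense: "\<exists>g y. (g, y) \<in> span B \<and> norm (f - g) < e" if e: "0 < e" for f e
  proof -
    obtain C \<phi> where C: "finite (C :: 'w set)"
      "norm (f - (\<Sum>c\<in>C. cont_tensor scaleX (\<phi> c) (apply_bcontfun f c))) \<le> e / 2"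
      by (rule X.cont_tensor_dense[OF compact half_gt_zero[OF e]])
    let ?g = "\<Sum>c\<in>C. cont_tensor scaleX (\<phi> c) (apply_bcontfun f c)"
    let ?y = "\<Sum>c\<in>C. T (\<phi> c) (apply_bcontfun f c)"
    have "(?g, ?y) = (\<Sum>c\<in>C. (cont_tensor scaleX (\<phi> c) (apply_bcontfun f c), T (\<phi> c) (apply_bcontfun f c)))"
      by (simp add: prod_eq_iff fst_sum snd_sum)
    also have "\<dots> \<in> span B"
      by (intro span_sum span_base) (auto simp: B_def)
    finally have "(?g, ?y) \<in> span B \<and> norm (f - ?g) < e"
      using C(2) e by auto
    then show ?thesis by (intro exI)
  qed
  obtain U where U: "\<And>f. (f, blinfun_apply U f) \<in> closure (span B)"
    "\<And>f y. (f, y) \<in> closure (span B) \<Longrightarrow> y = blinfun_apply U f"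
  proof (rule dense_relation_extension[OF subspace_span[of B]])
    show "norm y \<le> c * norm g" if "(g, y) \<in> span B" for g y using that by (rule bound)
    show "\<exists>g y. (g, y) \<in> span B \<and> norm (f - g) < e" if "0 < e" for f e using that by (rule dense)
  qed (rule that)
  have tensor: "blinfun_apply U (cont_tensor scaleX \<phi> x) = T \<phi> x" for \<phi> x
  proof -
    have "(cont_tensor scaleX \<phi> x, T \<phi> x) \<in> span B" by (intro span_base) (auto simp: B_def)
    then have "(cont_tensor scaleX \<phi> x, T \<phi> x) \<in> closure (span B)" using closure_subset by (rule subsetD[rotated])
    from U(2)[OF this] show ?thesis ..
  qed
  have U_scale: "blinfun_apply U (cont_scale scaleX a f) = scaleY a (blinfun_apply U f)" for a f
  proof -
    \<comment> \<open>The closure argument yields real linearity only. Multiplication by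
      \<open>a\<close> in both coordinates maps \<open>B\<close> into itself, hence also the closure
      of its span, which is the graph of \<open>U\<close>.\<close>
    define h where "h = (\<lambda>p :: ('w \<Rightarrow>\<^sub>C 'x) \<times> 'y. (cont_scale scaleX a (fst p), scaleY a (snd p)))"
    have "bounded_linear (cont_scale scaleX a :: ('w \<Rightarrow>\<^sub>C 'x) \<Rightarrow> _)"
    proof (rule bounded_linear_intro[of _ "norm a"])
      show "cont_scale scaleX a (f + g) = cont_scale scaleX a f + cont_scale scaleX a g" for f g :: "'w \<Rightarrow>\<^sub>C 'x"
        by (rule bcontfun_eqI) (simp add: X.cont_scale_apply X.scale_right_distrib)
      show "cont_scale scaleX a (r *\<^sub>R f) = r *\<^sub>R cont_scale scaleX a f" for r and f :: "'w \<Rightarrow>\<^sub>C 'x"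
        by (rule bcontfun_eqI) (simp add: X.cont_scale_apply linear_simps(5)[OF X.bounded_linear_scale_right])
    qed (simp add: X.norm_cont_scale mult.commute)
    then have h: "bounded_linear h"
      unfolding h_def using Y.bounded_linear_scale_right
      by (intro bounded_linear_Pair) (auto intro: bounded_linear_compose bounded_linear_fst bounded_linear_snd)
    have "h ` B \<subseteq> B"
      unfolding B_def h_def by (force simp: scale_tensor T_scale)
    then have "h ` span B \<subseteq> span B"
      using span_mono[of "h ` B" B] linear_span_image[OF bounded_linear.linear[OF h], of B] by simp
    then have "h ` closure (span B) \<subseteq> closure (span B)"
      using order_trans[OF closure_bounded_linear_image_subset[OF h] closure_mono] by simp
    then have "h (f, blinfun_apply U f) \<in> closure (span B)" by (rule subsetD) (rule imageI, rule U(1))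
    then have "(cont_scale scaleX a f, scaleY a (blinfun_apply U f)) \<in> closure (span B)" by (simp add: h_def)
    from U(2)[OF this] show ?thesis ..
  qed
  have "U \<in> bounded_ops (cont_scale scaleX) scaleY"
    unfolding bounded_ops_def Vector_Spaces.linear_iff
    using X.vector_space_cont_scale Y.vector_space_axioms U_scale by (auto simp: blinfun.add_right)
  moreover have "associated_op scaleX U = S"
    by (intro blinfun_eqI) (simp add: X.associated_op_apply tensor)
  ultimately show ?thesis ..
qed

end

end

theorem proposition4p4:
  fixes scaleX :: "'k::real_or_complex \<Rightarrow> 'x::banach \<Rightarrow> 'x"
    and scaleY :: "'k \<Rightarrow> 'y::banach \<Rightarrow> 'y"
    and S :: "('w::t2_space \<Rightarrow>\<^sub>C 'k) \<Rightarrow>\<^sub>L ('x \<Rightarrow>\<^sub>L 'y)"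
    and m :: "'w set \<Rightarrow> 'x \<Rightarrow> ('y \<Rightarrow> 'k) \<Rightarrow> 'k"
  assumes "banach_space_over scaleX"
    and "banach_space_over scaleY"
    and "compact (UNIV :: 'w set)"
    and "S \<in> bounded_ops (cont_scale (*)) (blinfun_scale scaleY)"
    and "range (blinfun_apply S) \<subseteq> bounded_ops scaleX scaleY"
    and "m = operator_representing_measure scaleY S"
  shows "(\<exists>U \<in> bounded_ops (cont_scale scaleX) scaleY. associated_op scaleX U = S) \<longleftrightarrow>
    (\<exists>c::real. c > 0 \<and>
      (\<forall>(E :: nat \<Rightarrow> 'w set) (x :: nat \<Rightarrow> 'x).
        range E \<subseteq> sets borel \<longrightarrow> disjoint_family E \<longrightarrow> (\<forall>i. x i \<in> cball 0 1) \<longrightarrow>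
        weak_l1_norm (dual (dual (space_of scaleY))) (\<lambda>i. m (E i) (x i)) \<le> ennreal c))"
proof -
  interpret cont_operator scaleX scaleY S
    using assms by (simp add: cont_operator_def cont_operator_axioms_def)
  show ?thesis
    unfolding assms(6)
  proof
    assume "\<exists>U \<in> bounded_ops (cont_scale scaleX) scaleY. associated_op scaleX U = S"
    then obtain U where U: "U \<in> bounded_ops (cont_scale scaleX) scaleY" "associated_op scaleX U = S" by blast
    have "blinfun_apply U (cont_scale scaleX a f) = scaleY a (blinfun_apply U f)" for a f
      using U(1) unfolding bounded_ops_def Vector_Spaces.linear_iff by blast
    moreover have "blinfun_apply (blinfun_apply S \<phi>) x = blinfun_apply U (cont_tensor scaleX \<phi> x)" for \<phi> x
      using X.associated_op_apply[of U \<phi> x] U(2) by simp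
    ultimately show "\<exists>c::real. c > 0 \<and>
      (\<forall>(E :: nat \<Rightarrow> 'w set) (x :: nat \<Rightarrow> 'x).
        range E \<subseteq> sets borel \<longrightarrow> disjoint_family E \<longrightarrow> (\<forall>i. x i \<in> cball 0 1) \<longrightarrow>
        weak_l1_norm (dual (dual (space_of scaleY))) (\<lambda>i. operator_representing_measure scaleY S (E i) (x i)) \<le> ennreal c)"
      by (intro exI[of _ "norm U + 1"] conjI allI impI weak_l1_norm_le) (auto simp: add_nonneg_pos)
  next
    assume "\<exists>c::real. c > 0 \<and>
      (\<forall>(E :: nat \<Rightarrow> 'w set) (x :: nat \<Rightarrow> 'x).
        range E \<subseteq> sets borel \<longrightarrow> disjoint_family E \<longrightarrow> (\<forall>i. x i \<in> cball 0 1) \<longrightarrow>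
        weak_l1_norm (dual (dual (space_of scaleY))) (\<lambda>i. operator_representing_measure scaleY S (E i) (x i)) \<le> ennreal c)"
    then obtain c where "c > 0" "\<And>(E :: nat \<Rightarrow> 'w set) (x :: nat \<Rightarrow> 'x).
        range E \<subseteq> sets borel \<Longrightarrow> disjoint_family E \<Longrightarrow> (\<And>i. norm (x i) \<le> 1) \<Longrightarrow>
        weak_l1_norm (dual (dual (space_of scaleY))) (\<lambda>i. operator_representing_measure scaleY S (E i) (x i)) \<le> ennreal c"
      by (metis mem_cball_0)
    then show "\<exists>U \<in> bounded_ops (cont_scale scaleX) scaleY. associated_op scaleX U = S"
      by (rule ex_operator)
  qed
qed

end
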